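(* Denote by $B_*(0,r)=\{x\in\mathbb R^2:0<|x|<r\}$ the ball without its center. Let $t^*>0$ be the solution of $$\int_0^\infty e^{-u^2/t^*}\,\frac{I_0'(u)}{I_0(u)}\,\frac{u^2}{t^*}\,du=1,$$ where $I_0$ is the modified Bessel function of the first kind of order $0$ (numerically $t^*\approx8.3419$). Then $\big(\theta_0,\ B_*\big(0,\theta_0\sqrt{t^*/(2\beta)}\big)\times[0,\infty)\big)$ is an equilibrium pair for the problem described in the context.
   Context: Constants $\theta_0>0$, $\beta>0$. State space $\mathbb X=\mathbb R^2\setminus\{(0,0)\}$. Admissible controls are the constants $\theta\in(0,\theta_0]$. The state is $X^\theta=(X^{1,\theta},X^{2,\theta})$ with $dX^{i,\theta}_t=\theta\,dW^i_t$, $W^1,W^2$ independent one-dimensional Brownian motions. $\mathbb E^{t,x}$ is expectation when the state is $x$ at time $t$. The reward is $g(s,t,x)=\dfrac{|x|^2}{1+\beta(t-s)}$ and the pay-off is $$J(t,x;u,\tau)=\mathbb E^{t,x}\left[\frac{|X^u_\tau|^2}{1+\beta(\tau-t)}I_{\{\tau<\infty\}}\right].$$ For relatively open $C\subset\mathbb X$, $C\times[0,\infty)$ denotes the continuation region of all (time, state) pairs with state in $C$, and $\tau_{(u,C,s)}=\inf\{r\ge s:X^u_r\notin C\}$ ($\inf\varnothing=\infty$). For $\vartheta\in(0,\theta_0]$, $\epsilon>0$, the perturbed control $\theta_{(t,\epsilon,\vartheta)}$ equals $\vartheta$ on times $[t,t+\epsilon)$ and $\theta$ otherwise. $(\theta,C\times[0,\infty))$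 is an equilibrium iff, with $\hat\tau=\tau_{(\theta,C,t)}$: (i) $|x|^2\le J(t,x;\theta,\hat\tau)$ for all $t\ge0,x\in\mathbb X$; (ii) $\limsup_{\epsilon\downarrow0}\epsilon^{-1}\big(J(t,x;\theta,\tau_{(\theta,C,t+\epsilon)})-J(t,x;\theta,\hat\tau)\big)\le0$ for all $t\ge0,x\in\mathbb X$; (iii) $\limsup_{\epsilon\downarrow0}\epsilon^{-1}\big(J(t,x;\theta_{(t,\epsilon,\vartheta)},\tau_{(\theta_{(t,\epsilon,\vartheta)},C,t)})-J(t,x;\theta,\hat\tau)\big)\le0$ for all $t\ge0$, $x\in C$, $\vartheta\in(0,\theta_0]$. *)

theory Defs
  imports "HOL-Probability.Probability"
begin

definition brownian_motion :: "'a measure \<Rightarrow> (real \<Rightarrow> 'a \<Rightarrow> real) \<Rightarrow> bool" where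
  "brownian_motion M W \<longleftrightarrow>
     prob_space M \<and>
     (\<forall>t\<ge>0. W t \<in> borel_measurable M) \<and>
     (AE \<omega> in M. W 0 \<omega> = 0) \<and>
     (\<forall>\<omega>\<in>space M. continuous_on {0..} (\<lambda>t. W t \<omega>)) \<and>
     (\<forall>s t. 0 \<le> s \<and> s < t \<longrightarrow>
        distributed M lborel (\<lambda>\<omega>. W t \<omega> - W s \<omega>) (normal_density 0 (sqrt (t - s)))) \<and>
     (\<forall>(n::nat) (ts::nat \<Rightarrow> real). 0 \<le> ts 0 \<and> (\<forall>i<n. ts i \<le> ts (Suc i)) \<longrightarrow>
        prob_space.indep_vars M (\<lambda>_. borel) (\<lambda>i \<omega>. W (ts (Suc i)) \<omega> - W (ts i) \<omega>) {..<n})"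

text \<open>The two components are independent as processes, i.e. as random elements of the
  product space indexed by all nonnegative times.\<close>

definition planar_brownian_motion ::
  "'a measure \<Rightarrow> (real \<Rightarrow> 'a \<Rightarrow> real) \<Rightarrow> (real \<Rightarrow> 'a \<Rightarrow> real) \<Rightarrow> bool" where
  "planar_brownian_motion M W1 W2 \<longleftrightarrow>
     brownian_motion M W1 \<and> brownian_motion M W2 \<and>
     prob_space.indep_var M
       (PiM {0..} (\<lambda>_. borel)) (\<lambda>\<omega>. \<lambda>t\<in>{0..}. W1 t \<omega>)
       (PiM {0..} (\<lambda>_. borel)) (\<lambda>\<omega>. \<lambda>t\<in>{0..}. W2 t \<omega>)"

definition state_space :: "(real \<times> real) set" where
  "state_space = - {(0, 0)}"

text \<open>The state at time \<open>s \<ge> t\<close> when it starts from \<open>x\<close> at time \<open>t\<close> and the constant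
  control \<open>\<theta>\<close> is used. The law of this process is the one under which the expectation given
  state \<open>x\<close> at time \<open>t\<close> is taken.\<close>

definition state ::
  "(real \<Rightarrow> 'a \<Rightarrow> real) \<Rightarrow> (real \<Rightarrow> 'a \<Rightarrow> real) \<Rightarrow> real \<Rightarrow> real \<Rightarrow> real \<times> real
     \<Rightarrow> real \<Rightarrow> 'a \<Rightarrow> real \<times> real" where
  "state W1 W2 \<theta> t x s \<omega> =
     (fst x + \<theta> * (W1 s \<omega> - W1 t \<omega>), snd x + \<theta> * (W2 s \<omega> - W2 t \<omega>))"

text \<open>The state under the control that equals \<open>\<theta>'\<close> on \<open>[t, t + \<epsilon>)\<close> and \<open>\<theta>\<close> afterwards:
  for such a step control the stochastic integral is an explicit sum of two terms.\<close>

definition perturbed_state ::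
  "(real \<Rightarrow> 'a \<Rightarrow> real) \<Rightarrow> (real \<Rightarrow> 'a \<Rightarrow> real) \<Rightarrow> real \<Rightarrow> real \<Rightarrow> real \<Rightarrow> real
     \<Rightarrow> real \<times> real \<Rightarrow> real \<Rightarrow> 'a \<Rightarrow> real \<times> real" where
  "perturbed_state W1 W2 \<theta> \<epsilon> \<theta>' t x s \<omega> =
     (if s < t + \<epsilon> then state W1 W2 \<theta>' t x s \<omega>
      else state W1 W2 \<theta> (t + \<epsilon>) (state W1 W2 \<theta>' t x (t + \<epsilon>) \<omega>) s \<omega>)"

text \<open>In \<open>ereal\<close> the infimum of the empty set is \<open>\<infinity>\<close>.\<close>

definition exit_time ::
  "(real \<Rightarrow> 'a \<Rightarrow> real \<times> real) \<Rightarrow> (real \<times> real) set \<Rightarrow> real \<Rightarrow> 'a \<Rightarrow> ereal" where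
  "exit_time X C s \<omega> = (INF r\<in>{r. s \<le> r \<and> X r \<omega> \<notin> C}. ereal r)"

definition reward :: "real \<Rightarrow> real \<Rightarrow> real \<Rightarrow> real \<times> real \<Rightarrow> real" where
  "reward \<beta> s t x = (norm x)\<^sup>2 / (1 + \<beta> * (t - s))"

text \<open>The reward is nonnegative, so its expectation is taken in \<open>[0, \<infinity>]\<close>; it is embedded in
  \<open>ereal\<close> because differences of pay-offs are needed.\<close>

definition payoff ::
  "'a measure \<Rightarrow> real \<Rightarrow> real \<Rightarrow> (real \<Rightarrow> 'a \<Rightarrow> real \<times> real) \<Rightarrow> ('a \<Rightarrow> ereal) \<Rightarrow> ereal" where
  "payoff M \<beta> t X \<tau> =
     enn2ereal (\<integral>\<^sup>+ \<omega>. (if \<tau> \<omega> < \<infinity>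
        then ennreal (reward \<beta> t (real_of_ereal (\<tau> \<omega>)) (X (real_of_ereal (\<tau> \<omega>)) \<omega>))
        else 0) \<partial>M)"

text \<open>The set \<open>C\<close> stands for the continuation region \<open>C \<times> [0, \<infinity>)\<close>.\<close>

definition equilibrium ::
  "'a measure \<Rightarrow> (real \<Rightarrow> 'a \<Rightarrow> real) \<Rightarrow> (real \<Rightarrow> 'a \<Rightarrow> real) \<Rightarrow> real \<Rightarrow> real
     \<Rightarrow> real \<Rightarrow> (real \<times> real) set \<Rightarrow> bool" where
  "equilibrium M W1 W2 \<beta> \<theta>0 \<theta> C \<longleftrightarrow>
     \<theta> \<in> {0<..\<theta>0} \<and>
     openin (top_of_set state_space) C \<and>
     (let X = (\<lambda>t x. state W1 W2 \<theta> t x);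
          Y = (\<lambda>\<epsilon> \<theta>' t x. perturbed_state W1 W2 \<theta> \<epsilon> \<theta>' t x);
          J = (\<lambda>t x. payoff M \<beta> t (X t x) (exit_time (X t x) C t))
      in
        (\<forall>t\<ge>0. \<forall>x\<in>state_space. ereal ((norm x)\<^sup>2) \<le> J t x) \<and>
        (\<forall>t\<ge>0. \<forall>x\<in>state_space.
           Limsup (at_right 0) (\<lambda>\<epsilon>. ereal (inverse \<epsilon>) *
             (payoff M \<beta> t (X t x) (exit_time (X t x) C (t + \<epsilon>)) - J t x)) \<le> 0) \<and>
        (\<forall>t\<ge>0. \<forall>x\<in>C. \<forall>\<theta>'\<in>{0<..\<theta>0}.
           Limsup (at_right 0) (\<lambda>\<epsilon>. ereal (inverse \<epsilon>) *
             (payoff M \<beta> t (Y \<epsilon> \<theta>' t x) (exit_time (Y \<epsilon> \<theta>' t x) C t) - J t x)) \<le> 0))"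

text \<open>The modified Bessel function of the first kind of integer order.\<close>

definition bessel_I :: "nat \<Rightarrow> real \<Rightarrow> real" where
  "bessel_I n x = (\<Sum>k. (x / 2) ^ (2 * k + n) / (fact k * fact (k + n)))"

definition is_t_star :: "real \<Rightarrow> bool" where
  "is_t_star t \<longleftrightarrow> t > 0 \<and>
     (LBINT u:{0..}. exp (- u\<^sup>2 / t) * (deriv (bessel_I 0) u / bessel_I 0 u) * (u\<^sup>2 / t)) = 1"

definition punctured_ball :: "real \<Rightarrow> (real \<times> real) set" where
  "punctured_ball r = {x. 0 < norm x \<and> norm x < r}"

end

theory Submission
  imports Defs
begin

text \<open>Writing \<open>1 / (1 + \<beta> s)\<close> as a mixture of exponentials turns the expected reward of stopping
  at the radius \<open>R\<close> into a mixture \<open>H\<close> of Laplace transforms of the hitting time of \<open>R\<close>, that is,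
  of ratios of \<open>I\<^sub>0\<close>. The equation for \<open>t\<^sup>*\<close> says that \<open>H\<close> fits \<open>r\<^sup>2\<close> smoothly at \<open>R\<close>; as \<open>I\<^sub>0\<close> is a
  power series with nonnegative coefficients, \<open>H\<close> is logarithmically convex in \<open>ln r\<close>, so it
  dominates \<open>r\<^sup>2\<close>. Since \<open>I\<^sub>0\<close> is an average of exponentials over the circle, \<open>H\<close> is a martingale
  along the process with volatility \<open>\<theta>\<close> and a supermartingale for smaller volatilities. This bounds
  the pay-off of every perturbed strategy started inside the ball by \<open>H + o(\<epsilon>)\<close>. The origin is never
  hit, hence the pay-off of the unperturbed strategy is at least \<open>H\<close>. Optional stopping is only ever
  applied on time grids, and only pointwise bounds of the pay-off by measurable functions are
  integrated, so exit times need not be measurable.\<close>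

subsection \<open>The modified Bessel function of order zero\<close>

text \<open>The discount restarts at the current time, so the problem is time-inconsistent and no
  recursion for the value is available. Each exponential of the mixture is time-consistent, however,
  and the delay \<open>s\<close> in \<open>H s r\<close> records how elapsed time has reweighted the
  mixture. The variable v, with v^2 exponentially distributed, makes the denominators I0 (sqrt t *
  v), as in the equation for t after rescaling. Smooth fit holds at delay 0 only: after a delay s
  the slope of \<open>H\<close> at R may fall short of that of the reward, but by O(s) at most. A
  perturbation of length \<epsilon> thus meets a shortfall of order \<epsilon> times the overshoot
  beyond R. The overshoot is of order sqrt \<epsilon>, so the loss is o(\<epsilon>), even for a
  start on the circle. That \<open>H\<close> dominates the squared radius follows without second
  derivatives: the tangent-line inequality for the exponential holds term by term in the series of
  I0 and survives averaging.\<close>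

abbreviation I0 :: "real \<Rightarrow> real" where "I0 \<equiv> bessel_I 0"

definition bterm :: "real \<Rightarrow> nat \<Rightarrow> real" where
  "bterm u k = (u / 2) ^ (2 * k) / (fact k)\<^sup>2"

text \<open>\<open>bessel_w u\<close> is u * I0'(u) / I0(u), the derivative of ln I0 with respect to
  ln u. The series form reads it as the mean of 2k under the weights
  \<open>bterm u k / I0 u\<close>, which is what the convexity arguments use;
  \<open>deriv_I0\<close> makes the link to \<open>deriv\<close>.\<close>

definition bessel_w :: "real \<Rightarrow> real" where
  "bessel_w u = (\<Sum>k. 2 * real k * bterm u k) / I0 u"

section \<open>The series of I0 and the moments of its index\<close>

lemma bterm_nonneg: "bterm u k \<ge> 0"
  by (simp add: bterm_def power_mult)

lemma bterm_0 [simp]: "bterm u 0 = 1"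
  by (simp add: bterm_def)

text \<open>Bessel's equation at the level of coefficients. It expresses k^2 times a term by the
  preceding term, so the second and third moments of the index reduce to lower ones.\<close>

lemma bterm_Suc: "(real (Suc k))\<^sup>2 * bterm u (Suc k) = (u / 2)\<^sup>2 * bterm u k"
proof -
  have "fact (Suc k) = real (Suc k) * fact k" by (simp only: fact_Suc of_nat_mult)
  moreover have "(u / 2) ^ (2 * Suc k) = (u / 2)\<^sup>2 * (u / 2) ^ (2 * k)"
    by (simp add: power_add[symmetric])
  moreover have "real (Suc k) \<noteq> 0" by simp
  ultimately show ?thesis
    unfolding bterm_def by (simp only: power_mult_distrib) (simp del: of_nat_Suc)
qed

lemma bterm_scale: "bterm (\<rho> * u) k = \<rho> ^ (2 * k) * bterm u k"
  by (simp add: bterm_def power_divide power_mult_distrib)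

lemma summable_bterm: "summable (bterm u)"
proof (rule summable_comparison_test)
  show "\<exists>N. \<forall>n\<ge>N. norm (bterm u n) \<le> inverse (fact n) * ((u/2)\<^sup>2) ^ n"
  proof (intro exI[of _ 0] allI impI)
    fix n :: nat
    have "(fact n :: real) \<le> (fact n)\<^sup>2"
      using fact_ge_1[of n, where 'a=real] by (simp add: power2_eq_square)
    then have "((u/2)\<^sup>2) ^ n / (fact n)\<^sup>2 \<le> ((u/2)\<^sup>2) ^ n / fact n"
      by (intro divide_left_mono) auto
    then show "norm (bterm u n) \<le> inverse (fact n) * ((u/2)\<^sup>2) ^ n"
      using bterm_nonneg[of u n] unfolding bterm_def power_mult
      by (simp only: real_norm_def abs_of_nonneg divide_inverse mult.commute)
  qed
  show "summable (\<lambda>n. inverse (fact n) * ((u/2)\<^sup>2) ^ n)"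
    by (rule summable_exp)
qed

lemma I0_eq: "I0 u = suminf (bterm u)"
  unfolding bessel_I_def bterm_def by (simp add: power2_eq_square)

lemma bterm_sums: "bterm u sums I0 u"
  using summable_bterm I0_eq by (simp add: summable_sums)

lemma bterm_sq_sums: "(\<lambda>k. (real k)\<^sup>2 * bterm u k) sums ((u / 2)\<^sup>2 * I0 u)"
proof -
  have "(\<lambda>k. (real (Suc k))\<^sup>2 * bterm u (Suc k)) sums ((u / 2)\<^sup>2 * I0 u)"
    unfolding bterm_Suc by (intro sums_mult bterm_sums)
  then show ?thesis by (subst (asm) sums_Suc_iff) simp
qed

lemma summable_k_bterm: "summable (\<lambda>k. real k * bterm u k)"
proof (rule summable_comparison_test)
  show "\<exists>N. \<forall>n\<ge>N. norm (real n * bterm u n) \<le> (real n)\<^sup>2 * bterm u n"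
  proof (intro exI[of _ 0] allI impI)
    fix n :: nat
    have "real n \<le> (real n)\<^sup>2" by (cases n) (auto simp: power2_eq_square)
    then show "norm (real n * bterm u n) \<le> (real n)\<^sup>2 * bterm u n"
      using bterm_nonneg[of u n] by (simp add: mult_right_mono)
  qed
  show "summable (\<lambda>n. (real n)\<^sup>2 * bterm u n)" using bterm_sq_sums sums_summable by blast
qed

text \<open>One factor k + 1 is left after the recursion has absorbed two, so the third moment
  closes on the first moment and the total mass.\<close>

lemma bterm_cube_sums:
  "(\<lambda>k. (real k)^3 * bterm u k) sums ((u / 2)\<^sup>2 * ((\<Sum>k. real k * bterm u k) + I0 u))"
proof -
  have "(real (Suc k))^3 * bterm u (Suc k) = (u / 2)\<^sup>2 * (real k * bterm u k + bterm u k)" for k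
  proof -
    have "(real (Suc k))^3 * bterm u (Suc k) = real (Suc k) * ((real (Suc k))\<^sup>2 * bterm u (Suc k))"
      by (simp only: power3_eq_cube power2_eq_square mult.assoc)
    then show ?thesis unfolding bterm_Suc by (simp add: algebra_simps)
  qed
  moreover have "(\<lambda>k. (u / 2)\<^sup>2 * (real k * bterm u k + bterm u k)) sums
      ((u / 2)\<^sup>2 * ((\<Sum>k. real k * bterm u k) + I0 u))"
    by (intro sums_mult sums_add summable_sums summable_k_bterm bterm_sums)
  ultimately have "(\<lambda>k. (real (Suc k))^3 * bterm u (Suc k)) sums
      ((u / 2)\<^sup>2 * ((\<Sum>k. real k * bterm u k) + I0 u))" by simp
  then show ?thesis by (subst (asm) sums_Suc_iff) simp
qed

lemma I0_ge_term: "bterm u k \<le> I0 u"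
  unfolding I0_eq using sum_le_suminf[OF summable_bterm, of "{k}"] bterm_nonneg by simp

lemma I0_ge_1: "1 \<le> I0 u"
  using I0_ge_term[of u 0] by simp

lemma I0_pos [simp]: "0 < I0 u"
  using I0_ge_1[of u] by linarith

lemma I0_nonneg [simp]: "0 \<le> I0 u"
  using I0_pos[of u] by linarith

lemma I0_nz [simp]: "I0 u \<noteq> 0"
  using I0_pos[of u] by linarith

text \<open>The single term k = 2. Fourth-power growth is what turns the exponential martingale into
  an exit probability of order \<epsilon>^2.\<close>

lemma I0_ge_pow4: "(u / 2) ^ 4 / 4 \<le> I0 u"
  using I0_ge_term[of u 2] by (simp add: bterm_def)

lemma I0_mono: "\<bar>u\<bar> \<le> \<bar>v\<bar> \<Longrightarrow> I0 u \<le> I0 v"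
  unfolding I0_eq
proof (rule suminf_le[OF _ summable_bterm summable_bterm])
  fix n assume "\<bar>u\<bar> \<le> \<bar>v\<bar>"
  then have "u\<^sup>2 \<le> v\<^sup>2" by (simp add: abs_le_square_iff)
  then show "bterm u n \<le> bterm v n"
    by (auto simp: bterm_def power_mult power_divide intro!: divide_right_mono power_mono)
qed

lemma k_bterm_sums: "(\<lambda>k. 2 * real k * bterm u k) sums (bessel_w u * I0 u)"
  using summable_sums[OF summable_mult[OF summable_k_bterm, of 2 u]]
  by (simp add: bessel_w_def mult.assoc)

lemma k_bterm_suminf: "(\<Sum>k. real k * bterm u k) = bessel_w u * I0 u / 2"
  using sums_unique[OF k_bterm_sums[of u]] suminf_mult[OF summable_k_bterm, of 2 u]
  by (simp add: mult.assoc)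

lemma bessel_w_nonneg: "0 \<le> bessel_w u"
  unfolding bessel_w_def using bterm_nonneg I0_pos[of u]
  by (intro divide_nonneg_nonneg suminf_nonneg sums_summable[OF k_bterm_sums]) auto

text \<open>For natural numbers k \<le> k^2, which bounds the first moment by the second, and the
  second is known exactly.\<close>

lemma bessel_w_le: "bessel_w u \<le> u\<^sup>2 / 2"
proof -
  have "bessel_w u * I0 u \<le> 2 * ((u / 2)\<^sup>2 * I0 u)"
  proof (rule sums_le[OF _ k_bterm_sums sums_mult[OF bterm_sq_sums]])
    fix n
    have "real n \<le> (real n)\<^sup>2" by (cases n) (auto simp: power2_eq_square)
    then show "2 * real n * bterm u n \<le> 2 * ((real n)\<^sup>2 * bterm u n)"
      using bterm_nonneg[of u n] by (simp add: mult_right_mono)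
  qed
  then have "bessel_w u * I0 u \<le> (u\<^sup>2 / 2) * I0 u" by (simp add: power_divide)
  then show ?thesis using I0_pos mult_le_cancel_right_pos by blast
qed

text \<open>The sum of k (k - u/2)^2 \<open>bterm u k\<close> is nonnegative. Expanding it involves
  the third, second and first moments, all affine in the first, so the inequality can be solved for
  \<open>bessel_w u\<close>.\<close>

lemma bessel_w_ge: assumes "0 < u" shows "u - 1 \<le> bessel_w u"
proof -
  define E where "E = bessel_w u * I0 u / 2"
  have s: "(\<lambda>k. ((real k)^3 * bterm u k - 2 * (u/2) * ((real k)\<^sup>2 * bterm u k)) + (u/2)\<^sup>2 * (real k
      * bterm u k))
     sums (((u / 2)\<^sup>2 * (E + I0 u) - 2 * (u/2) * ((u / 2)\<^sup>2 * I0 u)) + (u/2)\<^sup>2 * E)"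
    using bterm_cube_sums[of u] summable_sums[OF summable_k_bterm[of u]]
    unfolding E_def k_bterm_suminf by (intro sums_add sums_diff sums_mult bterm_sq_sums) auto
  have nn: "0 \<le> ((real k)^3 * bterm u k - 2 * (u/2) * ((real k)\<^sup>2 * bterm u k)) + (u/2)\<^sup>2 * (real k
      * bterm u k)" for k
  proof -
    have "((real k)^3 * bterm u k - 2 * (u/2) * ((real k)\<^sup>2 * bterm u k)) + (u/2)\<^sup>2 * (real k *
        bterm u k)
        = real k * (real k - u / 2)\<^sup>2 * bterm u k"
      by (simp add: power2_eq_square power3_eq_cube algebra_simps)
    then show ?thesis using bterm_nonneg by simp
  qed
  have "0 \<le> ((u / 2)\<^sup>2 * (E + I0 u) - 2 * (u/2) * ((u / 2)\<^sup>2 * I0 u)) + (u/2)\<^sup>2 * E"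
    by (rule sums_le[OF nn sums_zero s])
  also have "\<dots> = (u/2)\<^sup>2 * (2 * E + I0 u - u * I0 u)" by (simp add: algebra_simps)
  finally have "0 \<le> 2 * E + I0 u - u * I0 u" using assms by (simp add: zero_le_mult_iff)
  then have "0 \<le> (bessel_w u + 1 - u) * I0 u" by (simp add: E_def algebra_simps)
  then show ?thesis using I0_pos[of u] by (auto simp: zero_le_mult_iff)
qed

text \<open>Convexity of exp, after writing \<rho>^(2k) as \<rho> powr m times exp ((2k - m) ln
  \<rho>). The real exponent m is free: m = 2 compares with the reward, m =
  \<open>bessel_w u\<close> removes the linear term on average.\<close>

lemma I0_tangent_aux:
  assumes "0 < \<rho>"
  shows "\<rho> ^ (2 * k) \<ge> \<rho> powr m * (1 + (2 * real k - m) * ln \<rho>)"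
proof -
  have "\<rho> ^ (2 * k) = \<rho> powr m * exp ((2 * real k - m) * ln \<rho>)"
    using assms by (simp add: powr_def powr_realpow[symmetric] exp_add[symmetric] algebra_simps)
  moreover have "1 + (2 * real k - m) * ln \<rho> \<le> exp ((2 * real k - m) * ln \<rho>)"
    by (rule exp_ge_add_one_self)
  ultimately show ?thesis by (metis mult_left_mono powr_ge_zero)
qed

lemma I0_tangent_sums:
  "(\<lambda>k. \<rho> powr m * ((1 + (2 * real k - m) * ln \<rho>)) * bterm u k) sums
      (\<rho> powr m * I0 u * (1 + (bessel_w u - m) * ln \<rho>))"
proof -
  have "(\<lambda>k. \<rho> powr m * (((1 - m * ln \<rho>) * bterm u k) + ln \<rho> * (2 * real k * bterm u k))) sums
      (\<rho> powr m * ((1 - m * ln \<rho>) * I0 u + ln \<rho> * (bessel_w u * I0 u)))"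
    by (intro sums_mult sums_add bterm_sums k_bterm_sums)
  then show ?thesis by (simp add: algebra_simps)
qed

text \<open>The tangent line inequality for the exponential, averaged over the weights
  \<open>bterm u k / I0 u\<close>, whose mean is \<open>bessel_w u / 2\<close>.\<close>

lemma I0_tangent:
  assumes "0 < \<rho>"
  shows "\<rho> powr m * I0 u * (1 + (bessel_w u - m) * ln \<rho>) \<le> I0 (\<rho> * u)"
proof (rule sums_le[OF _ I0_tangent_sums bterm_sums])
  fix k
  show "\<rho> powr m * (1 + (2 * real k - m) * ln \<rho>) * bterm u k \<le> bterm (\<rho> * u) k"
    unfolding bterm_scale using I0_tangent_aux[OF assms] bterm_nonneg by (intro mult_right_mono) auto
qed

section \<open>Strict monotonicity of the logarithmic derivative\<close>

lemma bessel_w_pos: assumes "u \<noteq> 0" shows "0 < bessel_w u"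
proof -
  have "0 < (\<Sum>k. 2 * real k * bterm u k)"
    using assms by (intro suminf_pos2[where i=1] sums_summable[OF k_bterm_sums])
      (auto simp: bterm_nonneg bterm_def)
  then show ?thesis by (simp add: bessel_w_def)
qed

text \<open>At m = \<open>bessel_w u\<close> the linear term averages to zero. Strictness in one
  term suffices, and k = 0 serves because its deviation from the mean is -
  \<open>bessel_w u\<close>, which is nonzero.\<close>

lemma I0_tangent_strict:
  assumes "0 < \<rho>" "\<rho> \<noteq> 1" "u \<noteq> 0"
  shows "\<rho> powr bessel_w u * I0 u < I0 (\<rho> * u)"
proof -
  let ?m = "bessel_w u"
  let ?f = "\<lambda>k. bterm (\<rho> * u) k - \<rho> powr ?m * (1 + (2 * real k - ?m) * ln \<rho>) * bterm u k"
  have s: "?f sums (I0 (\<rho> * u) - \<rho> powr ?m * I0 u * (1 + (?m - ?m) * ln \<rho>))"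
    by (intro sums_diff bterm_sums I0_tangent_sums)
  have nz: "?m * ln \<rho> \<noteq> 0" using assms bessel_w_pos[of u] by auto
  have "0 < suminf ?f"
  proof (rule suminf_pos2[OF sums_summable[OF s], where i = 0])
    show "0 \<le> ?f n" for n
      unfolding bterm_scale using mult_right_mono[OF I0_tangent_aux[OF assms(1), of ?m n]
          bterm_nonneg[of u n]]
      by simp
    have "1 + (- ?m * ln \<rho>) < exp (- ?m * ln \<rho>)"
      using exp_minus_greater[of "?m * ln \<rho>"] nz by simp
    then have "\<rho> powr ?m * (1 + (- ?m * ln \<rho>)) < \<rho> powr ?m * exp (- ?m * ln \<rho>)"
      using assms by simp
    also have "\<dots> = 1" using assms by (simp add: powr_def exp_add[symmetric])
    finally show "0 < ?f 0" by simp
  qed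
  then show ?thesis using sums_unique[OF s] by simp
qed

text \<open>The strict inequality is used from u to v = \<rho> u and from v back to u. Chained
  together, the two compare \<rho> powr \<open>bessel_w u\<close> with \<rho> powr
  \<open>bessel_w v\<close>.\<close>

lemma bessel_w_strict_mono:
  assumes "0 < u" "u < v" shows "bessel_w u < bessel_w v"
proof -
  define \<rho> where "\<rho> = v / u"
  have \<rho>: "1 < \<rho>" using assms by (auto simp: \<rho>_def)
  have uv: "v = \<rho> * u" "u = inverse \<rho> * v" using assms by (auto simp: \<rho>_def)
  have 1: "\<rho> powr bessel_w u * I0 u < I0 v"
    using I0_tangent_strict[of \<rho> u] \<rho> assms unfolding uv(1)[symmetric] by simp
  have 2: "inverse \<rho> powr bessel_w v * I0 v < I0 u"
    using I0_tangent_strict[of "inverse \<rho>" v] \<rho> assms unfolding uv(2)[symmetric] by simp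
  have "\<rho> powr bessel_w v * (inverse \<rho> powr bessel_w v * I0 v) < \<rho> powr bessel_w v * I0 u"
    using 2 \<rho> by (intro mult_strict_left_mono) auto
  moreover have "\<rho> powr bessel_w v * (inverse \<rho> powr bessel_w v) = 1"
    using \<rho> by (simp add: powr_mult[symmetric])
  ultimately have "I0 v < \<rho> powr bessel_w v * I0 u" by (simp add: mult.assoc[symmetric])
  with 1 have "\<rho> powr bessel_w u * I0 u < \<rho> powr bessel_w v * I0 u" by linarith
  then show ?thesis using \<rho> I0_pos[of u] by (simp add: mult_less_cancel_right)
qed

text \<open>Coefficients in powers of u^2 rather than u, so that termwise differentiation applies to
  a power series without gaps at odd exponents.\<close>

definition bcoeff :: "nat \<Rightarrow> real" where
  "bcoeff k = 1 / (4 ^ k * (fact k)\<^sup>2)"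

lemma bterm_bcoeff: "bterm u k = bcoeff k * (u\<^sup>2) ^ k"
  by (simp add: bterm_def bcoeff_def power_mult power_divide)

lemma summable_bcoeff: "summable (\<lambda>k. bcoeff k * v ^ k)"
proof (rule summable_norm_cancel)
  have "norm (bcoeff k * v ^ k) = bterm (sqrt \<bar>v\<bar>) k" for k
    by (simp add: bterm_bcoeff abs_mult power_abs) (simp add: bcoeff_def)
  then show "summable (\<lambda>k. norm (bcoeff k * v ^ k))" using summable_bterm by simp
qed

lemma I0_power_series: "I0 u = (\<Sum>k. bcoeff k * (u\<^sup>2) ^ k)"
  unfolding I0_eq bterm_bcoeff ..

lemma DERIV_power_series: "((\<lambda>v. \<Sum>k. bcoeff k * v ^ k) has_real_derivative (\<Sum>k. diffs bcoeff k * v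
    ^ k)) (at v)"
  by (rule termdiffs_strong_converges_everywhere) (rule summable_bcoeff)

lemma DERIV_I0: "(I0 has_real_derivative (\<Sum>k. diffs bcoeff k * (u\<^sup>2) ^ k) * (2 * u)) (at u)"
  unfolding I0_power_series[abs_def]
  by (rule DERIV_chain2[OF DERIV_power_series]) (auto intro!: derivative_eq_intros)

lemma bessel_w_power_series: "bessel_w u * I0 u = 2 * u\<^sup>2 * (\<Sum>k. diffs bcoeff k * (u\<^sup>2) ^ k)"
proof -
  have "(\<lambda>n. 2 * u\<^sup>2 * (of_nat n * bcoeff n * (u\<^sup>2) ^ (n - Suc 0))) sums (2 * u\<^sup>2 * (\<Sum>k. diffs
      bcoeff k * (u\<^sup>2) ^ k))"
    by (intro sums_mult diffs_equiv termdiff_converges_all summable_bcoeff)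
  moreover have "2 * u\<^sup>2 * (of_nat n * bcoeff n * (u\<^sup>2) ^ (n - Suc 0)) = 2 * real n * bterm u n" for n
    by (cases n) (simp_all only: bterm_bcoeff of_nat_0 mult_zero_left mult_zero_right diff_Suc_Suc
        diff_zero power_Suc mult.assoc mult.left_commute)
  ultimately have "(\<lambda>n. 2 * real n * bterm u n) sums (2 * u\<^sup>2 * (\<Sum>k. diffs bcoeff k * (u\<^sup>2) ^ k))"
    by (simp only:)
  then show ?thesis using sums_unique2[OF k_bterm_sums] by blast
qed

text \<open>The factor u makes the identity hold at u = 0 as well; the substitution in the integral
  for t supplies exactly this factor.\<close>

lemma deriv_I0: "u * (deriv I0 u / I0 u) = bessel_w u"
proof -
  have "u * deriv I0 u = bessel_w u * I0 u"
    unfolding bessel_w_power_series DERIV_imp_deriv[OF DERIV_I0] by (simp add: power2_eq_square)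
  then show ?thesis by (simp add: field_simps)
qed

lemma continuous_on_I0 [continuous_intros]:
  fixes f :: "'a::topological_space \<Rightarrow> real"
  assumes "continuous_on S f" shows "continuous_on S (\<lambda>x. I0 (f x))"
proof -
  have "continuous_on UNIV I0"
    by (intro DERIV_continuous_on) (rule DERIV_subset[OF DERIV_I0], simp)
  then show ?thesis using continuous_on_compose2[OF _ assms] by blast
qed

lemma isCont_bessel_w: "isCont bessel_w u"
proof -
  have "isCont (\<lambda>v. \<Sum>k. diffs bcoeff k * v ^ k) v" for v
    by (rule DERIV_isCont[OF termdiffs_strong_converges_everywhere])
      (intro termdiff_converges_all summable_bcoeff)
  then have 1: "isCont (\<lambda>u. \<Sum>k. diffs bcoeff k * (u\<^sup>2) ^ k) u"
    by (rule isCont_o2[rotated]) (intro continuous_intros)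
  have "isCont (\<lambda>u. 2 * u\<^sup>2 * (\<Sum>k. diffs bcoeff k * (u\<^sup>2) ^ k) / I0 u) u"
    by (intro continuous_intros 1 DERIV_isCont[OF DERIV_I0]) simp
  moreover have "(\<lambda>u. 2 * u\<^sup>2 * (\<Sum>k. diffs bcoeff k * (u\<^sup>2) ^ k) / I0 u) = bessel_w"
    by (rule ext) (simp add: bessel_w_power_series[symmetric])
  ultimately show ?thesis by simp
qed

lemma bessel_w_measurable [measurable]: "bessel_w \<in> borel_measurable borel"
  by (intro borel_measurable_continuous_onI continuous_at_imp_continuous_on) (auto simp:
      isCont_bessel_w)

lemma I0_measurable [measurable]: "I0 \<in> borel_measurable borel"
  by (intro borel_measurable_continuous_onI continuous_intros)

subsection \<open>The equation for the critical time\<close>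

text \<open>Rescaling by sqrt a reduces to a = 1. These moments carry the explicit integrals in v:
  the mass of the mixture and the bounds on \<open>tstar_fun\<close> and \<open>W\<close>.\<close>

lemma odd_gaussian_moment:
  assumes "0 < a"
  shows "has_bochner_integral lborel (\<lambda>v::real. indicator {0..} v * (exp (- a * v\<^sup>2) * v ^ (2 * k + 1)))
     (fact k / (2 * a ^ (k + 1)))"
proof -
  define c where "c = sqrt a"
  have c: "c > 0" "c\<^sup>2 = a" using assms by (auto simp: c_def)
  have "has_bochner_integral lborel
     (\<lambda>x. indicator {0..} (0 + c * x) *\<^sub>R (exp (- (0 + c * x)\<^sup>2) * (0 + c * x)^(2 * k + 1))) ((fact
         k / 2) /\<^sub>R \<bar>c\<bar>)"
    using gaussian_moment_odd_pos[of k] c(1)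
    by (subst (asm) lborel_has_bochner_integral_real_affine_iff[of c _ _ 0]) auto
  then have "has_bochner_integral lborel
     (\<lambda>x. (1 / c ^ (2 * k + 1)) * (indicator {0..} (0 + c * x) *\<^sub>R (exp (- (0 + c * x)\<^sup>2) * (0 + c
         * x)^(2 * k + 1))))
      ((1 / c ^ (2 * k + 1)) * ((fact k / 2) /\<^sub>R \<bar>c\<bar>))"
    by (rule has_bochner_integral_mult_right)
  moreover have "(1 / c ^ (2 * k + 1)) * (indicator {0..} (0 + c * x) *\<^sub>R (exp (- (0 + c * x)\<^sup>2) *
      (0 + c * x)^(2 * k + 1)))
     = indicator {0..} x * (exp (- a * x\<^sup>2) * x ^ (2 * k + 1))" for x
  proof -
    have "indicator {0..} (c * x) = (indicator {0..} x :: real)"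
      using c(1) by (auto simp: indicator_def zero_le_mult_iff)
    moreover have "(c * x) ^ (2 * k + 1) = c ^ (2 * k + 1) * x ^ (2 * k + 1)" by (rule
        power_mult_distrib)
    moreover have "c ^ (2 * k + 1) \<noteq> 0" using c(1) by simp
    moreover have "(c * x)\<^sup>2 = a * x\<^sup>2" using c(2) by (simp add: power_mult_distrib)
    ultimately show ?thesis by (simp del: power_Suc add: divide_simps)
  qed
  moreover have "(1 / c ^ (2 * k + 1)) * ((fact k / 2) /\<^sub>R \<bar>c\<bar>) = fact k / (2 * a ^ (k + 1))"
  proof -
    have "c ^ (2 * k + 1) * c = a ^ (k + 1)" unfolding c(2)[symmetric] power_mult[symmetric] by simp
    then show ?thesis using c(1) by (simp add: field_simps)
  qed
  ultimately show ?thesis by (simp only:)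
qed

text \<open>The integral defining \<open>t\<^sup>*\<close> after the substitution \<open>u = sqrt t * v\<close>.\<close>

definition tstar_integrand :: "real \<Rightarrow> real \<Rightarrow> real" where
  "tstar_integrand t v = indicator {0..} v * (exp (- v\<^sup>2) * v * bessel_w (sqrt t * v))"

lemma tstar_integrand_measurable [measurable]: "tstar_integrand t \<in> borel_measurable borel"
  unfolding tstar_integrand_def[abs_def] by measurable

lemma tstar_integrand_nonneg: "0 \<le> tstar_integrand t v"
  by (auto simp: tstar_integrand_def indicator_def bessel_w_nonneg)

text \<open>Uniform in t up to T, so that it gives integrability and, at the same time, the
  dominating function for continuity in t.\<close>

lemma tstar_integrand_le:
  assumes "0 \<le> t" "t \<le> T"
  shows "tstar_integrand t v \<le> (T / 2) * (indicator {0..} v * (exp (- 1 * v\<^sup>2) * v ^ (2 * 1 + 1)))"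
proof (cases "0 \<le> v")
  case True
  have "bessel_w (sqrt t * v) \<le> t * v\<^sup>2 / 2"
    using bessel_w_le[of "sqrt t * v"] assms by (simp add: power_mult_distrib)
  also have "\<dots> \<le> T * v\<^sup>2 / 2" using assms by (simp add: mult_right_mono)
  finally have "exp (- v\<^sup>2) * v * bessel_w (sqrt t * v) \<le> exp (- v\<^sup>2) * v * (T * v\<^sup>2 / 2)"
    using True by (intro mult_left_mono) auto
  then show ?thesis using True by (simp add: tstar_integrand_def power2_eq_square power3_eq_cube
      algebra_simps)
qed (auto simp: tstar_integrand_def)

lemma integrable_tstar_integrand:
  assumes "0 \<le> t" shows "integrable lborel (tstar_integrand t)"
proof (rule Bochner_Integration.integrable_bound)
  show "integrable lborel (\<lambda>v::real. (t / 2) * (indicator {0..} v * (exp (- 1 * v\<^sup>2) * v ^ (2 * 1 +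
      1))))"
    by (intro integrable_mult_right integrable.intros[OF odd_gaussian_moment]) simp
  show "AE v in lborel. norm (tstar_integrand t v)
      \<le> norm ((t / 2) * (indicator {0..} v * (exp (- 1 * v\<^sup>2) * v ^ (2 * 1 + 1))))"
    using tstar_integrand_le[OF assms order_refl] tstar_integrand_nonneg[of t]
    by (intro AE_I2) (metis abs_of_nonneg order_trans real_norm_def abs_ge_self)
qed simp

definition tstar_fun :: "real \<Rightarrow> real" where
  "tstar_fun t = (\<integral>v. tstar_integrand t v \<partial>lborel)"

lemma tstar_fun_eq:
  assumes "0 < t"
  shows "(LBINT u:{0..}. exp (- u\<^sup>2 / t) * (deriv I0 u / I0 u) * (u\<^sup>2 / t)) = tstar_fun t"
proof -
  define c where "c = sqrt t"
  have c: "c > 0" "c\<^sup>2 = t" "\<bar>c\<bar> = c" using assms by (auto simp: c_def)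
  let ?f = "\<lambda>u. indicator {0..} u *\<^sub>R (exp (- u\<^sup>2 / t) * (deriv I0 u / I0 u) * (u\<^sup>2 / t))"
  have "(\<integral>u. ?f u \<partial>lborel) = \<bar>c\<bar> *\<^sub>R (\<integral>x. ?f (0 + c * x) \<partial>lborel)"
    using c by (intro lborel_integral_real_affine) simp
  also have "\<dots> = c * (\<integral>x. ?f (c * x) \<partial>lborel)" using c by (simp only: add_0 real_scaleR_def)
  also have "\<dots> = (\<integral>x. c * ?f (c * x) \<partial>lborel)" by (rule integral_mult_right_zero[symmetric])
  also have "\<dots> = (\<integral>x. tstar_integrand t x \<partial>lborel)"
  proof (rule Bochner_Integration.integral_cong[OF refl])
    fix x
    have i: "indicator {0..} (c * x) = (indicator {0..} x :: real)"
      using c(1) by (auto simp: indicator_def zero_le_mult_iff)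
    have "c * (deriv I0 (c * x) / I0 (c * x) * (c * x)\<^sup>2 / t) = x * ((c * x) * (deriv I0 (c * x) /
        I0 (c * x)))"
      unfolding c(2)[symmetric] using c(1) by (simp add: power2_eq_square field_simps)
    also have "\<dots> = x * bessel_w (c * x)" by (simp only: deriv_I0)
    finally have d: "c * (deriv I0 (c * x) / I0 (c * x) * (c * x)\<^sup>2 / t) = x * bessel_w (c * x)" .
    have e: "(c * x)\<^sup>2 / t = x\<^sup>2" using c assms by (simp add: power_mult_distrib)
    have "c * ?f (c * x) = indicator {0..} (c * x) * (exp (- ((c * x)\<^sup>2 / t)) * (c * (deriv I0 (c *
        x) / I0 (c * x) * (c * x)\<^sup>2 / t)))"
      by simp
    then show "c * ?f (c * x) = tstar_integrand t x"
      unfolding d e i by (simp add: tstar_integrand_def c_def)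
  qed
  finally show ?thesis by (simp add: tstar_fun_def set_lebesgue_integral_def)
qed

text \<open>The bound \<open>bessel_w_le\<close> leaves a third moment. It puts the lower end of the
  bracket for t at 4.\<close>

lemma tstar_fun_le: assumes "0 \<le> t" shows "tstar_fun t \<le> t / 4"
proof -
  have m: "has_bochner_integral lborel (\<lambda>v::real. (t / 2) * (indicator {0..} v * (exp (- 1 * v\<^sup>2) *
      v ^ (2 * 1 + 1))))
     ((t / 2) * (fact 1 / (2 * 1 ^ (1 + 1))))"
    by (intro has_bochner_integral_mult_right odd_gaussian_moment) simp
  have "tstar_fun t \<le> (t / 2) * (fact 1 / (2 * 1 ^ (1 + 1)))"
    unfolding tstar_fun_def has_bochner_integral_integral_eq[OF m, symmetric]
    by (intro integral_mono integrable_tstar_integrand integrable.intros[OF m]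
        tstar_integrand_le assms order_refl)
  then show ?thesis by simp
qed

text \<open>Here \<open>bessel_w u \<ge> u - 1\<close> is combined with \<open>v \<ge> (3 v\<^sup>2 - v\<^sup>4) / 2\<close>, which leaves odd Gaussian
  moments only.\<close>

lemma tstar_fun_36: "1 \<le> tstar_fun 36"
proof -
  let ?g = "\<lambda>k (v::real). indicator {0..} v * (exp (- 1 * v\<^sup>2) * v ^ (2 * k + 1))"
  \<comment> \<open>With c = sqrt t the minorant integrates to c / 4 - 1 / 2, which reaches 1 at c =
    6; hence the value 36, and the number below is exactly 1.\<close>
  have m: "has_bochner_integral lborel (\<lambda>v. 9 * ?g 1 v - 3 * ?g 2 v - ?g 0 v)
    (9 * (fact 1 / (2 * 1 ^ (1 + 1))) - 3 * (fact 2 / (2 * 1 ^ (2 + 1))) - (fact 0 / (2 * 1 ^ (0 +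
        1))))"
    by (intro has_bochner_integral_diff has_bochner_integral_mult_right odd_gaussian_moment) simp_all
  have "9 * ?g 1 v - 3 * ?g 2 v - ?g 0 v \<le> tstar_integrand 36 v" for v
  proof (cases "0 < v")
    case True
    \<comment> \<open>Equivalent to v \<ge> (3 v^2 - v^4) / 2 for the positive v at hand; the two
      sides touch at v = 1.\<close>
    have "0 \<le> (v * (v - 1)\<^sup>2) * (v + 2)" using True by simp
    also have "\<dots> = v ^ 4 + 2 * v - 3 * v\<^sup>2" by (simp add: power2_eq_square power4_eq_xxxx algebra_simps)
    finally have "9 * v\<^sup>2 - 3 * v ^ 4 - 1 \<le> 6 * v - 1" by simp
    also have "\<dots> \<le> bessel_w (sqrt 36 * v)" using bessel_w_ge[of "6 * v"] True by simp
    finally have "exp (- v\<^sup>2) * v * (9 * v\<^sup>2 - 3 * v ^ 4 - 1) \<le> exp (- v\<^sup>2) * v * bessel_w (sqrt 36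
        * v)"
      using True by (intro mult_left_mono) auto
    moreover have "9 * ?g 1 v - 3 * ?g 2 v - ?g 0 v = exp (- v\<^sup>2) * v * (9 * v\<^sup>2 - 3 * v ^ 4 - 1)"
      using True by (simp add: power2_eq_square power4_eq_xxxx power3_eq_cube power_Suc
          algebra_simps numeral_eq_Suc)
    ultimately show ?thesis using True by (simp add: tstar_integrand_def)
  qed (auto simp: tstar_integrand_def indicator_def)
  then have "9 * (fact 1 / (2 * 1 ^ (1 + 1))) - 3 * (fact 2 / (2 * 1 ^ (2 + 1))) - (fact 0 / (2 * 1
      ^ (0 + 1))) \<le> tstar_fun 36"
    unfolding tstar_fun_def has_bochner_integral_integral_eq[OF m, symmetric]
    by (intro integral_mono integrable_tstar_integrand integrable.intros[OF m]) auto
  then show ?thesis by (simp add: fact_numeral)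
qed

text \<open>Monotonicity is pointwise in v. If the integral of the difference vanished, the
  difference would vanish almost everywhere, but it is positive on the unit interval.\<close>

lemma tstar_fun_strict_mono:
  assumes "0 < s" "s < t" shows "tstar_fun s < tstar_fun t"
proof -
  let ?d = "\<lambda>v. tstar_integrand t v - tstar_integrand s v"
  have i: "integrable lborel (tstar_integrand s)" "integrable lborel (tstar_integrand t)"
    using assms by (auto intro: integrable_tstar_integrand)
  have pos: "0 < ?d v" if "0 < v" for v
    using that assms bessel_w_strict_mono[of "sqrt s * v" "sqrt t * v"] by (simp add:
        tstar_integrand_def)
  have nn: "0 \<le> ?d v" for v
    using pos[of v] by (cases "0 < v") (auto simp: tstar_integrand_def indicator_def)
  have "integral\<^sup>L lborel ?d \<noteq> 0"
  proof
    assume "integral\<^sup>L lborel ?d = 0"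
    then have "AE v in lborel. ?d v = 0"
      using i nn by (subst (asm) integral_nonneg_eq_0_iff_AE) auto
    then have "AE v in lborel. v \<notin> {0<..<1::real}"
      by eventually_elim (use pos in force)
    then have "emeasure lborel {0<..<1::real} = 0"
      by (subst (asm) AE_iff_measurable[of "{0<..<1}"]) auto
    then show False by simp
  qed
  moreover have "0 \<le> integral\<^sup>L lborel ?d" using nn by simp
  ultimately show ?thesis using i by (simp add: tstar_fun_def)
qed

lemma continuous_on_tstar_fun: "continuous_on {0..T} tstar_fun"
proof (rule continuous_on_sequentiallyI)
  fix x a assume x: "\<forall>n. x n \<in> {0..T}" "a \<in> {0..T}" "x \<longlonglongrightarrow> a"
  show "(\<lambda>n. tstar_fun (x n)) \<longlonglongrightarrow> tstar_fun a"
    unfolding tstar_fun_def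
  proof (rule integral_dominated_convergence)
    show "integrable lborel (\<lambda>v::real. (T / 2) * (indicator {0..} v * (exp (- 1 * v\<^sup>2) * v ^ (2 * 1
        + 1))))"
      by (intro integrable_mult_right integrable.intros[OF odd_gaussian_moment]) simp
    show "AE v in lborel. norm (tstar_integrand (x n) v) \<le> (T / 2) * (indicator {0..} v * (exp (- 1
        * v\<^sup>2) * v ^ (2 * 1 + 1)))" for n
      using tstar_integrand_le[of "x n" T] x(1) tstar_integrand_nonneg[of "x n"]
      by (intro AE_I2) auto
    show "AE v in lborel. (\<lambda>n. tstar_integrand (x n) v) \<longlonglongrightarrow> tstar_integrand a v"
      unfolding tstar_integrand_def
      by (intro AE_I2 tendsto_intros isCont_tendsto_compose[OF isCont_bessel_w] x)
  qed simp_all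
qed

lemma is_t_star_iff: "is_t_star t \<longleftrightarrow> 0 < t \<and> tstar_fun t = 1"
  unfolding is_t_star_def using tstar_fun_eq[of t] by auto

text \<open>\<open>tstar_fun\<close> is at most 1 at 4 and at least 1 at 36, so the intermediate
  value theorem applies on this bracket; strict monotonicity gives uniqueness.\<close>

lemma ex1_t_star: "\<exists>!t. is_t_star t"
proof -
  have "\<exists>t. 4 \<le> t \<and> t \<le> 36 \<and> tstar_fun t = 1"
    using tstar_fun_le[of 4] tstar_fun_36 continuous_on_tstar_fun[of 36]
    by (intro IVT') (auto intro: continuous_on_subset)
  then show ?thesis unfolding is_t_star_iff
    using tstar_fun_strict_mono by (metis less_irrefl linorder_neqE_linordered_idom less_le_trans
        zero_less_numeral)
qed

lemma t_star_ge_4: "is_t_star t \<Longrightarrow> 4 \<le> t"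
  using tstar_fun_le[of t] by (simp add: is_t_star_iff)

subsection \<open>Gaussian averages\<close>

context
  fixes a b :: real
begin

private definition g :: "real \<Rightarrow> real" where "g \<phi> = a * cos \<phi> + b * sin \<phi>"

private definition m :: "nat \<Rightarrow> real" where "m n = (\<integral>\<phi>. g \<phi> ^ n * indicator {0..2*pi} \<phi> \<partial>lborel)"

private lemma g_cont: "isCont g x"
  unfolding g_def[abs_def] by (intro continuous_intros)

private lemma g_pow_integrable: "integrable lborel (\<lambda>\<phi>. g \<phi> ^ n * indicator {0..2*pi} \<phi>)"
  using borel_integrable_atLeastAtMost[of 0 "2*pi" "\<lambda>\<phi>. g \<phi> ^ n"] g_cont
  by (simp add: indicator_def if_distrib if_distribR cong: if_cong)

private lemma m_0: "m 0 = 2 * pi"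
  by (simp add: m_def)

private lemma m_1: "m 1 = 0"
proof -
  have "has_bochner_integral lborel (\<lambda>\<phi>. g \<phi> * indicator {0..2*pi} \<phi>)
     ((a * sin (2*pi) - b * cos (2 * pi)) - (a * sin 0 - b * cos 0))"
    by (rule has_bochner_integral_FTC_Icc_real)
      (auto intro!: derivative_eq_intros g_cont simp: g_def)
  then show ?thesis by (simp add: m_def has_bochner_integral_integral_eq)
qed

text \<open>Integrate the derivative of \<open>g' * g ^ (n + 1)\<close>, using \<open>g'' = - g\<close> and that \<open>g\<^sup>2 + g'\<^sup>2\<close> is
  constant.\<close>

private lemma m_rec: "real (n + 2) * m (n + 2) = real (n + 1) * (a\<^sup>2 + b\<^sup>2) * m n"
proof -
  define h where "h \<phi> = - a * sin \<phi> + b * cos \<phi>" for \<phi>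
  have gh: "(g \<phi>)\<^sup>2 + (h \<phi>)\<^sup>2 = a\<^sup>2 + b\<^sup>2" for \<phi>
    unfolding g_def h_def using sin_cos_squared_add[of \<phi>] by algebra
  have dg: "(g has_real_derivative h x) (at x)" for x
    unfolding g_def[abs_def] h_def by (auto intro!: derivative_eq_intros)
  have dh: "(h has_real_derivative - g x) (at x)" for x
    unfolding h_def[abs_def] g_def by (auto intro!: derivative_eq_intros)
  have "has_bochner_integral lborel
      (\<lambda>\<phi>. (- g \<phi> * g \<phi> ^ (n+1) + (real (n+1) * g \<phi> ^ n * h \<phi>) * h \<phi>) * indicator {0..2*pi} \<phi>)
      (h (2*pi) * g (2*pi) ^ (n+1) - h 0 * g 0 ^ (n+1))"
  proof (rule has_bochner_integral_FTC_Icc_real)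
    fix x
    show "((\<lambda>x. h x * g x ^ (n + 1)) has_real_derivative - g x * g x ^ (n + 1) + real (n + 1) * g x
        ^ n * h x * h x) (at x)"
      by (rule DERIV_cong[OF DERIV_mult[OF dh DERIV_power[OF dg]]]) (simp add: algebra_simps)
    show "isCont (\<lambda>x. - g x * g x ^ (n + 1) + real (n + 1) * g x ^ n * h x * h x) x"
      by (intro continuous_intros g_cont DERIV_isCont[OF dh])
  qed simp
  moreover have "h (2*pi) * g (2*pi) ^ (n+1) - h 0 * g 0 ^ (n+1) = 0"
    by (simp add: g_def h_def)
  moreover have "(- g \<phi> * g \<phi> ^ (n+1) + (real (n+1) * g \<phi> ^ n * h \<phi>) * h \<phi>) * indicator {0..2*pi} \<phi>
      = real (n+1) * (a\<^sup>2 + b\<^sup>2) * (g \<phi> ^ n * indicator {0..2*pi} \<phi>) - real (n + 2) * (g \<phi> ^ (n +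
          2) * indicator {0..2*pi} \<phi>)" for \<phi>
    unfolding gh[symmetric, of \<phi>] by (simp add: algebra_simps power2_eq_square)
  ultimately have "(\<integral>\<phi>. real (n+1) * (a\<^sup>2 + b\<^sup>2) * (g \<phi> ^ n * indicator {0..2*pi} \<phi>) - real (n + 2)
      * (g \<phi> ^ (n + 2) * indicator {0..2*pi} \<phi>) \<partial>lborel) = 0"
    using has_bochner_integral_integral_eq by (metis (no_types, lifting)
        Bochner_Integration.integral_cong)
  then show ?thesis
    unfolding m_def
    by (simp only: Bochner_Integration.integral_diff[OF integrable_mult_right[OF g_pow_integrable]
        integrable_mult_right[OF g_pow_integrable]]
        integral_mult_right_zero)
qed

private lemma m_odd: "m (2 * k + 1) = 0"
proof (induction k)
  case (Suc k)
  have "real (2 * k + 1 + 2) * m (2 * k + 1 + 2) = 0" unfolding m_rec Suc.IH by simp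
  then show ?case by simp
qed (simp add: m_1[simplified])

text \<open>Both sides satisfy the same one-step recursion in k, in which a and b enter only through
  a^2 + b^2; this is where rotational invariance appears.\<close>

private lemma m_even: "m (2 * k) / fact (2 * k) = 2 * pi * bterm (sqrt (a\<^sup>2 + b\<^sup>2)) k"
proof (induction k)
  case (Suc k)
  let ?r = "a\<^sup>2 + b\<^sup>2"
  have "m (2 * k + 2) = real (2 * k + 1) * ?r * m (2 * k) / real (2 * k + 2)"
    using m_rec[of "2*k"] by (simp add: field_simps)
  moreover have "fact (2 * k + 2) = real (2 * k + 2) * (real (2 * k + 1) * fact (2 * k))"
    by (simp add: algebra_simps)
  ultimately have 1: "m (2 * k + 2) / fact (2 * k + 2) = ?r / (real (2 * k + 2))\<^sup>2 * (m (2 * k) /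
      fact (2 * k))"
    by (simp add: power2_eq_square divide_simps del: of_nat_add of_nat_mult)
  have 2: "bterm (sqrt ?r) (Suc k) = ?r / (real (2 * k + 2))\<^sup>2 * bterm (sqrt ?r) k"
  proof -
    have "(real (2 * k + 2))\<^sup>2 * bterm (sqrt ?r) (Suc k) = 4 * ((real (Suc k))\<^sup>2 * bterm (sqrt ?r)
        (Suc k))"
      by (simp add: power2_eq_square algebra_simps)
    also have "\<dots> = ?r * bterm (sqrt ?r) k" unfolding bterm_Suc by (simp add: power_divide)
    finally have "(real (2 * k + 2))\<^sup>2 * bterm (sqrt ?r) (Suc k) = ?r * bterm (sqrt ?r) k" .
    moreover have "(real (2 * k + 2))\<^sup>2 \<noteq> 0" by simp
    ultimately show ?thesis by (metis nonzero_eq_divide_eq mult.commute times_divide_eq_left)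
  qed
  show ?case using 1 2 Suc.IH by simp
qed (simp add: m_0)

text \<open>The exponential is expanded in its series, and sum and integral are exchanged by means
  of the bound (|a| + |b|)^n / n!. The odd moments vanish, and the even ones are the terms of I0 up
  to the factor 2 pi.\<close>

lemma circle_integral_exp:
  "(\<integral>\<^sup>+\<phi>. ennreal (exp (a * cos \<phi> + b * sin \<phi>)) * indicator {0..2*pi} \<phi> \<partial>lborel)
     = ennreal (2 * pi * I0 (sqrt (a\<^sup>2 + b\<^sup>2)))"
proof -
  let ?f = "\<lambda>n \<phi>. (g \<phi> ^ n / fact n) * indicator {0..2*pi} \<phi>"
  have fi: "integrable lborel (?f n)" for n
    using integrable_mult_left[OF g_pow_integrable[of n], of "inverse (fact n)"]
    by (simp add: divide_inverse mult_ac)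
  have gb: "\<bar>g \<phi>\<bar> \<le> \<bar>a\<bar> + \<bar>b\<bar>" for \<phi>
  proof -
    have "\<bar>a * cos \<phi>\<bar> \<le> \<bar>a\<bar> * 1" "\<bar>b * sin \<phi>\<bar> \<le> \<bar>b\<bar> * 1"
      unfolding abs_mult by (intro mult_left_mono; simp)+
    then show ?thesis unfolding g_def by linarith
  qed
  have sm: "(\<lambda>n. ?f n \<phi>) sums (exp (g \<phi>) * indicator {0..2*pi} \<phi>)" for \<phi>
    using exp_converges[of "g \<phi>"] by (intro sums_mult2) (simp add: divide_inverse mult.commute)
  have 1: "(\<lambda>n. \<integral>\<phi>. ?f n \<phi> \<partial>lborel) sums (\<integral>\<phi>. (\<Sum>n. ?f n \<phi>) \<partial>lborel)"
  proof (rule sums_integral)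
    have "summable (\<lambda>n. \<bar>g \<phi>\<bar> ^ n / fact n)" for \<phi>
      using summable_exp[of "\<bar>g \<phi>\<bar>"] by (simp add: divide_inverse mult.commute)
    then have "summable (\<lambda>n. \<bar>g \<phi>\<bar> ^ n / fact n * indicator {0..2*pi} \<phi>)" for \<phi>
      by (rule summable_mult2)
    then show "AE \<phi> in lborel. summable (\<lambda>n. norm (?f n \<phi>))"
      by (simp add: abs_mult power_abs)
    show "summable (\<lambda>n. \<integral>\<phi>. norm (?f n \<phi>) \<partial>lborel)"
    proof (rule summable_comparison_test'[where N=0])
      show "summable (\<lambda>n. 2 * pi * (inverse (fact n) * (\<bar>a\<bar> + \<bar>b\<bar>) ^ n))"
        by (intro summable_mult summable_exp)
      fix n
      have "(\<integral>\<phi>. norm (?f n \<phi>) \<partial>lborel) \<le> (\<integral>\<phi>. inverse (fact n) * (\<bar>a\<bar> + \<bar>b\<bar>) ^ n * indicator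
          {0..2*pi} \<phi> \<partial>lborel)"
      proof (intro integral_mono integrable_norm fi)
        show "integrable lborel (\<lambda>\<phi>. inverse (fact n) * (\<bar>a\<bar> + \<bar>b\<bar>) ^ n * indicat_real {0..2 * pi} \<phi>)"
          by (intro integrable_mult_right integrable_real_indicator) auto
        fix \<phi> have "\<bar>g \<phi>\<bar> ^ n \<le> (\<bar>a\<bar> + \<bar>b\<bar>) ^ n" using gb by (intro power_mono) auto
        then show "norm (?f n \<phi>) \<le> inverse (fact n) * (\<bar>a\<bar> + \<bar>b\<bar>) ^ n * indicator {0..2*pi} \<phi>"
          by (auto simp: indicator_def power_abs abs_mult divide_inverse mult.commute)
      qed
      then show "norm (\<integral>\<phi>. norm (?f n \<phi>) \<partial>lborel) \<le> 2 * pi * (inverse (fact n) * (\<bar>a\<bar> + \<bar>b\<bar>) ^ n)"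
        by (simp add: integral_nonneg_AE mult_ac)
    qed
  qed (rule fi)
  have ff: "(\<integral>\<phi>. ?f n \<phi> \<partial>lborel) = m n / fact n" for n
    unfolding m_def integral_divide_zero[symmetric]
    by (intro Bochner_Integration.integral_cong) auto
  have 2: "(\<lambda>n. m n / fact n) sums (\<integral>\<phi>. exp (g \<phi>) * indicator {0..2*pi} \<phi> \<partial>lborel)"
    using 1 unfolding ff by (simp only: sums_unique[OF sm, symmetric])
  have "(\<lambda>k. m (2 * k) / fact (2 * k)) sums (\<integral>\<phi>. exp (g \<phi>) * indicator {0..2*pi} \<phi> \<partial>lborel)"
  proof (subst sums_mono_reindex[of "\<lambda>k. 2 * k" "\<lambda>n. m n / fact n"])
    show "m n / fact n = 0" if "n \<notin> range (\<lambda>k. 2 * k)" for n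
    proof -
      have "odd n" using that by (auto elim!: evenE)
      then show ?thesis using m_odd by (auto elim!: oddE)
    qed
  qed (use 2 in \<open>auto simp: strict_mono_def\<close>)
  moreover have "(\<lambda>k. m (2 * k) / fact (2 * k)) sums (2 * pi * I0 (sqrt (a\<^sup>2 + b\<^sup>2)))"
    unfolding m_even by (intro sums_mult bterm_sums)
  ultimately have 3: "(\<integral>\<phi>. exp (g \<phi>) * indicator {0..2*pi} \<phi> \<partial>lborel) = 2 * pi * I0 (sqrt (a\<^sup>2 + b\<^sup>2))"
    by (rule sums_unique2)
  have "integrable lborel (\<lambda>\<phi>. exp (g \<phi>) * indicator {0..2*pi} \<phi>)"
    using borel_integrable_atLeastAtMost[of 0 "2*pi" "\<lambda>\<phi>. exp (g \<phi>)"] g_cont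
    by (simp add: indicator_def if_distrib if_distribR cong: if_cong)
  from nn_integral_eq_integral[OF this]
  show ?thesis unfolding 3 unfolding g_def by (simp add: ennreal_mult'' ennreal_indicator)
qed

end

text \<open>The circle average with a = u, b = 0 is bounded by its maximum, at \<phi> = 0.\<close>

lemma I0_le_exp: assumes "0 \<le> u" shows "I0 u \<le> exp u"
proof -
  have "ennreal (2 * pi * I0 (sqrt (u\<^sup>2 + 0\<^sup>2))) \<le> (\<integral>\<^sup>+\<phi>. ennreal (exp u) * indicator {0..2*pi} \<phi>
      \<partial>lborel)"
    unfolding circle_integral_exp[symmetric]
    using assms mult_left_mono[OF cos_le_one assms]
    by (intro nn_integral_mono) (auto simp: indicator_def)
  also have "\<dots> = ennreal (2 * pi * exp u)"
    by (subst nn_integral_cmult_indicator) (auto simp: ennreal_mult'' ennreal_mult' mult.commute)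
  finally show ?thesis using assms by (simp add: ennreal_le_iff)
qed

text \<open>The law of an increment of a planar Brownian motion over a time span of length \<open>s\<^sup>2\<close>.\<close>

definition gauss2 :: "real \<Rightarrow> (real \<times> real) measure" where
  "gauss2 s = density lborel (normal_density 0 s) \<Otimes>\<^sub>M density lborel (normal_density 0 s)"

section \<open>Integrals against the planar Gaussian law\<close>

lemma sets_gauss2 [simp, measurable_cong]: "sets (gauss2 s) = sets borel"
proof -
  have "sets (gauss2 s) = sets (borel \<Otimes>\<^sub>M borel)"
    unfolding gauss2_def by (intro sets_pair_measure_cong) auto
  then show ?thesis by (simp only: borel_prod)
qed

lemma nn_integral_gauss2:
  assumes "0 < s" and [measurable]: "f \<in> borel_measurable borel"
  shows "(\<integral>\<^sup>+d. f d \<partial>gauss2 s)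
    = (\<integral>\<^sup>+x. ennreal (normal_density 0 s x) * (\<integral>\<^sup>+y. ennreal (normal_density 0 s y) * f (x, y)
        \<partial>lborel) \<partial>lborel)"
proof -
  interpret prob_space "density lborel (normal_density 0 s)"
    using assms(1) by (rule prob_space_normal_density)
  have f: "f \<in> borel_measurable (borel \<Otimes>\<^sub>M borel)" by (simp add: borel_prod)
  have "(\<integral>\<^sup>+d. f d \<partial>gauss2 s) = (\<integral>\<^sup>+x. \<integral>\<^sup>+y. f (x, y) \<partial>density lborel (normal_density 0 s) \<partial>density
      lborel (normal_density 0 s))"
    unfolding gauss2_def
    by (rule nn_integral_fst[symmetric]) (use f in \<open>simp cong: measurable_cong_sets
        sets_pair_measure_cong\<close>)
  also have "\<dots> = (\<integral>\<^sup>+x. \<integral>\<^sup>+y. ennreal (normal_density 0 s y) * f (x, y) \<partial>lborel \<partial>density lborel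
      (normal_density 0 s))"
    using f by (intro nn_integral_cong nn_integral_density) auto
  also have "\<dots> = (\<integral>\<^sup>+x. ennreal (normal_density 0 s x) * (\<integral>\<^sup>+y. ennreal (normal_density 0 s y) * f
      (x, y) \<partial>lborel) \<partial>lborel)"
    by (rule nn_integral_density) (use f in measurable)
  finally show ?thesis .
qed

lemma prob_space_gauss2: "0 < s \<Longrightarrow> prob_space (gauss2 s)"
  unfolding gauss2_def
  by (intro prob_space_pair prob_space_normal_density)

lemma gauss2_Fubini:
  fixes f :: "real \<times> real \<Rightarrow> real \<Rightarrow> ennreal"
  assumes "0 < s" and [measurable]: "case_prod f \<in> borel_measurable (borel \<Otimes>\<^sub>M borel)"
  shows "(\<integral>\<^sup>+d. \<integral>\<^sup>+v. f d v \<partial>lborel \<partial>gauss2 s) = (\<integral>\<^sup>+v. \<integral>\<^sup>+d. f d v \<partial>gauss2 s \<partial>lborel)"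
proof -
  interpret G: prob_space "gauss2 s" using assms(1) by (rule prob_space_gauss2)
  interpret pair_sigma_finite "gauss2 s" lborel ..
  have "sets (gauss2 s \<Otimes>\<^sub>M (lborel :: real measure)) = sets (borel \<Otimes>\<^sub>M borel)"
    by (intro sets_pair_measure_cong) auto
  then have "case_prod f \<in> borel_measurable (gauss2 s \<Otimes>\<^sub>M lborel)"
    using assms(2) by (simp cong: measurable_cong_sets)
  then show ?thesis by (rule Fubini'[symmetric])
qed

lemma nn_integral_gauss2_prod:
  assumes "0 < s" and [measurable]: "p \<in> borel_measurable borel" "q \<in> borel_measurable borel"
  shows "(\<integral>\<^sup>+d. p (fst d) * q (snd d) \<partial>gauss2 s)
    = (\<integral>\<^sup>+x. ennreal (normal_density 0 s x) * p x \<partial>lborel) * (\<integral>\<^sup>+y. ennreal (normal_density 0 s y)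
        * q y \<partial>lborel)"
proof -
  have "(\<integral>\<^sup>+d. p (fst d) * q (snd d) \<partial>gauss2 s) =
     (\<integral>\<^sup>+x. ennreal (normal_density 0 s x) * (\<integral>\<^sup>+y. ennreal (normal_density 0 s y) * (p x * q y)
         \<partial>lborel) \<partial>lborel)"
    using assms by (subst nn_integral_gauss2) (auto simp: borel_prod[symmetric])
  also have "\<dots> = (\<integral>\<^sup>+x. ennreal (normal_density 0 s x) * p x * (\<integral>\<^sup>+y. ennreal (normal_density 0 s
      y) * q y \<partial>lborel) \<partial>lborel)"
    by (intro nn_integral_cong) (simp add: nn_integral_cmult[symmetric] mult_ac)
  also have "\<dots> = (\<integral>\<^sup>+x. ennreal (normal_density 0 s x) * p x \<partial>lborel) * (\<integral>\<^sup>+y. ennreal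
      (normal_density 0 s y) * q y \<partial>lborel)"
    by (rule nn_integral_multc) measurable
  finally show ?thesis .
qed

lemma normal_density_mgf:
  assumes "0 < s"
  shows "(\<integral>\<^sup>+x. ennreal (normal_density 0 s x) * ennreal (exp (a * x)) \<partial>lborel) = ennreal (exp (a\<^sup>2
      * s\<^sup>2 / 2))"
proof -
  have "normal_density 0 s x * exp (a * x) = exp (a\<^sup>2 * s\<^sup>2 / 2) * normal_density (a * s\<^sup>2) s x" for x
  proof -
    have "- (x - 0)\<^sup>2 / (2 * s\<^sup>2) + a * x = a\<^sup>2 * s\<^sup>2 / 2 + - (x - a * s\<^sup>2)\<^sup>2 / (2 * s\<^sup>2)"
      using assms by (simp add: field_simps power2_eq_square)
    then have "exp (- (x - 0)\<^sup>2 / (2 * s\<^sup>2)) * exp (a * x) = exp (a\<^sup>2 * s\<^sup>2 / 2) * exp (- (x - a *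
        s\<^sup>2)\<^sup>2 / (2 * s\<^sup>2))"
      by (simp only: exp_add[symmetric])
    then show ?thesis by (simp add: normal_density_def)
  qed
  then have "(\<integral>\<^sup>+x. ennreal (normal_density 0 s x) * ennreal (exp (a * x)) \<partial>lborel)
     = (\<integral>\<^sup>+x. ennreal (exp (a\<^sup>2 * s\<^sup>2 / 2)) * ennreal (normal_density (a * s\<^sup>2) s x) \<partial>lborel)"
    by (intro nn_integral_cong) (simp add: ennreal_mult'[symmetric])
  also have "\<dots> = ennreal (exp (a\<^sup>2 * s\<^sup>2 / 2)) * (\<integral>\<^sup>+x. ennreal (normal_density (a * s\<^sup>2) s x) \<partial>lborel)"
    by (rule nn_integral_cmult) simp
  also have "(\<integral>\<^sup>+x. ennreal (normal_density (a * s\<^sup>2) s x) \<partial>lborel) = 1"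
    using assms by (subst nn_integral_eq_integral) (auto intro!: integrable_normal_density)
  finally show ?thesis by simp
qed

lemma gauss2_exp:
  assumes "0 < s"
  shows "(\<integral>\<^sup>+d. ennreal (exp (a * (y1 + fst d) + b * (y2 + snd d))) \<partial>gauss2 s)
    = ennreal (exp (a * y1 + b * y2) * exp ((a\<^sup>2 + b\<^sup>2) * s\<^sup>2 / 2))"
proof -
  have "(\<integral>\<^sup>+d. ennreal (exp (a * (y1 + fst d) + b * (y2 + snd d))) \<partial>gauss2 s)
    = (\<integral>\<^sup>+d. ennreal (exp (a * y1 + b * y2)) * (ennreal (exp (a * fst d)) * ennreal (exp (b * snd
        d))) \<partial>gauss2 s)"
    by (intro nn_integral_cong) (simp add: ennreal_mult'[symmetric] exp_add[symmetric] algebra_simps)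
  also have "\<dots> = ennreal (exp (a * y1 + b * y2)) * (\<integral>\<^sup>+d. ennreal (exp (a * fst d)) * ennreal (exp
      (b * snd d)) \<partial>gauss2 s)"
    by (rule nn_integral_cmult) (simp add: borel_prod[symmetric] cong: measurable_cong_sets)
  also have "\<dots> = ennreal (exp (a * y1 + b * y2)) * (ennreal (exp (a\<^sup>2 * s\<^sup>2 / 2)) * ennreal (exp
      (b\<^sup>2 * s\<^sup>2 / 2)))"
    using assms by (subst nn_integral_gauss2_prod) (auto simp: normal_density_mgf)
  also have "\<dots> = ennreal (exp (a * y1 + b * y2) * exp ((a\<^sup>2 + b\<^sup>2) * s\<^sup>2 / 2))"
    by (simp add: ennreal_mult'[symmetric] exp_add[symmetric] algebra_simps add_divide_distrib)
  finally show ?thesis .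
qed

text \<open>I0 (k |z|) is the average over unit vectors e of exp (k <e, z>). A Gaussian step
  multiplies each of these exponentials by exp (k^2 s^2 / 2), whatever the direction e, hence
  multiplies the average by the same factor. This makes I0 (k |X|), suitably discounted, a
  martingale.\<close>

lemma gauss2_I0:
  fixes y :: "real \<times> real"
  assumes "0 < s"
  shows "(\<integral>\<^sup>+d. ennreal (I0 (k * norm (y + d))) \<partial>gauss2 s) = ennreal (exp (k\<^sup>2 * s\<^sup>2 / 2) * I0 (k *
      norm y))"
proof -
  interpret G: prob_space "gauss2 s" using assms by (rule prob_space_gauss2)
  have circ: "(\<integral>\<^sup>+\<phi>. ennreal (exp ((k * cos \<phi>) * fst z + (k * sin \<phi>) * snd z)) * indicator
      {0..2*pi} \<phi> \<partial>lborel)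
     = ennreal (2 * pi) * ennreal (I0 (k * norm z))" for z :: "real \<times> real"
  proof -
    have "\<bar>sqrt ((k * fst z)\<^sup>2 + (k * snd z)\<^sup>2)\<bar> = \<bar>k * norm z\<bar>"
      by (simp add: norm_prod_def power_mult_distrib distrib_left[symmetric] real_sqrt_mult abs_mult)
    then have "I0 (sqrt ((k * fst z)\<^sup>2 + (k * snd z)\<^sup>2)) = I0 (k * norm z)"
      by (intro antisym I0_mono) auto
    moreover have "(k * cos \<phi>) * fst z + (k * sin \<phi>) * snd z = (k * fst z) * cos \<phi> + (k * snd z) *
        sin \<phi>" for \<phi>
      by (simp add: mult_ac)
    ultimately show ?thesis by (simp only: circle_integral_exp) (simp add: ennreal_mult')
  qed
  have "ennreal (2 * pi) * (\<integral>\<^sup>+d. ennreal (I0 (k * norm (y + d))) \<partial>gauss2 s)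
     = (\<integral>\<^sup>+d. ennreal (2 * pi) * ennreal (I0 (k * norm (y + d))) \<partial>gauss2 s)"
    by (rule nn_integral_cmult[symmetric]) simp
  also have "\<dots> = (\<integral>\<^sup>+d. (\<integral>\<^sup>+\<phi>. ennreal (exp ((k * cos \<phi>) * (fst y + fst d) + (k * sin \<phi>) * (snd y +
      snd d))) * indicator {0..2*pi} \<phi> \<partial>lborel) \<partial>gauss2 s)"
    by (simp only: circ[symmetric] fst_add snd_add)
  also have "\<dots> = (\<integral>\<^sup>+\<phi>. (\<integral>\<^sup>+d. ennreal (exp ((k * cos \<phi>) * (fst y + fst d) + (k * sin \<phi>) * (snd y +
      snd d))) * indicator {0..2*pi} \<phi> \<partial>gauss2 s) \<partial>lborel)"
    by (rule gauss2_Fubini[OF assms]) (unfold borel_prod[symmetric], measurable)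
  also have "\<dots> = (\<integral>\<^sup>+\<phi>. ennreal (exp (k\<^sup>2 * s\<^sup>2 / 2)) * (ennreal (exp ((k * cos \<phi>) * fst y + (k *
      sin \<phi>) * snd y)) * indicator {0..2*pi} \<phi>) \<partial>lborel)"
  proof (rule nn_integral_cong)
    fix \<phi>
    have e: "(k * cos \<phi>)\<^sup>2 + (k * sin \<phi>)\<^sup>2 = k\<^sup>2"
      by (simp add: power_mult_distrib distrib_left[symmetric])
    show "(\<integral>\<^sup>+d. ennreal (exp ((k * cos \<phi>) * (fst y + fst d) + (k * sin \<phi>) * (snd y + snd d))) *
        indicator {0..2*pi} \<phi> \<partial>gauss2 s)
      = ennreal (exp (k\<^sup>2 * s\<^sup>2 / 2)) * (ennreal (exp ((k * cos \<phi>) * fst y + (k * sin \<phi>) * snd y))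
          * indicator {0..2*pi} \<phi>)"
      using gauss2_exp[OF assms, of "k * cos \<phi>" "fst y" "k * sin \<phi>" "snd y"] unfolding e
      by (subst nn_integral_multc) (simp_all add: borel_prod[symmetric] ennreal_mult' mult_ac cong:
          measurable_cong_sets)
  qed
  also have "\<dots> = ennreal (exp (k\<^sup>2 * s\<^sup>2 / 2)) * (ennreal (2 * pi) * ennreal (I0 (k * norm y)))"
    by (subst nn_integral_cmult) (simp_all only: circ, measurable)
  finally have "ennreal (2 * pi) * (\<integral>\<^sup>+d. ennreal (I0 (k * norm (y + d))) \<partial>gauss2 s)
     = ennreal (2 * pi) * ennreal (exp (k\<^sup>2 * s\<^sup>2 / 2) * I0 (k * norm y))"
    by (simp add: ennreal_mult' mult_ac)
  then show ?thesis by (subst (asm) ennreal_mult_cancel_left) auto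
qed

section \<open>The heat kernel and its semigroup property\<close>

lemma normal_density_0_minus: "normal_density 0 s (- x) = normal_density 0 s x"
  by (simp add: normal_density_def)

lemma normal_density_shift_mean:
  assumes "0 < \<sigma>" "0 < s"
  shows "(\<integral>\<^sup>+x. ennreal (normal_density 0 s x) * ennreal (normal_density 0 \<sigma> (y + x)) \<partial>lborel)
     = ennreal (normal_density 0 (sqrt (\<sigma>\<^sup>2 + s\<^sup>2)) y)"
proof -
  have "(\<integral>\<^sup>+x. ennreal (normal_density 0 \<sigma> (- y - x) * normal_density 0 s x) \<partial>lborel)
     = ennreal (normal_density 0 (sqrt (\<sigma>\<^sup>2 + s\<^sup>2)) (- y))"
    using fun_cong[OF conv_normal_density_zero_mean[OF assms], of "- y"] by simp
  moreover have "normal_density 0 \<sigma> (- y - x) = normal_density 0 \<sigma> (y + x)" for x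
    using normal_density_0_minus[of \<sigma> "y + x"] by (simp only: minus_add_distrib diff_conv_add_uminus)
  ultimately show ?thesis
    by (simp add: normal_density_0_minus ennreal_mult' mult.commute)
qed

text \<open>The planar Gaussian density. The parameter is the variance per coordinate, not the
  standard deviation, so that a Gaussian step acts on it by addition.\<close>

definition heat_kernel :: "real \<Rightarrow> real \<times> real \<Rightarrow> real" where
  "heat_kernel v y = exp (- ((fst y)\<^sup>2 + (snd y)\<^sup>2) / (2 * v)) / (2 * pi * v)"

lemma heat_kernel_normal_density:
  assumes "0 < v"
  shows "heat_kernel v y = normal_density 0 (sqrt v) (fst y) * normal_density 0 (sqrt v) (snd y)"
  using assms by (simp add: heat_kernel_def normal_density_def exp_add[symmetric]
      add_divide_distrib diff_divide_distrib)

lemma gauss2_heat_kernel: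
  assumes "0 < s" "0 < v"
  shows "(\<integral>\<^sup>+d. ennreal (heat_kernel v (y + d)) \<partial>gauss2 s) = ennreal (heat_kernel (v + s\<^sup>2) y)"
proof -
  have "(\<integral>\<^sup>+d. ennreal (heat_kernel v (y + d)) \<partial>gauss2 s) =
    (\<integral>\<^sup>+d. ennreal (normal_density 0 (sqrt v) (fst y + fst d)) * ennreal (normal_density 0 (sqrt v)
        (snd y + snd d)) \<partial>gauss2 s)"
    using assms by (simp add: heat_kernel_normal_density ennreal_mult')
  also have "\<dots> = ennreal (normal_density 0 (sqrt (v + s\<^sup>2)) (fst y)) * ennreal (normal_density 0
      (sqrt (v + s\<^sup>2)) (snd y))"
    using assms by (subst nn_integral_gauss2_prod) (auto simp: normal_density_shift_mean)
  also have "\<dots> = ennreal (heat_kernel (v + s\<^sup>2) y)"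
    using assms by (simp add: heat_kernel_normal_density ennreal_mult' add_pos_pos)
  finally show ?thesis .
qed

section \<open>Moments of the planar Gaussian law\<close>

lemma nn_normal_density: "0 < s \<Longrightarrow> (\<integral>\<^sup>+x. ennreal (normal_density \<mu> s x) \<partial>lborel) = 1"
  by (subst nn_integral_eq_integral) (auto intro!: integrable_normal_density)

lemma gauss2_fst:
  assumes "0 < s" and [measurable]: "p \<in> borel_measurable borel"
  shows "(\<integral>\<^sup>+d. p (fst d) \<partial>gauss2 s) = (\<integral>\<^sup>+x. ennreal (normal_density 0 s x) * p x \<partial>lborel)"
  using nn_integral_gauss2_prod[OF assms, of "\<lambda>_. 1"] assms(1) by (simp add: nn_normal_density)

lemma gauss2_snd:
  assumes "0 < s" and [measurable]: "p \<in> borel_measurable borel"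
  shows "(\<integral>\<^sup>+d. p (snd d) \<partial>gauss2 s) = (\<integral>\<^sup>+x. ennreal (normal_density 0 s x) * p x \<partial>lborel)"
  using nn_integral_gauss2_prod[OF assms(1), of "\<lambda>_. 1" p] assms by (simp add: nn_normal_density)

lemma normal_density_even_moment:
  assumes "0 < s"
  shows "(\<integral>\<^sup>+x. ennreal (normal_density 0 s x) * ennreal (x ^ (2 * k)) \<partial>lborel)
    = ennreal (fact (2 * k) / ((2 / s\<^sup>2) ^ k * fact k))"
proof -
  have h: "has_bochner_integral lborel (\<lambda>x. normal_density 0 s x * x ^ (2 * k)) (fact (2 * k) / ((2
      / s\<^sup>2) ^ k * fact k))"
    using normal_moment_even[OF assms, of 0 k] by simp
  have "(\<integral>\<^sup>+x. ennreal (normal_density 0 s x * x ^ (2 * k)) \<partial>lborel) = ennreal (\<integral>x. normal_density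
      0 s x * x ^ (2 * k) \<partial>lborel)"
    using h by (intro nn_integral_eq_integral) (auto intro: integrable.intros simp: zero_le_even_power)
  then show ?thesis using has_bochner_integral_integral_eq[OF h] by (simp add: ennreal_mult')
qed

lemma norm_prod_sq: "(norm (z :: real \<times> real))\<^sup>2 = (fst z)\<^sup>2 + (snd z)\<^sup>2"
  by (simp add: norm_prod_def)

lemma gauss2_norm2:
  assumes "0 < s"
  shows "(\<integral>\<^sup>+d. ennreal ((norm d)\<^sup>2) \<partial>gauss2 s) = ennreal (2 * s\<^sup>2)"
proof -
  have "(\<integral>\<^sup>+d. ennreal ((norm d)\<^sup>2) \<partial>gauss2 s) = (\<integral>\<^sup>+d. ennreal ((fst d)\<^sup>2) + ennreal ((snd d)\<^sup>2)
      \<partial>gauss2 s)"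
    by (simp add: norm_prod_sq)
  also have "\<dots> = (\<integral>\<^sup>+d. ennreal ((fst d)\<^sup>2) \<partial>gauss2 s) + (\<integral>\<^sup>+d. ennreal ((snd d)\<^sup>2) \<partial>gauss2 s)"
    by (rule nn_integral_add) (simp_all add: borel_prod[symmetric] cong: measurable_cong_sets)
  also have "\<dots> = ennreal (s\<^sup>2) + ennreal (s\<^sup>2)"
    using assms normal_density_even_moment[OF assms, of 1]
    by (simp add: gauss2_fst[where p = "\<lambda>x. ennreal (x\<^sup>2)"] gauss2_snd[where p = "\<lambda>x. ennreal
        (x\<^sup>2)"] fact_numeral)
  also have "\<dots> = ennreal (2 * s\<^sup>2)" by (simp only: mult_2 ennreal_plus zero_le_power2)
  finally show ?thesis .
qed

text \<open>Only the order s^4 matters, so the mixed term is absorbed by (p + q)^2 \<le> 2 p^2 + 2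
  q^2.\<close>

lemma gauss2_norm4:
  assumes "0 < s"
  shows "(\<integral>\<^sup>+d. ennreal ((norm d) ^ 4) \<partial>gauss2 s) \<le> ennreal (12 * s ^ 4)"
proof -
  have b: "(norm d) ^ 4 \<le> 2 * (fst d) ^ 4 + 2 * (snd d) ^ 4" for d :: "real \<times> real"
  proof -
    have "(norm d) ^ 4 = ((fst d)\<^sup>2 + (snd d)\<^sup>2)\<^sup>2"
      unfolding norm_prod_sq[symmetric] by (simp add: power_mult[symmetric])
    also have "\<dots> \<le> 2 * ((fst d)\<^sup>2)\<^sup>2 + 2 * ((snd d)\<^sup>2)\<^sup>2"
      using zero_le_power2[of "(fst d)\<^sup>2 - (snd d)\<^sup>2"] by (simp add: power2_sum power2_diff)
    finally show ?thesis by (simp add: power_mult[symmetric])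
  qed
  have "(\<integral>\<^sup>+d. ennreal ((norm d) ^ 4) \<partial>gauss2 s) \<le> (\<integral>\<^sup>+d. 2 * ennreal ((fst d) ^ 4) + 2 * ennreal
      ((snd d) ^ 4) \<partial>gauss2 s)"
  proof (rule nn_integral_mono)
    fix d :: "real \<times> real"
    have "ennreal (2 * (fst d) ^ 4 + 2 * (snd d) ^ 4) = 2 * ennreal ((fst d) ^ 4) + 2 * ennreal
        ((snd d) ^ 4)"
      by (simp add: ennreal_mult')
    then show "ennreal ((norm d) ^ 4) \<le> 2 * ennreal ((fst d) ^ 4) + 2 * ennreal ((snd d) ^ 4)"
      using ennreal_leI[OF b[of d]] by simp
  qed
  also have "\<dots> = 2 * (\<integral>\<^sup>+d. ennreal ((fst d) ^ 4) \<partial>gauss2 s) + 2 * (\<integral>\<^sup>+d. ennreal ((snd d) ^ 4)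
      \<partial>gauss2 s)"
    by (subst nn_integral_add) (simp_all add: nn_integral_cmult borel_prod[symmetric] cong:
        measurable_cong_sets)
  also have "\<dots> = 2 * ennreal (3 * s ^ 4) + 2 * ennreal (3 * s ^ 4)"
    using assms normal_density_even_moment[OF assms, of 2]
    by (simp add: gauss2_fst[where p = "\<lambda>x. ennreal (x ^ 4)"] gauss2_snd[where p = "\<lambda>x. ennreal (x
        ^ 4)"]
        fact_numeral power_divide power_mult[symmetric])
  also have "\<dots> = ennreal (12 * s ^ 4)"
  proof -
    have "2 * ennreal (3 * s ^ 4) = ennreal (6 * s ^ 4)"
      using ennreal_mult'[of 2 "3 * s ^ 4"] by simp
    then show ?thesis by (simp add: ennreal_plus[symmetric] del: ennreal_plus)
  qed
  finally show ?thesis .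
qed

text \<open>An equality and not just a bound of the right order: outside the ball the growth 2 s^2
  is set against the discount at first order in \<epsilon>.\<close>

lemma gauss2_norm2_shift:
  fixes y :: "real \<times> real"
  assumes "0 < s"
  shows "(\<integral>\<^sup>+d. ennreal ((norm (y + d))\<^sup>2) \<partial>gauss2 s) = ennreal ((norm y)\<^sup>2 + 2 * s\<^sup>2)"
proof -
  have one: "(\<integral>\<^sup>+x. ennreal (normal_density 0 s x) * ennreal ((a + x)\<^sup>2) \<partial>lborel) = ennreal (a\<^sup>2 +
      s\<^sup>2)" for a
  proof -
    have "has_bochner_integral lborel (\<lambda>x. a\<^sup>2 * (normal_density 0 s x * (x - 0) ^ (2 * 0)) + 2 * a
        * (normal_density 0 s x * (x - 0) ^ (2 * 0 + 1)) + normal_density 0 s x * (x - 0) ^ (2 * 1))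
       (a\<^sup>2 * (fact (2 * 0) / ((2 / s\<^sup>2) ^ 0 * fact 0)) + 2 * a * 0 + fact (2 * 1) / ((2 / s\<^sup>2) ^ 1
           * fact 1))"
      by (intro has_bochner_integral_add has_bochner_integral_mult_right normal_moment_even
          normal_moment_odd assms)
    moreover have "a\<^sup>2 * (normal_density 0 s x * (x - 0) ^ (2 * 0)) + 2 * a * (normal_density 0 s x
        * (x - 0) ^ (2 * 0 + 1)) + normal_density 0 s x * (x - 0) ^ (2 * 1)
        = normal_density 0 s x * (a + x)\<^sup>2" for x
      by (simp add: power2_eq_square algebra_simps)
    ultimately have h: "has_bochner_integral lborel (\<lambda>x. normal_density 0 s x * (a + x)\<^sup>2) (a\<^sup>2 + s\<^sup>2)"
      by (simp add: fact_numeral)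
    have "(\<integral>\<^sup>+x. ennreal (normal_density 0 s x * (a + x)\<^sup>2) \<partial>lborel) = ennreal (\<integral>x. normal_density
        0 s x * (a + x)\<^sup>2 \<partial>lborel)"
      using h by (intro nn_integral_eq_integral) (auto intro: integrable.intros)
    then show ?thesis using has_bochner_integral_integral_eq[OF h] by (simp add: ennreal_mult')
  qed
  have "(\<integral>\<^sup>+d. ennreal ((norm (y + d))\<^sup>2) \<partial>gauss2 s) = (\<integral>\<^sup>+d. ennreal ((fst y + fst d)\<^sup>2) + ennreal
      ((snd y + snd d)\<^sup>2) \<partial>gauss2 s)"
    by (simp add: norm_prod_sq)
  also have "\<dots> = (\<integral>\<^sup>+d. ennreal ((fst y + fst d)\<^sup>2) \<partial>gauss2 s) + (\<integral>\<^sup>+d. ennreal ((snd y + snd d)\<^sup>2)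
      \<partial>gauss2 s)"
    by (rule nn_integral_add) (simp_all add: borel_prod[symmetric] cong: measurable_cong_sets)
  also have "\<dots> = ennreal (((fst y)\<^sup>2 + s\<^sup>2) + ((snd y)\<^sup>2 + s\<^sup>2))"
    using assms by (simp add: gauss2_fst[where p = "\<lambda>x. ennreal ((fst y + x)\<^sup>2)"] gauss2_snd[where
        p = "\<lambda>x. ennreal ((snd y + x)\<^sup>2)"] one ennreal_plus[symmetric] del: ennreal_plus)
  also have "((fst y)\<^sup>2 + s\<^sup>2) + ((snd y)\<^sup>2 + s\<^sup>2) = (norm y)\<^sup>2 + 2 * s\<^sup>2"
    by (simp add: norm_prod_sq)
  finally show ?thesis .
qed

subsection \<open>The value function\<close>

locale tstar_problem =
  fixes \<theta> \<beta> t :: real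
  assumes \<theta>_pos: "0 < \<theta>" and \<beta>_pos: "0 < \<beta>" and t_star: "is_t_star t"
begin

definition R :: real where "R = \<theta> * sqrt (t / (2 * \<beta>))"

text \<open>The scale is fixed by \<kappa>^2 \<theta>^2 / 2 = \<beta>, so that exp (- \<beta> v^2 s)
  I0 (\<kappa> v |X s|) is a martingale under volatility \<theta>. With this scale \<kappa> R = sqrt
  t.\<close>

definition \<kappa> :: real where "\<kappa> = sqrt (2 * \<beta>) / \<theta>"

text \<open>\<open>H s r\<close> is the expected reward obtained by stopping at radius \<open>R\<close>, from radius \<open>r\<close> and with
  delay \<open>s\<close>: expand \<open>1 / (1 + \<beta> * s)\<close> as a mixture of the exponentials \<open>exp (- \<beta> * v\<^sup>2 * s)\<close> and
  use the Laplace transform of the hitting time of \<open>R\<close>.\<close>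

definition Hint :: "real \<Rightarrow> real \<Rightarrow> real \<Rightarrow> real" where
  "Hint s r v = indicator {0..} v * (R\<^sup>2 * (2 * v * exp (- (1 + \<beta> * s) * v\<^sup>2)) * (I0 (\<kappa> * v * r) /
      I0 (sqrt t * v)))"

definition H :: "real \<Rightarrow> real \<Rightarrow> ennreal" where
  "H s r = (\<integral>\<^sup>+v. ennreal (Hint s r v) \<partial>lborel)"

lemma t_pos: "0 < t"
  using t_star by (simp add: is_t_star_iff)

lemma R_pos: "0 < R"
  using \<theta>_pos \<beta>_pos t_pos by (simp add: R_def)

lemma R_sq: "R\<^sup>2 = \<theta>\<^sup>2 * t / (2 * \<beta>)"
  using \<beta>_pos t_pos by (simp add: R_def power_mult_distrib)

lemma \<kappa>_pos: "0 < \<kappa>"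
  using \<theta>_pos \<beta>_pos by (simp add: \<kappa>_def)

lemma \<kappa>_sq: "\<kappa>\<^sup>2 * \<theta>\<^sup>2 = 2 * \<beta>"
  using \<theta>_pos \<beta>_pos by (simp add: \<kappa>_def power_divide)

lemma \<kappa>_R: "\<kappa> * R = sqrt t"
  using \<theta>_pos \<beta>_pos t_pos by (simp add: \<kappa>_def R_def real_sqrt_mult real_sqrt_divide)

lemma Hint_nonneg: "0 \<le> Hint s r v"
  by (auto simp: Hint_def indicator_def intro!: mult_nonneg_nonneg divide_nonneg_nonneg)

lemma Hint_measurable [measurable]: "(\<lambda>(r, v). Hint s r v) \<in> borel_measurable (borel \<Otimes>\<^sub>M borel)"
  unfolding Hint_def by measurable

lemma H_measurable [measurable]: "H s \<in> borel_measurable borel"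
  unfolding H_def[abs_def] by measurable

lemma Hint_mono: "\<bar>r\<bar> \<le> \<bar>r'\<bar> \<Longrightarrow> Hint s r v \<le> Hint s r' v"
  unfolding Hint_def using \<kappa>_pos
  by (auto simp: indicator_def abs_mult intro!: mult_left_mono divide_right_mono I0_mono
      mult_nonneg_nonneg)

lemma H_mono: "\<bar>r\<bar> \<le> \<bar>r'\<bar> \<Longrightarrow> H s r \<le> H s r'"
  unfolding H_def by (intro nn_integral_mono ennreal_leI Hint_mono)

text \<open>For each v a step of variance \<sigma>^2 multiplies I0 by exp (\<kappa>^2 v^2 \<sigma>^2
  / 2), while the delay \<delta> costs exp (- \<beta> v^2 \<delta>). The two cancel for \<sigma>^2 =
  \<theta>^2 \<delta>, and a smaller variance leaves a loss.\<close>

lemma gauss2_H_le: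
  fixes y :: "real \<times> real"
  assumes \<sigma>: "0 < \<sigma>" "\<sigma>\<^sup>2 \<le> \<theta>\<^sup>2 * \<delta>"
  shows "(\<integral>\<^sup>+d. H (s + \<delta>) (norm (y + d)) \<partial>gauss2 \<sigma>) \<le> H s (norm y)"
proof -
  have "(\<integral>\<^sup>+d. H (s + \<delta>) (norm (y + d)) \<partial>gauss2 \<sigma>) = (\<integral>\<^sup>+v. (\<integral>\<^sup>+d. ennreal (Hint (s + \<delta>) (norm (y +
      d)) v) \<partial>gauss2 \<sigma>) \<partial>lborel)"
    unfolding H_def by (rule gauss2_Fubini[OF \<sigma>(1)]) measurable
  also have "\<dots> \<le> (\<integral>\<^sup>+v. ennreal (Hint s (norm y) v) \<partial>lborel)"
  proof (rule nn_integral_mono)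
    fix v
    show "(\<integral>\<^sup>+d. ennreal (Hint (s + \<delta>) (norm (y + d)) v) \<partial>gauss2 \<sigma>) \<le> ennreal (Hint s (norm y) v)"
    proof (cases "0 \<le> v")
      case True
      define c where "c = R\<^sup>2 * (2 * v * exp (- (1 + \<beta> * (s + \<delta>)) * v\<^sup>2)) / I0 (sqrt t * v)"
      have c: "0 \<le> c" using True by (simp add: c_def)
      have "(\<integral>\<^sup>+d. ennreal (Hint (s + \<delta>) (norm (y + d)) v) \<partial>gauss2 \<sigma>) = (\<integral>\<^sup>+d. ennreal c * ennreal
          (I0 ((\<kappa> * v) * norm (y + d))) \<partial>gauss2 \<sigma>)"
        using True c by (intro nn_integral_cong) (simp add: Hint_def c_def ennreal_mult'[symmetric]
            mult_ac)
      also have "\<dots> = ennreal c * (\<integral>\<^sup>+d. ennreal (I0 ((\<kappa> * v) * norm (y + d))) \<partial>gauss2 \<sigma>)"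
        by (rule nn_integral_cmult) measurable
      also have "\<dots> = ennreal (c * (exp ((\<kappa> * v)\<^sup>2 * \<sigma>\<^sup>2 / 2) * I0 (\<kappa> * v * norm y)))"
        unfolding gauss2_I0[OF \<sigma>(1)] using c by (simp add: ennreal_mult')
      also have "\<dots> \<le> ennreal (Hint s (norm y) v)"
      proof (rule ennreal_leI)
        have "(\<kappa> * v)\<^sup>2 * \<sigma>\<^sup>2 \<le> (\<kappa> * v)\<^sup>2 * (\<theta>\<^sup>2 * \<delta>)" using \<sigma>(2) by (intro mult_left_mono) auto
        also have "\<dots> = 2 * \<beta> * \<delta> * v\<^sup>2" unfolding \<kappa>_sq[symmetric] by (simp add: power_mult_distrib)
        finally have "exp (- (1 + \<beta> * (s + \<delta>)) * v\<^sup>2) * exp ((\<kappa> * v)\<^sup>2 * \<sigma>\<^sup>2 / 2) \<le> exp (- (1 + \<beta> *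
            s) * v\<^sup>2)"
          unfolding exp_add[symmetric] by (simp add: algebra_simps)
        then have "(R\<^sup>2 * (2 * v) * I0 (\<kappa> * v * norm y) / I0 (sqrt t * v)) * (exp (- (1 + \<beta> * (s +
            \<delta>)) * v\<^sup>2) * exp ((\<kappa> * v)\<^sup>2 * \<sigma>\<^sup>2 / 2))
          \<le> (R\<^sup>2 * (2 * v) * I0 (\<kappa> * v * norm y) / I0 (sqrt t * v)) * exp (- (1 + \<beta> * s) * v\<^sup>2)"
          using True by (intro mult_left_mono) auto
        then show "c * (exp ((\<kappa> * v)\<^sup>2 * \<sigma>\<^sup>2 / 2) * I0 (\<kappa> * v * norm y)) \<le> Hint s (norm y) v"
          using True by (simp add: c_def Hint_def mult_ac)
      qed
      finally show ?thesis .
    qed (simp add: Hint_def)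
  qed
  finally show ?thesis by (simp add: H_def)
qed

section \<open>The slope of \<open>H\<close> at R and lower bounds for \<open>H\<close>\<close>

definition wint :: "real \<Rightarrow> real \<Rightarrow> real" where
  "wint s v = indicator {0..} v * (2 * v * exp (- (1 + \<beta> * s) * v\<^sup>2) * bessel_w (sqrt t * v))"

lemma wint_measurable [measurable]: "wint s \<in> borel_measurable borel"
  unfolding wint_def[abs_def] by measurable

lemma wint_nonneg: "0 \<le> wint s v"
  by (auto simp: wint_def indicator_def intro!: mult_nonneg_nonneg bessel_w_nonneg)

lemma discount_pos: "0 \<le> s \<Longrightarrow> 0 < 1 + \<beta> * s"
  using \<beta>_pos by (simp add: add_pos_nonneg)

lemma w_le: "bessel_w (sqrt t * v) \<le> t * v\<^sup>2 / 2"
  using bessel_w_le[of "sqrt t * v"] t_pos by (simp add: power_mult_distrib)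

lemma wint_le: "wint s v \<le> t * (indicator {0..} v * (exp (- (1 + \<beta> * s) * v\<^sup>2) * v ^ (2 * 1 + 1)))"
proof (cases "0 \<le> v")
  case True
  have "2 * v * exp (- (1 + \<beta> * s) * v\<^sup>2) * bessel_w (sqrt t * v) \<le> 2 * v * exp (- (1 + \<beta> * s) *
      v\<^sup>2) * (t * v\<^sup>2 / 2)"
    using True by (intro mult_left_mono w_le) auto
  then show ?thesis using True by (simp add: wint_def power2_eq_square power3_eq_cube mult_ac)
qed (simp add: wint_def)

lemma moment_integral:
  assumes "0 \<le> s"
  shows "has_bochner_integral lborel (\<lambda>v. indicator {0..} v * (exp (- (1 + \<beta> * s) * v\<^sup>2) * v ^ (2 *
      k + 1)))
     (fact k / (2 * (1 + \<beta> * s) ^ (k + 1)))"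
  using odd_gaussian_moment[OF discount_pos[OF assms]] by simp

lemma integrable_wint: assumes "0 \<le> s" shows "integrable lborel (wint s)"
proof (rule Bochner_Integration.integrable_bound)
  show "integrable lborel (\<lambda>v. t * (indicator {0..} v * (exp (- (1 + \<beta> * s) * v\<^sup>2) * v ^ (2 * 1 + 1))))"
    by (intro integrable_mult_right integrable.intros[OF moment_integral] assms)
  show "AE v in lborel. norm (wint s v) \<le> norm (t * (indicator {0..} v * (exp (- (1 + \<beta> * s) * v\<^sup>2)
      * v ^ (2 * 1 + 1))))"
    using wint_le[of s] wint_nonneg[of s]
    by (intro AE_I2) (metis abs_of_nonneg order_trans real_norm_def abs_ge_self)
qed simp

text \<open>\<open>W s\<close> is the derivative of H s (\<rho> R) / R^2 with respect to ln \<rho>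
  at \<rho> = 1. The corresponding slope of the discounted squared radius is 2 / (1 + \<beta> s),
  and the difference of the two governs the lower bounds on \<open>H\<close>.\<close>

definition W :: "real \<Rightarrow> real" where "W s = (\<integral>v. wint s v \<partial>lborel)"

text \<open>Smooth fit: the squared radius has slope 2 in ln \<rho>, and the equation for t says
  that \<open>H 0\<close> has the same slope.\<close>

lemma W_0: "W 0 = 2"
proof -
  have "wint 0 v = 2 * tstar_integrand t v" for v
    by (simp add: wint_def tstar_integrand_def)
  then have "W 0 = 2 * tstar_fun t" by (simp add: W_def tstar_fun_def)
  then show ?thesis using t_star by (simp add: is_t_star_iff)
qed

lemma W_le: assumes "0 \<le> s" shows "W s \<le> t / (2 * (1 + \<beta> * s))"
proof -
  have m: "has_bochner_integral lborel (\<lambda>v. t * (indicator {0..} v * (exp (- (1 + \<beta> * s) * v\<^sup>2) * v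
      ^ (2 * 1 + 1))))
     (t * (fact 1 / (2 * (1 + \<beta> * s) ^ (1 + 1))))"
    by (intro has_bochner_integral_mult_right moment_integral assms)
  have "W s \<le> t * (fact 1 / (2 * (1 + \<beta> * s) ^ (1 + 1)))"
    unfolding W_def has_bochner_integral_integral_eq[OF m, symmetric]
    by (intro integral_mono integrable_wint assms integrable.intros[OF m] wint_le)
  \<comment> \<open>One factor 1 + \<beta> s is given up so that the bound is proportional to the
    value R^2 / (1 + \<beta> s) of \<open>H\<close> on the circle, with a ratio free of s.\<close>
  also have "\<dots> \<le> t * (1 / (2 * (1 + \<beta> * s)))"
  proof (rule mult_left_mono)
    have "1 + \<beta> * s \<le> (1 + \<beta> * s) ^ 2"
      using assms \<beta>_pos by (intro self_le_power) auto
    then have "1 / (2 * (1 + \<beta> * s) ^ 2) \<le> 1 / (2 * (1 + \<beta> * s))"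
      using discount_pos[OF assms] by (intro divide_left_mono mult_pos_pos) auto
    then show "fact 1 / (2 * (1 + \<beta> * s) ^ (1 + 1)) \<le> 1 / (2 * (1 + \<beta> * s))"
      by (simp only: fact_1 one_add_one)
  qed (use t_pos in simp)
  finally show ?thesis by simp
qed

text \<open>The inequality exp (- \<beta> s v^2) \<ge> 1 - \<beta> s v^2 reduces the claim to
  \<open>W_0\<close> and a fifth moment. Smooth fit thus deteriorates at most linearly in the
  delay.\<close>

lemma W_ge: assumes "0 \<le> s" shows "2 - \<beta> * s * t \<le> W s"
proof -
  let ?g = "\<lambda>v. indicator {0..} v * (exp (- (1 + \<beta> * 0) * v\<^sup>2) * v ^ (2 * 2 + 1))"
  have m: "has_bochner_integral lborel (\<lambda>v. \<beta> * s * t * ?g v) (\<beta> * s * t * (fact 2 / (2 * (1 + \<beta> *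
      0) ^ (2 + 1))))"
    by (intro has_bochner_integral_mult_right moment_integral) simp
  have "(\<integral>v. wint 0 v - \<beta> * s * t * ?g v \<partial>lborel) \<le> W s"
    unfolding W_def
  proof (intro integral_mono integrable_wint assms Bochner_Integration.integrable_diff
      integrable.intros[OF m])
    fix v
    show "wint 0 v - \<beta> * s * t * ?g v \<le> wint s v"
    proof (cases "0 \<le> v")
      case True
      let ?w = "bessel_w (sqrt t * v)"
      have "exp (- v\<^sup>2) * (1 + - \<beta> * s * v\<^sup>2) \<le> exp (- v\<^sup>2) * exp (- \<beta> * s * v\<^sup>2)"
        using exp_ge_add_one_self[of "- \<beta> * s * v\<^sup>2"] by (intro mult_left_mono) auto
      also have "\<dots> = exp (- (1 + \<beta> * s) * v\<^sup>2)" unfolding exp_add[symmetric] by (simp add: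
          algebra_simps)
      finally have "2 * v * ?w * (exp (- v\<^sup>2) * (1 + - \<beta> * s * v\<^sup>2)) \<le> 2 * v * ?w * exp (- (1 + \<beta> *
          s) * v\<^sup>2)"
        using True bessel_w_nonneg by (intro mult_left_mono) auto
      moreover have "2 * v * exp (- v\<^sup>2) * \<beta> * s * v\<^sup>2 * ?w \<le> 2 * v * exp (- v\<^sup>2) * \<beta> * s * v\<^sup>2 *
          (t * v\<^sup>2 / 2)"
        using True \<beta>_pos assms by (intro mult_left_mono w_le) auto
      moreover have "v ^ 5 = v * v\<^sup>2 * v\<^sup>2" by (simp add: numeral_eq_Suc)
      ultimately show ?thesis using True by (simp add: wint_def algebra_simps)
    qed (simp add: wint_def)
  qed simp
  also have "(\<integral>v. wint 0 v - \<beta> * s * t * ?g v \<partial>lborel) = 2 - \<beta> * s * t * (fact 2 / (2 * (1 + \<beta> * 0)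
      ^ (2 + 1)))"
    using Bochner_Integration.integral_diff[OF integrable_wint[OF order_refl] integrable.intros[OF m]]
      W_0[unfolded W_def] has_bochner_integral_integral_eq[OF m] by (simp only:)
  finally show ?thesis by simp
qed

text \<open>The tangent inequality with exponent 2, integrated over v. The constant terms give the
  total mass 1 / (1 + \<beta> s), the slope terms give
  \<open>W s - 2 / (1 + \<beta> * s)\<close>.\<close>

lemma H_ge:
  assumes "0 \<le> s" "0 < \<rho>"
  shows "ennreal (R\<^sup>2 * \<rho>\<^sup>2 * (1 / (1 + \<beta> * s) + (W s - 2 / (1 + \<beta> * s)) * ln \<rho>)) \<le> H s (\<rho> * R)"
proof -
  let ?a = "1 + \<beta> * s"
  let ?m = "\<lambda>v. indicator {0..} v * (exp (- ?a * v\<^sup>2) * v ^ (2 * 0 + 1)) :: real"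
  let ?g = "\<lambda>v. R\<^sup>2 * \<rho>\<^sup>2 * ((2 - 4 * ln \<rho>) * ?m v + ln \<rho> * wint s v)"
  have "has_bochner_integral lborel ?g
      (R\<^sup>2 * \<rho>\<^sup>2 * ((2 - 4 * ln \<rho>) * (fact 0 / (2 * ?a ^ (0 + 1))) + ln \<rho> * W s))"
    unfolding W_def
    by (intro has_bochner_integral_mult_right has_bochner_integral_add moment_integral
       has_bochner_integral_integrable integrable_wint assms)
  moreover have "(2 - 4 * ln \<rho>) * (fact 0 / (2 * ?a ^ (0 + 1))) + ln \<rho> * W s = 1 / ?a + (W s - 2 /
      ?a) * ln \<rho>"
    using discount_pos[OF assms(1)] by (simp add: field_simps)
  ultimately have g: "has_bochner_integral lborel ?g (R\<^sup>2 * \<rho>\<^sup>2 * (1 / ?a + (W s - 2 / ?a) * ln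
      \<rho>))" by simp
  have le: "?g v \<le> Hint s (\<rho> * R) v" for v
  proof (cases "0 \<le> v")
    case True
    let ?w = "bessel_w (sqrt t * v)"
    have "\<rho>\<^sup>2 * I0 (sqrt t * v) * (1 + (?w - 2) * ln \<rho>) \<le> I0 (\<rho> * (sqrt t * v))"
      using I0_tangent[OF assms(2), of 2 "sqrt t * v"] assms(2) by simp
    then have "\<rho>\<^sup>2 * (1 + (?w - 2) * ln \<rho>) \<le> I0 (\<rho> * (sqrt t * v)) / I0 (sqrt t * v)"
      by (simp add: pos_le_divide_eq mult_ac)
    also have "\<rho> * (sqrt t * v) = \<kappa> * v * (\<rho> * R)" unfolding \<kappa>_R[symmetric] by (simp add: mult_ac)
    finally have "R\<^sup>2 * (2 * v * exp (- ?a * v\<^sup>2)) * (\<rho>\<^sup>2 * (1 + (?w - 2) * ln \<rho>))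
       \<le> R\<^sup>2 * (2 * v * exp (- ?a * v\<^sup>2)) * (I0 (\<kappa> * v * (\<rho> * R)) / I0 (sqrt t * v))"
      using True by (intro mult_left_mono) auto
    moreover have "?g v = R\<^sup>2 * (2 * v * exp (- ?a * v\<^sup>2)) * (\<rho>\<^sup>2 * (1 + (?w - 2) * ln \<rho>))"
      using True by (simp add: wint_def algebra_simps)
    moreover have "Hint s (\<rho> * R) v = R\<^sup>2 * (2 * v * exp (- ?a * v\<^sup>2)) * (I0 (\<kappa> * v * (\<rho> * R)) / I0
        (sqrt t * v))"
      using True by (simp add: Hint_def)
    ultimately show ?thesis by (simp only:)
  qed (simp add: wint_def Hint_def)
  have "R\<^sup>2 * \<rho>\<^sup>2 * (1 / ?a + (W s - 2 / ?a) * ln \<rho>) = (\<integral>v. ?g v \<partial>lborel)"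
    by (rule has_bochner_integral_integral_eq[OF g, symmetric])
  \<comment> \<open>The tangent line may be negative, whereas \<open>H\<close> integrates
    nonnegative values; truncation at 0 bridges the two.\<close>
  also have "\<dots> \<le> (\<integral>v. max 0 (?g v) \<partial>lborel)"
    by (intro integral_mono integrable_max integrable.intros[OF g]) auto
  finally have "ennreal (R\<^sup>2 * \<rho>\<^sup>2 * (1 / ?a + (W s - 2 / ?a) * ln \<rho>)) \<le> ennreal (\<integral>v. max 0 (?g v)
      \<partial>lborel)"
    by (rule ennreal_leI)
  also have "\<dots> = (\<integral>\<^sup>+v. ennreal (max 0 (?g v)) \<partial>lborel)"
    by (intro nn_integral_eq_integral[symmetric] integrable_max integrable.intros[OF g]) auto
  also have "\<dots> \<le> H s (\<rho> * R)"
    unfolding H_def using le Hint_nonneg by (intro nn_integral_mono ennreal_leI) auto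
  finally show ?thesis .
qed

lemma H_0_ge: "0 < r \<Longrightarrow> ennreal (r\<^sup>2) \<le> H 0 r"
  using H_ge[of 0 "r / R"] R_pos by (simp add: W_0 power_divide)

text \<open>The shortfall is the slope defect, at most \<beta> s t, times ln \<rho> \<le> \<rho> -
  1. It is a product of delay and relative overshoot: with a delay \<epsilon> and an overshoot of
  order sqrt \<epsilon> it is negligible against \<epsilon>.\<close>

lemma H_ge_outside:
  assumes "0 \<le> s" "R \<le> r"
  shows "ennreal (r\<^sup>2 / (1 + \<beta> * s)) \<le> H s r + ennreal (\<beta> * s * t * (r\<^sup>2 * (r / R - 1)))"
proof -
  define \<rho> where "\<rho> = r / R"
  have \<rho>: "1 \<le> \<rho>" "r = \<rho> * R" using assms R_pos by (auto simp: \<rho>_def)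
  let ?a = "1 + \<beta> * s"
  have a: "1 \<le> ?a" using assms \<beta>_pos by simp
  have ln: "0 \<le> ln \<rho>" "ln \<rho> \<le> \<rho> - 1" using \<rho> by (auto intro: ln_le_minus_one)
  have aux: "- x \<le> y \<Longrightarrow> x \<le> z \<Longrightarrow> 0 \<le> y + z" for x y z :: real by linarith
  have "2 / ?a \<le> 2" using a by (simp add: divide_le_eq)
  then have "- (\<beta> * s * t) \<le> W s - 2 / ?a" using W_ge[OF assms(1)] by linarith
  then have "- (\<beta> * s * t) * ln \<rho> \<le> (W s - 2 / ?a) * ln \<rho>" using ln by (intro mult_right_mono)
  moreover have "(\<beta> * s * t) * ln \<rho> \<le> (\<beta> * s * t) * (\<rho> - 1)"
    using ln \<beta>_pos t_pos assms by (intro mult_left_mono) auto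
  ultimately have "0 \<le> (W s - 2 / ?a) * ln \<rho> + (\<beta> * s * t) * (\<rho> - 1)"
    unfolding mult_minus_left by (rule aux)
  then have "1 / ?a \<le> (1 / ?a + (W s - 2 / ?a) * ln \<rho>) + \<beta> * s * t * (\<rho> - 1)"
    by (simp only: add.assoc le_add_same_cancel1)
  then have "R\<^sup>2 * \<rho>\<^sup>2 * (1 / ?a) \<le> R\<^sup>2 * \<rho>\<^sup>2 * ((1 / ?a + (W s - 2 / ?a) * ln \<rho>) + \<beta> * s * t * (\<rho>
      - 1))"
    by (intro mult_left_mono) auto
  then have "r\<^sup>2 / ?a \<le> R\<^sup>2 * \<rho>\<^sup>2 * (1 / ?a + (W s - 2 / ?a) * ln \<rho>) + \<beta> * s * t * (r\<^sup>2 * (\<rho> - 1))"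
    unfolding \<rho>(2) by (simp add: power_mult_distrib algebra_simps)
  then have "ennreal (r\<^sup>2 / ?a) \<le> ennreal (R\<^sup>2 * \<rho>\<^sup>2 * (1 / ?a + (W s - 2 / ?a) * ln \<rho>) + \<beta> * s * t
      * (r\<^sup>2 * (\<rho> - 1)))"
    by (rule ennreal_leI)
  \<comment> \<open>\<open>ennreal\<close> is additive on nonnegative summands only, hence the split
    on the sign of the tangent value.\<close>
  also have "\<dots> \<le> ennreal (R\<^sup>2 * \<rho>\<^sup>2 * (1 / ?a + (W s - 2 / ?a) * ln \<rho>)) + ennreal (\<beta> * s * t * (r\<^sup>2
      * (\<rho> - 1)))"
    using \<rho>(1) \<beta>_pos t_pos assms(1) by (cases "0 \<le> R\<^sup>2 * \<rho>\<^sup>2 * (1 / ?a + (W s - 2 / ?a) * ln \<rho>)")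
     (auto simp: ennreal_neg add_increasing intro!: ennreal_leI)
  also have "\<dots> \<le> H s r + ennreal (\<beta> * s * t * (r\<^sup>2 * (\<rho> - 1)))"
    unfolding \<rho>(2) using H_ge[OF assms(1), of \<rho>] \<rho>(1) by (intro add_right_mono) auto
  finally show ?thesis by (simp add: \<rho>_def)
qed

text \<open>Here ln \<rho> \<le> 0, so an upper bound on the slope is what counts. The prefactor
  does not involve s and tends to 1 as \<rho> tends to 1: stopping slightly inside the circle costs
  only this factor.\<close>

lemma H_ge_inside:
  assumes "0 \<le> s" "0 < \<rho>" "\<rho> \<le> 1" "\<rho> * R \<le> r"
  shows "ennreal (\<rho>\<^sup>2 * (1 + t / 2 * ln \<rho>) * (R\<^sup>2 / (1 + \<beta> * s))) \<le> H s r"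
proof -
  let ?a = "1 + \<beta> * s"
  have a: "0 < ?a" using discount_pos assms by simp
  have "ln \<rho> \<le> 0" using assms by simp
  moreover have "W s - 2 / ?a \<le> t / (2 * ?a)" using W_le[OF assms(1)] a by (smt (verit)
      divide_nonneg_pos)
  ultimately have "t / (2 * ?a) * ln \<rho> \<le> (W s - 2 / ?a) * ln \<rho>" by (intro mult_right_mono_neg)
  then have le: "R\<^sup>2 * \<rho>\<^sup>2 * (1 / ?a + t / (2 * ?a) * ln \<rho>) \<le> R\<^sup>2 * \<rho>\<^sup>2 * (1 / ?a + (W s - 2 / ?a)
      * ln \<rho>)"
    by (intro mult_left_mono) auto
  have "1 / ?a + t / (2 * ?a) * ln \<rho> = (1 + t / 2 * ln \<rho>) / ?a" by (simp add: add_divide_distrib)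
  then have "\<rho>\<^sup>2 * (1 + t / 2 * ln \<rho>) * (R\<^sup>2 / ?a) = R\<^sup>2 * \<rho>\<^sup>2 * (1 / ?a + t / (2 * ?a) * ln \<rho>)"
    by (simp only: times_divide_eq_left times_divide_eq_right mult_ac)
  also note le
  finally have "ennreal (\<rho>\<^sup>2 * (1 + t / 2 * ln \<rho>) * (R\<^sup>2 / ?a)) \<le> ennreal (R\<^sup>2 * \<rho>\<^sup>2 * (1 / ?a + (W
      s - 2 / ?a) * ln \<rho>))"
    by (rule ennreal_leI)
  also have "\<dots> \<le> H s (\<rho> * R)"
    by (rule H_ge[OF assms(1,2)])
  also have "\<dots> \<le> H s r" using assms R_pos by (intro H_mono) auto
  finally show ?thesis .
qed

text \<open>Up to radius R each ratio of I0 is at most 1, which leaves the total mass of the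
  mixture. This supplies finiteness of \<open>H 0\<close> and the comparison on the circle
  itself.\<close>

lemma H_0_le: assumes "0 \<le> r" "r \<le> R" shows "H 0 r \<le> ennreal (R\<^sup>2)"
proof -
  have m: "has_bochner_integral lborel (\<lambda>v. 2 * R\<^sup>2 * (indicator {0..} v * (exp (- (1 + \<beta> * 0) *
      v\<^sup>2) * v ^ (2 * 0 + 1)))) (2 * R\<^sup>2 * (fact 0 / (2 * (1 + \<beta> * 0) ^ (0 + 1))))"
    by (intro has_bochner_integral_mult_right moment_integral) simp
  have "H 0 r \<le> (\<integral>\<^sup>+v. ennreal (2 * R\<^sup>2 * (indicator {0..} v * (exp (- (1 + \<beta> * 0) * v\<^sup>2) * v ^ (2
      * 0 + 1)))) \<partial>lborel)"
    unfolding H_def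
  proof (intro nn_integral_mono ennreal_leI)
    fix v
    show "Hint 0 r v \<le> 2 * R\<^sup>2 * (indicator {0..} v * (exp (- (1 + \<beta> * 0) * v\<^sup>2) * v ^ (2 * 0 + 1)))"
    proof (cases "0 \<le> v")
      case True
      have "\<kappa> * v * r \<le> \<kappa> * v * R" using True assms \<kappa>_pos by (intro mult_left_mono) auto
      also have "\<kappa> * v * R = sqrt t * v" unfolding \<kappa>_R[symmetric] by (simp add: mult_ac)
      finally have "I0 (\<kappa> * v * r) \<le> I0 (sqrt t * v)"
        using True assms \<kappa>_pos by (intro I0_mono) auto
      then have "I0 (\<kappa> * v * r) / I0 (sqrt t * v) \<le> 1" by (simp add: divide_le_eq)
      then have "R\<^sup>2 * (2 * v * exp (- (1 + \<beta> * 0) * v\<^sup>2)) * (I0 (\<kappa> * v * r) / I0 (sqrt t * v)) \<le>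
          R\<^sup>2 * (2 * v * exp (- (1 + \<beta> * 0) * v\<^sup>2)) * 1"
        using True by (intro mult_left_mono) auto
      then show ?thesis using True by (simp add: Hint_def mult_ac)
    qed (simp add: Hint_def)
  qed
  also have "\<dots> = ennreal (R\<^sup>2)"
  proof -
    have "AE v in lborel. 0 \<le> 2 * R\<^sup>2 * (indicator {0..} v * (exp (- (1 + \<beta> * 0) * v\<^sup>2) * v ^ (2 *
        0 + 1)))"
      by (intro AE_I2) (simp add: indicator_def)
    from nn_integral_eq_integral[OF integrable.intros[OF m] this]
    show ?thesis unfolding has_bochner_integral_integral_eq[OF m] by simp
  qed
  finally show ?thesis .
qed

end

subsection \<open>Planar Brownian motion on a time grid\<close>

locale planar_bm = prob_space M for M :: "'a measure" +
  fixes W1 W2 :: "real \<Rightarrow> 'a \<Rightarrow> real"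
  assumes pbm: "planar_brownian_motion M W1 W2"
begin

lemma bm: "brownian_motion M W1" "brownian_motion M W2"
  and indep_W: "indep_var (PiM {0..} (\<lambda>_. borel)) (\<lambda>\<omega>. \<lambda>t\<in>{0..}. W1 t \<omega>)
       (PiM {0..} (\<lambda>_. borel)) (\<lambda>\<omega>. \<lambda>t\<in>{0..}. W2 t \<omega>)"
  using pbm by (auto simp: planar_brownian_motion_def)

lemma W_measurable: "0 \<le> s \<Longrightarrow> W1 s \<in> borel_measurable M" "0 \<le> s \<Longrightarrow> W2 s \<in> borel_measurable M"
  using bm by (auto simp: brownian_motion_def)

lemma W_continuous:
  "\<omega> \<in> space M \<Longrightarrow> continuous_on {0..} (\<lambda>s. W1 s \<omega>)"
  "\<omega> \<in> space M \<Longrightarrow> continuous_on {0..} (\<lambda>s. W2 s \<omega>)"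
  using bm by (auto simp: brownian_motion_def)

end

text \<open>The planar Brownian motion sampled at the times \<open>ts j\<close> and run with volatility \<open>a j\<close> between
  \<open>ts j\<close> and \<open>ts (Suc j)\<close>.\<close>

locale sampled_bm = planar_bm +
  fixes ts :: "nat \<Rightarrow> real" and a :: "nat \<Rightarrow> real" and x :: "real \<times> real"
  assumes ts_0: "0 \<le> ts 0" and ts_Suc: "\<And>i. ts i < ts (Suc i)" and a_pos: "\<And>i. 0 < a i"
begin

section \<open>Law and independence of the grid increments\<close>

lemma ts_nonneg: "0 \<le> ts i"
  by (induction i) (use ts_0 ts_Suc in \<open>auto intro: order_trans less_imp_le\<close>)

text \<open>The Boolean selects the component, so the increments of both motions form one family and
  their joint independence is a single statement.\<close>

definition inc :: "bool \<times> nat \<Rightarrow> 'a \<Rightarrow> real" where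
  "inc k \<omega> = (if fst k then W1 (ts (Suc (snd k))) \<omega> - W1 (ts (snd k)) \<omega>
                       else W2 (ts (Suc (snd k))) \<omega> - W2 (ts (snd k)) \<omega>)"

lemma inc_measurable [measurable]: "inc k \<in> borel_measurable M"
  unfolding inc_def[abs_def] using W_measurable ts_nonneg by (cases "fst k") auto

lemma indep_inc_components:
  "0 < n \<Longrightarrow> indep_vars (\<lambda>_. borel) (\<lambda>i. inc (b, i)) {..<n}"
  using bm ts_0 ts_Suc
  by (cases b) (auto simp: brownian_motion_def inc_def[abs_def] less_imp_le)

text \<open>Independence across components is known for paths, independence over time for each
  component separately. A rectangle event for all increments is a pair of path events
  \<open>S True\<close> and \<open>S False\<close>, which splits the probability by components; each
  factor then splits over time.\<close>

lemma indep_inc: assumes "0 < n" shows "indep_vars (\<lambda>_. borel) inc (UNIV \<times> {..<n})"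
proof (subst indep_vars_finite[where E = "\<lambda>_. sets borel"])
  show "\<forall>A\<in>UNIV \<times> {..<n} \<rightarrow> sets borel.
     prob (\<Inter>j\<in>UNIV \<times> {..<n}. inc j -` A j \<inter> space M) = (\<Prod>j\<in>UNIV \<times> {..<n}. prob (inc j -` A j \<inter>
         space M))"
  proof
    fix A :: "bool \<times> nat \<Rightarrow> real set" assume A: "A \<in> UNIV \<times> {..<n} \<rightarrow> sets borel"
    have [measurable]: "(\<lambda>p. p s) \<in> borel_measurable (PiM {0..} (\<lambda>_. borel))" if "0 \<le> s" for s :: real
      using that by (intro measurable_component_singleton) simp
    note [simp] = ts_nonneg
    define S where "S b = {p \<in> space (PiM {0..} (\<lambda>_. borel)). \<forall>i\<in>{..<n}. p (ts (Suc i)) - p (ts i)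
        \<in> A (b, i)}" for b
    have S: "S b \<in> sets (PiM {0..} (\<lambda>_. borel))" for b
    proof -
      have "{p \<in> space (PiM {0..} (\<lambda>_. borel)). p (ts (Suc i)) - p (ts i) \<in> A (b, i)} \<in> sets (PiM
          {0..} (\<lambda>_. borel))"
        if "i < n" for i
      proof -
        have d: "(\<lambda>p. p (ts (Suc i)) - p (ts i) :: real) \<in> borel_measurable (PiM {0..} (\<lambda>_. borel))"
          by (rule borel_measurable_diff; rule measurable_component_singleton) simp_all
        have "A (b, i) \<in> sets borel" using A that by auto
        from measurable_sets[OF d this] show ?thesis by (simp add: vimage_def Int_def conj_commute)
      qed
      then show ?thesis unfolding S_def by (intro sets.sets_Collect_finite_All') (use assms in auto)
    qed
    have ne: "{..<n} \<noteq> {}" "UNIV \<times> {..<n} \<noteq> ({} :: (bool \<times> nat) set)" using assms by auto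
    have S1: "(\<lambda>t\<in>{0..}. W1 t \<omega>) \<in> S True \<longleftrightarrow> (\<forall>i<n. inc (True, i) \<omega> \<in> A (True, i))" for \<omega>
      by (simp add: S_def inc_def space_PiM Ball_def)
    have S2: "(\<lambda>t\<in>{0..}. W2 t \<omega>) \<in> S False \<longleftrightarrow> (\<forall>i<n. inc (False, i) \<omega> \<in> A (False, i))" for \<omega>
      by (simp add: S_def inc_def space_PiM Ball_def)
    have 1: "(\<Inter>j\<in>UNIV \<times> {..<n}. inc j -` A j \<inter> space M)
       = (\<lambda>\<omega>. (\<lambda>t\<in>{0..}. W1 t \<omega>, \<lambda>t\<in>{0..}. W2 t \<omega>)) -` (S True \<times> S False) \<inter> space M"
      using ne by (simp only: INT_simps if_False) (auto simp: S1 S2, metis (full_types))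
    have 2: "(\<lambda>\<omega>. \<lambda>t\<in>{0..}. W1 t \<omega>) -` S True \<inter> space M = (\<Inter>i\<in>{..<n}. inc (True, i) -` A (True, i)
        \<inter> space M)"
      "(\<lambda>\<omega>. \<lambda>t\<in>{0..}. W2 t \<omega>) -` S False \<inter> space M = (\<Inter>i\<in>{..<n}. inc (False, i) -` A (False, i) \<inter>
          space M)"
      using ne by (simp_all only: INT_simps if_False) (auto simp: S1 S2)
    have 3: "prob (\<Inter>i\<in>{..<n}. inc (b, i) -` A (b, i) \<inter> space M) = (\<Prod>i\<in>{..<n}. prob (inc (b, i) -` A
        (b, i) \<inter> space M))" for b
      using assms A by (intro indep_varsD_finite[OF indep_inc_components[OF assms]]) auto
    have "prob (\<Inter>j\<in>UNIV \<times> {..<n}. inc j -` A j \<inter> space M)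
       = (\<Prod>i\<in>{..<n}. prob (inc (True, i) -` A (True, i) \<inter> space M)) * (\<Prod>i\<in>{..<n}. prob (inc (False,
           i) -` A (False, i) \<inter> space M))"
      unfolding 1 indep_varD[OF indep_W S S] 2 3 ..
    also have "\<dots> = (\<Prod>j\<in>UNIV \<times> {..<n}. prob (inc j -` A j \<inter> space M))"
      using prod.cartesian_product[of "\<lambda>b i. prob (inc (b, i) -` A (b, i) \<inter> space M)" "{..<n}" UNIV]
      by (simp add: UNIV_bool mult.commute case_prod_beta')
    finally show "prob (\<Inter>j\<in>UNIV \<times> {..<n}. inc j -` A j \<inter> space M) = (\<Prod>j\<in>UNIV \<times> {..<n}. prob (inc j
        -` A j \<inter> space M))" .
  qed
  show "sets borel = sigma_sets (space borel) (sets (borel :: real measure))"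
    by (rule sets.sigma_sets_eq[symmetric])
  show "Int_stable (sets (borel :: real measure))" by (rule sets.Int_stable)
  show "sets (borel :: real measure) \<subseteq> Pow (space borel)" by (rule sets.space_closed)
qed (use assms in auto)

definition D :: "nat \<Rightarrow> 'a \<Rightarrow> real \<times> real" where
  "D j \<omega> = (a j * inc (True, j) \<omega>, a j * inc (False, j) \<omega>)"

definition \<sigma> :: "nat \<Rightarrow> real" where
  "\<sigma> j = a j * sqrt (ts (Suc j) - ts j)"

lemma \<sigma>_pos: "0 < \<sigma> j"
  using a_pos ts_Suc by (simp add: \<sigma>_def)

lemma D_measurable [measurable]: "D j \<in> borel_measurable M"
  unfolding D_def[abs_def] borel_prod[symmetric] by measurable

lemma distr_inc: "distr M borel (\<lambda>\<omega>. a j * inc (b, j) \<omega>) = density lborel (normal_density 0 (\<sigma> j))"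
proof -
  have "distributed M lborel (inc (b, j)) (normal_density 0 (sqrt (ts (Suc j) - ts j)))"
    using bm ts_nonneg[of j] ts_Suc[of j]
    by (cases b) (auto simp: brownian_motion_def inc_def[abs_def])
  from normal_density_affine[OF this, of "a j" 0] a_pos[of j] ts_Suc[of j]
  have "distributed M lborel (\<lambda>\<omega>. a j * inc (b, j) \<omega>) (normal_density 0 (\<sigma> j))"
    by (simp add: \<sigma>_def)
  then have "distr M lborel (\<lambda>\<omega>. a j * inc (b, j) \<omega>) = density lborel (normal_density 0 (\<sigma> j))"
    by (simp add: distributed_def)
  moreover have "distr M lborel (\<lambda>\<omega>. a j * inc (b, j) \<omega>) = distr M borel (\<lambda>\<omega>. a j * inc (b, j) \<omega>)"
    by (rule distr_cong) auto
  ultimately show ?thesis by simp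
qed

lemma distr_D: "distr M borel (D j) = gauss2 (\<sigma> j)"
proof -
  have "indep_var (PiM {(True, j)} (\<lambda>_. borel)) (\<lambda>\<omega>. \<lambda>i\<in>{(True, j)}. inc i \<omega>)
     (PiM {(False, j)} (\<lambda>_. borel)) (\<lambda>\<omega>. \<lambda>i\<in>{(False, j)}. inc i \<omega>)"
    by (rule indep_var_restrict[OF indep_inc[of "Suc j"]]) auto
  then have "indep_var borel ((\<lambda>p. a j * p (True, j)) \<circ> (\<lambda>\<omega>. \<lambda>i\<in>{(True, j)}. inc i \<omega>))
     borel ((\<lambda>p. a j * p (False, j)) \<circ> (\<lambda>\<omega>. \<lambda>i\<in>{(False, j)}. inc i \<omega>))"
    by (rule indep_var_compose) (auto intro!: borel_measurable_times measurable_component_singleton)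
  then have "indep_var borel (\<lambda>\<omega>. a j * inc (True, j) \<omega>) borel (\<lambda>\<omega>. a j * inc (False, j) \<omega>)"
    by (simp add: o_def)
  then have "distr M borel (\<lambda>\<omega>. a j * inc (True, j) \<omega>) \<Otimes>\<^sub>M distr M borel (\<lambda>\<omega>. a j * inc (False, j) \<omega>)
     = distr M (borel \<Otimes>\<^sub>M borel) (\<lambda>\<omega>. (a j * inc (True, j) \<omega>, a j * inc (False, j) \<omega>))"
    by (simp add: indep_var_distribution_eq)
  then show ?thesis unfolding distr_inc gauss2_def D_def[abs_def] borel_prod ..
qed

definition past :: "nat \<Rightarrow> 'a \<Rightarrow> bool \<times> nat \<Rightarrow> real" where
  "past j \<omega> = (\<lambda>k\<in>UNIV \<times> {..<j}. inc k \<omega>)"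

lemma past_measurable [measurable]: "past j \<in> M \<rightarrow>\<^sub>M PiM (UNIV \<times> {..<j}) (\<lambda>_. borel)"
  unfolding past_def[abs_def] by (intro measurable_restrict) simp

definition cur :: "nat \<Rightarrow> 'a \<Rightarrow> bool \<times> nat \<Rightarrow> real" where
  "cur j \<omega> = (\<lambda>k\<in>UNIV \<times> {j}. inc k \<omega>)"

lemma cur_measurable [measurable]: "cur j \<in> M \<rightarrow>\<^sub>M PiM (UNIV \<times> {j}) (\<lambda>_. borel)"
  unfolding cur_def[abs_def] by (intro measurable_restrict) simp

lemma indep_past_cur:
  "indep_var (PiM (UNIV \<times> {..<j}) (\<lambda>_. borel)) (past j) (PiM (UNIV \<times> {j}) (\<lambda>_. borel)) (cur j)"
  unfolding past_def[abs_def] cur_def[abs_def]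
  by (rule indep_var_restrict[OF indep_inc[of "Suc j"]]) auto

text \<open>The Markov property at grid times without conditional expectations: the joint law of
  past and current increments is a product, so Fubini integrates the new step first, with the past
  frozen.\<close>

lemma nn_integral_past_D:
  assumes [measurable]: "case_prod F \<in> borel_measurable (PiM (UNIV \<times> {..<j}) (\<lambda>_. borel) \<Otimes>\<^sub>M borel)"
  shows "(\<integral>\<^sup>+\<omega>. F (past j \<omega>) (D j \<omega>) \<partial>M) = (\<integral>\<^sup>+\<omega>. (\<integral>\<^sup>+d. F (past j \<omega>) d \<partial>gauss2 (\<sigma> j)) \<partial>M)"
proof -
  let ?N = "PiM (UNIV \<times> {..<j}) (\<lambda>_. borel) :: (bool \<times> nat \<Rightarrow> real) measure"
  let ?C = "PiM (UNIV \<times> {j}) (\<lambda>_. borel) :: (bool \<times> nat \<Rightarrow> real) measure"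
  define dm :: "(bool \<times> nat \<Rightarrow> real) \<Rightarrow> real \<times> real" where "dm q = (a j * q (True, j), a j * q
      (False, j))" for q
  have dm [measurable]: "dm \<in> borel_measurable ?C"
    unfolding dm_def[abs_def] borel_prod[symmetric]
    by (intro measurable_Pair borel_measurable_times measurable_component_singleton) auto
  have D: "D j \<omega> = dm (cur j \<omega>)" for \<omega> by (simp add: dm_def cur_def D_def)
  interpret C: prob_space "distr M ?C (cur j)" by (rule prob_space_distr) measurable
  interpret G: prob_space "gauss2 (\<sigma> j)" by (rule prob_space_gauss2[OF \<sigma>_pos])
  have eq: "distr M ?N (past j) \<Otimes>\<^sub>M distr M ?C (cur j) = distr M (?N \<Otimes>\<^sub>M ?C) (\<lambda>\<omega>. (past j \<omega>, cur j \<omega>))"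
    using indep_past_cur[of j] unfolding indep_var_distribution_eq by simp
  have F': "(\<lambda>z. F (fst z) (dm (snd z))) \<in> borel_measurable (?N \<Otimes>\<^sub>M ?C)"
  proof -
    have "(\<lambda>z. (fst z, dm (snd z))) \<in> ?N \<Otimes>\<^sub>M ?C \<rightarrow>\<^sub>M ?N \<Otimes>\<^sub>M borel" by measurable
    from measurable_compose[OF this assms] show ?thesis by simp
  qed
  have g: "(\<integral>\<^sup>+q. F p (dm q) \<partial>distr M ?C (cur j)) = (\<integral>\<^sup>+d. F p d \<partial>gauss2 (\<sigma> j))" if p: "p \<in> space
      ?N" for p
  proof -
    have [measurable]: "F p \<in> borel_measurable borel"
      using measurable_compose[OF measurable_Pair1'[OF p] assms] by simp
    have "(\<integral>\<^sup>+q. F p (dm q) \<partial>distr M ?C (cur j)) = (\<integral>\<^sup>+\<omega>. F p (D j \<omega>) \<partial>M)"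
      unfolding D by (subst nn_integral_distr) auto
    also have "\<dots> = (\<integral>\<^sup>+d. F p d \<partial>distr M borel (D j))"
      by (subst nn_integral_distr) auto
    finally show ?thesis unfolding distr_D .
  qed
  have "(\<integral>\<^sup>+\<omega>. F (past j \<omega>) (D j \<omega>) \<partial>M) = (\<integral>\<^sup>+z. F (fst z) (dm (snd z)) \<partial>distr M (?N \<Otimes>\<^sub>M ?C) (\<lambda>\<omega>.
      (past j \<omega>, cur j \<omega>)))"
    using F' by (subst nn_integral_distr) (auto simp: D)
  also have "\<dots> = (\<integral>\<^sup>+p. (\<integral>\<^sup>+q. F (fst (p, q)) (dm (snd (p, q))) \<partial>distr M ?C (cur j)) \<partial>distr M ?N
      (past j))"
    unfolding eq[symmetric]
    by (rule C.nn_integral_fst[symmetric]) (use F' in \<open>simp cong: measurable_cong_sets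
        sets_pair_measure_cong\<close>)
  also have "\<dots> = (\<integral>\<^sup>+p. (\<integral>\<^sup>+d. F p d \<partial>gauss2 (\<sigma> j)) \<partial>distr M ?N (past j))"
    by (intro nn_integral_cong) (simp add: g)
  also have "\<dots> = (\<integral>\<^sup>+\<omega>. (\<integral>\<^sup>+d. F (past j \<omega>) d \<partial>gauss2 (\<sigma> j)) \<partial>M)"
  proof (rule nn_integral_distr)
    have "case_prod F \<in> borel_measurable (?N \<Otimes>\<^sub>M gauss2 (\<sigma> j))"
      using assms by (simp cong: measurable_cong_sets sets_pair_measure_cong)
    then have "(\<lambda>p. \<integral>\<^sup>+d. F p d \<partial>gauss2 (\<sigma> j)) \<in> borel_measurable ?N"
      by (rule G.borel_measurable_nn_integral)
    then show "(\<lambda>p. \<integral>\<^sup>+d. F p d \<partial>gauss2 (\<sigma> j)) \<in> borel_measurable (distr M ?N (past j))"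
      by simp
  qed simp
  finally show ?thesis .
qed

text \<open>Taken as a function of an arbitrary table \<open>p\<close> of increments, so that it
  applies to \<open>past j\<close> as well and its measurability can be stated on the product
  space.\<close>

definition pos :: "(bool \<times> nat \<Rightarrow> real) \<Rightarrow> nat \<Rightarrow> real \<times> real" where
  "pos p j = (fst x + (\<Sum>i<j. a i * p (True, i)), snd x + (\<Sum>i<j. a i * p (False, i)))"

definition X :: "nat \<Rightarrow> 'a \<Rightarrow> real \<times> real" where
  "X j \<omega> = pos (\<lambda>k. inc k \<omega>) j"

lemma X_0 [simp]: "X 0 \<omega> = x"
  by (simp add: X_def pos_def)

lemma X_Suc: "X (Suc j) \<omega> = X j \<omega> + D j \<omega>"
  by (simp add: X_def pos_def D_def)

lemma X_measurable [measurable]: "X j \<in> borel_measurable M"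
  unfolding X_def[abs_def] pos_def borel_prod[symmetric] by measurable

lemma X_past: "i \<le> j \<Longrightarrow> X i \<omega> = pos (past j \<omega>) i"
  unfolding X_def pos_def past_def by (auto intro!: sum.cong)

lemma pos_measurable [measurable]:
  assumes "i \<le> j" shows "(\<lambda>p. pos p i) \<in> borel_measurable (PiM (UNIV \<times> {..<j}) (\<lambda>_. borel))"
  unfolding pos_def borel_prod[symmetric] using assms
  by (intro measurable_Pair borel_measurable_add borel_measurable_sum borel_measurable_times
      measurable_component_singleton) auto

section \<open>Optional stopping on the grid\<close>

definition hit :: "(nat \<Rightarrow> (real \<times> real) set) \<Rightarrow> nat \<Rightarrow> 'a \<Rightarrow> bool" where
  "hit A j \<omega> \<longleftrightarrow> (\<exists>i\<le>j. X i \<omega> \<in> A i)"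

text \<open>The value of \<open>f\<close> at index min (T, j), where T is the first index at which
  \<open>X\<close> lies in \<open>A\<close>. The recursion avoids T itself and lets one step at a
  time be integrated.\<close>

primrec stopped :: "(nat \<Rightarrow> (real \<times> real) set) \<Rightarrow> (nat \<Rightarrow> real \<times> real \<Rightarrow> ennreal) \<Rightarrow> nat \<Rightarrow> 'a \<Rightarrow> ennreal"
    where
  "stopped A f 0 \<omega> = f 0 (X 0 \<omega>)"
| "stopped A f (Suc j) \<omega> = (if hit A j \<omega> then stopped A f j \<omega> else f (Suc j) (X (Suc j) \<omega>))"

lemma stopped_not_hit: "(\<And>i. i < j \<Longrightarrow> X i \<omega> \<notin> A i) \<Longrightarrow> stopped A f j \<omega> = f j (X j \<omega>)"
  by (cases j) (auto simp: hit_def)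

lemma stopped_first_hit:
  assumes "X i \<omega> \<in> A i" "\<And>l. l < i \<Longrightarrow> X l \<omega> \<notin> A l" "i \<le> j"
  shows "stopped A f j \<omega> = f i (X i \<omega>)"
  using assms(3)
proof (induction j rule: dec_induct)
  case base then show ?case using assms(2) by (rule stopped_not_hit)
next
  case (step n) then show ?case using assms(1) by (auto simp: hit_def)
qed

context
  fixes A :: "nat \<Rightarrow> (real \<times> real) set" and f :: "nat \<Rightarrow> real \<times> real \<Rightarrow> ennreal"
  assumes A_meas [measurable]: "\<And>i. A i \<in> sets borel" and f_meas [measurable]: "\<And>i. f i \<in>
      borel_measurable borel"
begin

lemma hit_measurable [measurable]: "Measurable.pred M (hit A j)"
  unfolding hit_def[abs_def] by measurable

lemma stopped_measurable [measurable]: "stopped A f j \<in> borel_measurable M"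
  by (induction j) (simp_all del: X_0)

lemma stopped_step:
  "(\<integral>\<^sup>+\<omega>. stopped A f (Suc j) \<omega> \<partial>M) =
    (\<integral>\<^sup>+\<omega>. (if hit A j \<omega> then stopped A f j \<omega> else (\<integral>\<^sup>+d. f (Suc j) (X j \<omega> + d) \<partial>gauss2 (\<sigma> j))) \<partial>M)"
proof -
  let ?N = "PiM (UNIV \<times> {..<j}) (\<lambda>_. borel) :: (bool \<times> nat \<Rightarrow> real) measure"
  interpret G: prob_space "gauss2 (\<sigma> j)" by (rule prob_space_gauss2[OF \<sigma>_pos])
  \<comment> \<open>Zero after a hit, so that the stopped value splits into a part known from the
    past and a part moved by the next step.\<close>
  define F where "F p d = (if \<exists>i\<le>j. pos p i \<in> A i then 0 else f (Suc j) (pos p j + d))" for p d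
  have [measurable]: "(\<lambda>p. pos p i) \<in> borel_measurable ?N" if "i \<in> {..j}" for i
    using that by (intro pos_measurable) simp
  have F: "case_prod F \<in> borel_measurable (?N \<Otimes>\<^sub>M borel)"
  proof -
    have [measurable]: "Measurable.pred ?N (\<lambda>p. \<exists>i\<in>{..j}. pos p i \<in> A i)" by measurable
    have [measurable]: "(\<lambda>p. pos p j) \<in> borel_measurable ?N" by (intro pos_measurable) simp
    have "(\<lambda>z. if \<exists>i\<in>{..j}. pos (fst z) i \<in> A i then 0 else f (Suc j) (pos (fst z) j + snd z)) \<in>
        borel_measurable (?N \<Otimes>\<^sub>M borel)"
      by measurable
    then show ?thesis by (simp add: F_def case_prod_beta' Bex_def atMost_iff)
  qed
  have gm: "(\<lambda>\<omega>. \<integral>\<^sup>+d. f (Suc j) (X j \<omega> + d) \<partial>gauss2 (\<sigma> j)) \<in> borel_measurable M"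
  proof -
    have "(\<lambda>(\<omega>, d). f (Suc j) (X j \<omega> + d)) \<in> borel_measurable (M \<Otimes>\<^sub>M borel)" by measurable
    then have "(\<lambda>(\<omega>, d). f (Suc j) (X j \<omega> + d)) \<in> borel_measurable (M \<Otimes>\<^sub>M gauss2 (\<sigma> j))"
      by (simp cong: measurable_cong_sets sets_pair_measure_cong)
    then show ?thesis by (rule G.borel_measurable_nn_integral)
  qed
  have Fp: "F (past j \<omega>) d = (if hit A j \<omega> then 0 else f (Suc j) (X j \<omega> + d))" for \<omega> d
    unfolding F_def hit_def by (simp add: X_past[of _ j] cong: conj_cong)
  have "(\<integral>\<^sup>+\<omega>. stopped A f (Suc j) \<omega> \<partial>M) = (\<integral>\<^sup>+\<omega>. (if hit A j \<omega> then stopped A f j \<omega> else 0) + F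
      (past j \<omega>) (D j \<omega>) \<partial>M)"
    by (intro nn_integral_cong) (simp add: Fp X_Suc)
  also have "\<dots> = (\<integral>\<^sup>+\<omega>. (if hit A j \<omega> then stopped A f j \<omega> else 0) \<partial>M) + (\<integral>\<^sup>+\<omega>. F (past j \<omega>) (D j
      \<omega>) \<partial>M)"
    by (rule nn_integral_add) (measurable, unfold Fp, measurable)
  also have "(\<integral>\<^sup>+\<omega>. F (past j \<omega>) (D j \<omega>) \<partial>M) = (\<integral>\<^sup>+\<omega>. (if hit A j \<omega> then 0 else (\<integral>\<^sup>+d. f (Suc j) (X
      j \<omega> + d) \<partial>gauss2 (\<sigma> j))) \<partial>M)"
  proof -
    have "(\<integral>\<^sup>+\<omega>. F (past j \<omega>) (D j \<omega>) \<partial>M) = (\<integral>\<^sup>+\<omega>. (\<integral>\<^sup>+d. F (past j \<omega>) d \<partial>gauss2 (\<sigma> j)) \<partial>M)"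
      by (rule nn_integral_past_D[OF F])
    then show ?thesis unfolding Fp by (auto intro!: nn_integral_cong)
  qed
  also have "(\<integral>\<^sup>+\<omega>. (if hit A j \<omega> then stopped A f j \<omega> else 0) \<partial>M) + \<dots> =
     (\<integral>\<^sup>+\<omega>. (if hit A j \<omega> then stopped A f j \<omega> else 0) + (if hit A j \<omega> then 0 else (\<integral>\<^sup>+d. f (Suc j)
         (X j \<omega> + d) \<partial>gauss2 (\<sigma> j))) \<partial>M)"
    using gm by (intro nn_integral_add[symmetric]) auto
  also have "\<dots> = (\<integral>\<^sup>+\<omega>. (if hit A j \<omega> then stopped A f j \<omega> else (\<integral>\<^sup>+d. f (Suc j) (X j \<omega> + d)
      \<partial>gauss2 (\<sigma> j))) \<partial>M)"
    by (intro nn_integral_cong) auto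
  finally show ?thesis .
qed

lemma stopped_if_not_hit: "\<not> hit A j \<omega> \<Longrightarrow> stopped A f j \<omega> = f j (X j \<omega>)"
  by (rule stopped_not_hit) (auto simp: hit_def)

text \<open>Optional stopping for a supermartingale by induction on the horizon. All values lie in
  [0, \<infinity>], so no integrability has to be carried along; \<open>stopped_ge\<close> is the
  mirror image.\<close>

lemma stopped_le:
  assumes "\<And>j y. (\<integral>\<^sup>+d. f (Suc j) (y + d) \<partial>gauss2 (\<sigma> j)) \<le> f j y"
  shows "(\<integral>\<^sup>+\<omega>. stopped A f j \<omega> \<partial>M) \<le> f 0 x"
proof (induction j)
  case (Suc j)
  have "(\<integral>\<^sup>+\<omega>. stopped A f (Suc j) \<omega> \<partial>M) \<le> (\<integral>\<^sup>+\<omega>. stopped A f j \<omega> \<partial>M)"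
    unfolding stopped_step using assms by (intro nn_integral_mono) (auto simp: stopped_if_not_hit)
  then show ?case using Suc by (rule order_trans)
qed (simp add: emeasure_space_1)

lemma stopped_ge:
  assumes "\<And>j y. (\<integral>\<^sup>+d. f (Suc j) (y + d) \<partial>gauss2 (\<sigma> j)) \<ge> f j y"
  shows "f 0 x \<le> (\<integral>\<^sup>+\<omega>. stopped A f j \<omega> \<partial>M)"
proof (induction j)
  case (Suc j)
  have "(\<integral>\<^sup>+\<omega>. stopped A f j \<omega> \<partial>M) \<le> (\<integral>\<^sup>+\<omega>. stopped A f (Suc j) \<omega> \<partial>M)"
    unfolding stopped_step using assms by (intro nn_integral_mono) (auto simp: stopped_if_not_hit)
  with Suc show ?case by (rule order_trans)
qed (simp add: emeasure_space_1)

end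

end

context sampled_bm
begin

lemma hit_first:
  assumes "hit A N \<omega>"
  obtains i where "i \<le> N" "X i \<omega> \<in> A i" "\<And>l. l < i \<Longrightarrow> X l \<omega> \<notin> A l"
proof -
  from assms have ex: "\<exists>i. i \<le> N \<and> X i \<omega> \<in> A i" by (auto simp: hit_def)
  define i where "i = (LEAST i. i \<le> N \<and> X i \<omega> \<in> A i)"
  have i: "i \<le> N \<and> X i \<omega> \<in> A i" unfolding i_def using ex by (rule LeastI_ex)
  have "X l \<omega> \<notin> A l" if "l < i" for l
    using not_less_Least[of l "\<lambda>i. i \<le> N \<and> X i \<omega> \<in> A i"] that i unfolding i_def[symmetric] by auto
  with i show thesis by (intro that[of i]) auto
qed

text \<open>A maximal inequality of Doob's type: the stopped value is at least \<open>c\<close> on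
  the event of a hit, and its integral is at most the starting value.\<close>

lemma hit_bound:
  assumes [measurable]: "\<And>i. A i \<in> sets borel" "\<And>i. f i \<in> borel_measurable borel"
    and super: "\<And>j y. (\<integral>\<^sup>+d. f (Suc j) (y + d) \<partial>gauss2 (\<sigma> j)) \<le> f j y"
    and c: "\<And>j y. y \<in> A j \<Longrightarrow> c \<le> f j y"
  shows "c * emeasure M {\<omega>\<in>space M. hit A N \<omega>} \<le> f 0 x"
proof -
  have [measurable]: "{\<omega>\<in>space M. hit A N \<omega>} \<in> sets M" by measurable
  have "c * emeasure M {\<omega>\<in>space M. hit A N \<omega>} = (\<integral>\<^sup>+\<omega>. c * indicator {\<omega>\<in>space M. hit A N \<omega>} \<omega> \<partial>M)"
    by (subst nn_integral_cmult_indicator) auto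
  also have "\<dots> \<le> (\<integral>\<^sup>+\<omega>. stopped A f N \<omega> \<partial>M)"
  proof (rule nn_integral_mono)
    fix \<omega>
    show "c * indicator {\<omega>\<in>space M. hit A N \<omega>} \<omega> \<le> stopped A f N \<omega>"
    proof (cases "hit A N \<omega>")
      case True
      then obtain i where "i \<le> N" "X i \<omega> \<in> A i" "\<And>l. l < i \<Longrightarrow> X l \<omega> \<notin> A l" by (rule hit_first) blast
      then show ?thesis using c by (subst stopped_first_hit[of i]) (auto simp: indicator_def)
    qed (simp add: indicator_def)
  qed
  also have "\<dots> \<le> f 0 x" by (rule stopped_le) (use super in auto)
  finally show ?thesis .
qed

end

text \<open>Fatou's lemma for events. The grids are not nested, so an event in continuous time is
  captured only by the grid events for all large n; the uniform bound survives this passage.\<close>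

lemma (in planar_bm) emeasure_eventually_le:
  fixes H :: "nat \<Rightarrow> 'a set"
  assumes [measurable]: "\<And>n. H n \<in> sets M" and B: "\<And>n. emeasure M (H n) \<le> B"
  shows "{\<omega>\<in>space M. \<forall>\<^sub>F n in sequentially. \<omega> \<in> H n} \<in> sets M"
    and "emeasure M {\<omega>\<in>space M. \<forall>\<^sub>F n in sequentially. \<omega> \<in> H n} \<le> B"
proof -
  have eq: "{\<omega>\<in>space M. \<forall>\<^sub>F n in sequentially. \<omega> \<in> H n} = (\<Union>k. \<Inter>n\<in>{k..}. H n)"
    using sets.sets_into_space[OF assms(1)] by (auto simp: eventually_sequentially)
  then show "{\<omega>\<in>space M. \<forall>\<^sub>F n in sequentially. \<omega> \<in> H n} \<in> sets M" by simp
  have "emeasure M (\<Union>k. \<Inter>n\<in>{k..}. H n) = (SUP k. emeasure M (\<Inter>n\<in>{k..}. H n))"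
    by (intro SUP_emeasure_incseq[symmetric]) (auto simp: incseq_def)
  also have "\<dots> \<le> B"
  proof (rule SUP_least)
    fix k show "emeasure M (\<Inter>n\<in>{k..}. H n) \<le> B"
      by (rule order_trans[OF emeasure_mono B[of k]]) auto
  qed
  finally show "emeasure M {\<omega>\<in>space M. \<forall>\<^sub>F n in sequentially. \<omega> \<in> H n} \<le> B" unfolding eq .
qed

text \<open>Used with (n + 1)^2 steps on regular grids, so that the horizon n + 1 grows while the
  step shrinks.\<close>

definition mesh :: "nat \<Rightarrow> real" where "mesh n = 1 / real (Suc n)"

lemma mesh_pos [simp]: "0 < mesh n"
  by (simp add: mesh_def)

lemma mesh_nonneg [simp]: "0 \<le> mesh n"
  by (simp add: mesh_def)

lemma mesh_tendsto: "mesh \<longlonglongrightarrow> 0"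
  unfolding mesh_def[abs_def] by (rule LIMSEQ_Suc[OF lim_const_over_n])

text \<open>Continuity carries membership in an open set from r to the next grid time. This is the
  link from continuous time to the grid; the index bound holds once n + 1 is at least r - b +
  1.\<close>

lemma eventually_grid_in_open:
  fixes p :: "real \<Rightarrow> 'b::topological_space"
  assumes p: "continuous_on {b..} p" and U: "open U" "p r \<in> U" and r: "b \<le> r"
  shows "\<forall>\<^sub>F n in sequentially. \<exists>j\<le>(Suc n)\<^sup>2. r \<le> b + real j * mesh n \<and> b + real j * mesh n \<le> r +
      mesh n \<and> p (b + real j * mesh n) \<in> U"
proof -
  \<comment> \<open>Index of the first grid time at or after r.\<close>
  define j where "j n = nat \<lceil>(r - b) * real (Suc n)\<rceil>" for n
  have jb: "(r - b) * real (Suc n) \<le> real (j n)" "real (j n) \<le> (r - b) * real (Suc n) + 1" for n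
    using r unfolding j_def by (auto simp: of_nat_nat ceiling_le_iff zero_le_ceiling intro:
        le_of_int_ceiling order_trans)
  have lo: "r \<le> b + real (j n) * mesh n" for n
    using jb(1)[of n] by (simp add: mesh_def field_simps)
  have hi: "b + real (j n) * mesh n \<le> r + mesh n" for n
    using divide_right_mono[OF jb(2)[of n], of "real (Suc n)"] by (simp add: mesh_def
        add_divide_distrib)
  have lim: "(\<lambda>n. b + real (j n) * mesh n) \<longlonglongrightarrow> r"
    by (rule tendsto_sandwich[of "\<lambda>_. r" _ _ "\<lambda>n. r + mesh n"])
      (use lo hi tendsto_add[OF tendsto_const mesh_tendsto, of r] in auto)
  have "(\<lambda>n. p (b + real (j n) * mesh n)) \<longlonglongrightarrow> p r"
    using r by (intro continuous_on_tendsto_compose[OF p lim]) auto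
  then have e1: "\<forall>\<^sub>F n in sequentially. p (b + real (j n) * mesh n) \<in> U"
    using U by (rule topological_tendstoD)
  have "\<forall>\<^sub>F n in sequentially. r - b + 1 \<le> real (Suc n)" by real_asymp
  with e1 show ?thesis
  proof eventually_elim
    case (elim n)
    have "real (j n) \<le> (r - b + 1) * real (Suc n)" using jb(2)[of n] by (simp add: algebra_simps)
    also have "\<dots> \<le> real (Suc n) * real (Suc n)" using elim by (intro mult_right_mono) auto
    finally have "real (j n) \<le> real ((Suc n)\<^sup>2)" by (simp only: power2_eq_square of_nat_mult)
    then have "j n \<le> (Suc n)\<^sup>2" by (simp only: of_nat_le_iff)
    then show ?case using elim lo hi by blast
  qed
qed

context planar_bm
begin

lemma continuous_on_state:
  "\<omega> \<in> space M \<Longrightarrow> continuous_on {0..} (\<lambda>s. state W1 W2 \<theta> t x s \<omega>)"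
  unfolding state_def by (intro continuous_intros W_continuous)

lemma sampled_grid:
  assumes "0 \<le> b" "0 < \<theta>"
  shows "sampled_bm M W1 W2 (\<lambda>j. b + real j * mesh n) (\<lambda>_. \<theta>)"
  by unfold_locales (use assms in \<open>auto simp: algebra_simps\<close>)

lemma X_grid:
  assumes "0 \<le> b" "0 < \<theta>"
  shows "sampled_bm.X W1 W2 (\<lambda>j. b + real j * mesh n) (\<lambda>_. \<theta>) x j \<omega> = state W1 W2 \<theta> b x (b + real j
      * mesh n) \<omega>"
proof -
  interpret sampled_bm M W1 W2 "\<lambda>j. b + real j * mesh n" "\<lambda>_. \<theta>" x by (rule sampled_grid[OF assms])
  show ?thesis
    by (induction j) (simp_all add: X_Suc D_def inc_def state_def algebra_simps)
qed

lemma \<sigma>_grid: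
  assumes "0 \<le> b" "0 < \<theta>"
  shows "sampled_bm.\<sigma> (\<lambda>j. b + real j * mesh n) (\<lambda>_. \<theta>) j = \<theta> * sqrt (mesh n)"
proof -
  interpret sampled_bm M W1 W2 "\<lambda>j. b + real j * mesh n" "\<lambda>_. \<theta>" "(0, 0)" by (rule sampled_grid[OF
      assms])
  show ?thesis by (simp add: \<sigma>_def algebra_simps)
qed

end

subsection \<open>Hitting probabilities\<close>

lemma heat_kernel_measurable [measurable]: "(\<lambda>(v, y). heat_kernel v y) \<in> borel_measurable (borel
    \<Otimes>\<^sub>M borel)"
  unfolding heat_kernel_def borel_prod[symmetric] by measurable

lemma I0_0: "I0 0 = 1"
  using I0_le_exp[of 0] I0_ge_1[of 0] by simp

text \<open>From x \<le> exp x one gets exp (- q / v) / v \<le> 1 / q for every v > 0. Uniformity in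
  v keeps the potential at the starting point bounded as \<eta> shrinks.\<close>

lemma heat_kernel_le:
  assumes "0 < v" "y \<noteq> 0"
  shows "heat_kernel v y \<le> 1 / (pi * (norm y)\<^sup>2)"
proof -
  define q where "q = (norm y)\<^sup>2 / 2"
  have q: "0 < q" using assms by (simp add: q_def)
  have "q / v \<le> exp (q / v)" using exp_ge_add_one_self[of "q / v"] by linarith
  then have "exp (- (q / v)) / v \<le> 1 / q"
    using assms q by (simp add: exp_minus field_simps)
  then have "exp (- (q / v)) / v / (2 * pi) \<le> 1 / q / (2 * pi)" by (intro divide_right_mono) auto
  moreover have "heat_kernel v y = exp (- (q / v)) / v / (2 * pi)"
    by (simp add: heat_kernel_def q_def norm_prod_sq add_divide_distrib diff_divide_distrib mult_ac)
  moreover have "1 / q / (2 * pi) = 1 / (pi * (norm y)\<^sup>2)" by (simp add: q_def)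
  ultimately show ?thesis by (simp only:)
qed

text \<open>A superharmonic function of space-time, close to the logarithmic potential, that tends to infinity
  at the origin as \<open>\<eta>\<close> tends to \<open>0\<close>.\<close>

definition potential :: "real \<Rightarrow> real \<Rightarrow> real \<times> real \<Rightarrow> ennreal" where
  "potential \<eta> L y = (\<integral>\<^sup>+v. ennreal (heat_kernel v y) * indicator {\<eta>..L} v \<partial>lborel)"

lemma potential_measurable [measurable]: "potential \<eta> L \<in> borel_measurable borel"
  unfolding potential_def[abs_def] by measurable

text \<open>A step of variance s^2 turns the kernel at v into the kernel at v + s^2, so the window
  [\<eta>, L - s^2] moves to [\<eta> + s^2, L]. The right end shrinks with elapsed time to make this
  a part of [\<eta>, L].\<close>

lemma gauss2_potential_le:
  assumes "0 < \<eta>" "0 < s"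
  shows "(\<integral>\<^sup>+d. potential \<eta> (L - s\<^sup>2) (y + d) \<partial>gauss2 s) \<le> potential \<eta> L y"
proof -
  have "(\<integral>\<^sup>+d. potential \<eta> (L - s\<^sup>2) (y + d) \<partial>gauss2 s)
     = (\<integral>\<^sup>+v. (\<integral>\<^sup>+d. ennreal (heat_kernel v (y + d)) * indicator {\<eta>..L - s\<^sup>2} v \<partial>gauss2 s) \<partial>lborel)"
    unfolding potential_def by (rule gauss2_Fubini[OF assms(2)]) measurable
  also have "\<dots> = (\<integral>\<^sup>+v. ennreal (heat_kernel (s\<^sup>2 + v) y) * indicator {\<eta> + s\<^sup>2..L} (s\<^sup>2 + v) \<partial>lborel)"
  proof (rule nn_integral_cong)
    fix v
    have "(\<integral>\<^sup>+d. ennreal (heat_kernel v (y + d)) * indicator {\<eta>..L - s\<^sup>2} v \<partial>gauss2 s)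
       = (\<integral>\<^sup>+d. ennreal (heat_kernel v (y + d)) \<partial>gauss2 s) * indicator {\<eta>..L - s\<^sup>2} v"
      by (rule nn_integral_multc) measurable
    then show "(\<integral>\<^sup>+d. ennreal (heat_kernel v (y + d)) * indicator {\<eta>..L - s\<^sup>2} v \<partial>gauss2 s)
       = ennreal (heat_kernel (s\<^sup>2 + v) y) * indicator {\<eta> + s\<^sup>2..L} (s\<^sup>2 + v)"
      using assms by (auto simp: indicator_def gauss2_heat_kernel add.commute[of "s\<^sup>2"])
  qed
  also have "\<dots> = (\<integral>\<^sup>+v. ennreal (heat_kernel v y) * indicator {\<eta> + s\<^sup>2..L} v \<partial>lborel)"
    using nn_integral_real_affine[of "\<lambda>v. ennreal (heat_kernel v y) * indicator {\<eta> + s\<^sup>2..L} v" 1 "s\<^sup>2"]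
    by simp
  also have "\<dots> \<le> potential \<eta> L y"
    unfolding potential_def
    by (intro nn_integral_mono mult_left_mono) (auto simp: indicator_def intro: order_trans[rotated])
  finally show ?thesis .
qed

lemma potential_le:
  assumes "0 < \<eta>" "\<eta> \<le> L" "y \<noteq> 0"
  shows "potential \<eta> L y \<le> ennreal (L / (pi * (norm y)\<^sup>2))"
proof -
  have "potential \<eta> L y \<le> (\<integral>\<^sup>+v. ennreal (1 / (pi * (norm y)\<^sup>2)) * indicator {\<eta>..L} v \<partial>lborel)"
    unfolding potential_def using assms heat_kernel_le
    by (intro nn_integral_mono) (auto simp: indicator_def intro!: ennreal_leI)
  also have "\<dots> = ennreal (1 / (pi * (norm y)\<^sup>2)) * ennreal (L - \<eta>)"
    using assms by (subst nn_integral_cmult_indicator) auto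
  also have "\<dots> = ennreal ((L - \<eta>) / (pi * (norm y)\<^sup>2))" using assms by (simp add:
      ennreal_mult'[symmetric])
  also have "\<dots> \<le> ennreal (L / (pi * (norm y)\<^sup>2))" using assms by (intro ennreal_leI
      divide_right_mono) auto
  finally show ?thesis .
qed

text \<open>For |y|^2 \<le> \<eta> \<le> v the Gaussian exponent is at least - 1 / 2, and 1 / v
  integrates over [\<eta>, 1] to ln (1 / \<eta>). This diverges as \<eta> tends to 0, unlike the
  bound at the starting point.\<close>

lemma potential_ge:
  assumes "0 < \<eta>" "\<eta> \<le> 1" "1 \<le> L" "(norm y)\<^sup>2 \<le> \<eta>"
  shows "ennreal (exp (- 1 / 2) / (2 * pi) * ln (1 / \<eta>)) \<le> potential \<eta> L y"
proof -
  let ?c = "exp (- 1 / 2) / (2 * pi)"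
  have "(\<integral>\<^sup>+v. ennreal (?c * (1 / v)) * indicator {\<eta>..1} v \<partial>lborel) = ennreal (?c * ln 1 - ?c * ln \<eta>)"
    using assms by (intro nn_integral_FTC_Icc) (auto intro!: derivative_eq_intros)
  also have "?c * ln 1 - ?c * ln \<eta> = ?c * ln (1 / \<eta>)" using assms by (simp add: ln_div)
  finally have "ennreal (?c * ln (1 / \<eta>)) = (\<integral>\<^sup>+v. ennreal (?c * (1 / v)) * indicator {\<eta>..1} v
      \<partial>lborel)" ..
  also have "\<dots> \<le> potential \<eta> L y"
    unfolding potential_def
  proof (rule nn_integral_mono)
    fix v
    show "ennreal (?c * (1 / v)) * indicator {\<eta>..1} v \<le> ennreal (heat_kernel v y) * indicator {\<eta>..L} v"
    proof (cases "v \<in> {\<eta>..1}")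
      case True
      then have v: "0 < v" "(norm y)\<^sup>2 \<le> v" using assms by auto
      then have "exp (- 1 / 2) \<le> exp (- ((norm y)\<^sup>2 / (2 * v)))" by (simp add: divide_le_eq)
      then have "exp (- 1 / 2) / (2 * pi * v) \<le> exp (- ((norm y)\<^sup>2 / (2 * v))) / (2 * pi * v)"
        using v by (intro divide_right_mono) auto
      moreover have "heat_kernel v y = exp (- ((norm y)\<^sup>2 / (2 * v))) / (2 * pi * v)"
        by (simp add: heat_kernel_def norm_prod_sq add_divide_distrib diff_divide_distrib)
      ultimately have "?c * (1 / v) \<le> heat_kernel v y"
        by (simp only: times_divide_times_eq mult_1_right)
      then show ?thesis using True assms by (auto simp: indicator_def intro!: ennreal_leI)
    qed simp
  qed
  finally show ?thesis .
qed

context planar_bm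
begin

text \<open>\<open>L\<close> is chosen so that the window still reaches 1 at the latest grid time T
  + 1 considered. The maximal inequality then bounds the probability by a constant over ln (1 /
  \<eta>).\<close>

lemma hit_origin_grid:
  assumes "0 \<le> b" "0 < \<theta>" "x \<noteq> 0" "0 < \<eta>" "\<eta> \<le> 1" "0 \<le> T"
  defines "H \<equiv> \<lambda>n. {\<omega>\<in>space M. \<exists>j\<le>(Suc n)\<^sup>2. real j * mesh n \<le> T + 1 \<and> (norm (state W1 W2 \<theta> b x (b
      + real j * mesh n) \<omega>))\<^sup>2 \<le> \<eta>}"
  defines "L \<equiv> 1 + \<theta>\<^sup>2 * (T + 1)"
  shows "H n \<in> sets M" and "ennreal (exp (- 1 / 2) / (2 * pi) * ln (1 / \<eta>)) * emeasure M (H n) \<le>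
      ennreal (L / (pi * (norm x)\<^sup>2))"
proof -
  interpret sampled_bm M W1 W2 "\<lambda>j. b + real j * mesh n" "\<lambda>_. \<theta>" x by (rule sampled_grid[OF assms(1,2)])
  define A where "A j = (if real j * mesh n \<le> T + 1 then {y :: real \<times> real. (norm y)\<^sup>2 \<le> \<eta>} else
      {})" for j
  define f where "f j = potential \<eta> (L - \<theta>\<^sup>2 * (real j * mesh n))" for j
  have [measurable]: "A j \<in> sets borel" "f j \<in> borel_measurable borel" for j
    by (auto simp: A_def f_def)
  have H: "H n = {\<omega>\<in>space M. hit A ((Suc n)\<^sup>2) \<omega>}"
    unfolding H_def hit_def X_grid[OF assms(1,2)] A_def by (auto split: if_splits)
  show "H n \<in> sets M" unfolding H by measurable
  have "ennreal (exp (- 1 / 2) / (2 * pi) * ln (1 / \<eta>)) * emeasure M (H n) \<le> f 0 x"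
    unfolding H
  proof (rule hit_bound)
    fix j y
    have "f (Suc j) = potential \<eta> ((L - \<theta>\<^sup>2 * (real j * mesh n)) - (\<sigma> j)\<^sup>2)"
      using assms(1,2) by (simp add: f_def \<sigma>_grid[OF assms(1,2)] power_mult_distrib algebra_simps)
    then show "(\<integral>\<^sup>+d. f (Suc j) (y + d) \<partial>gauss2 (\<sigma> j)) \<le> f j y"
      using gauss2_potential_le[OF assms(4) \<sigma>_pos] by (simp add: f_def)
    assume "y \<in> A j"
    then have y: "real j * mesh n \<le> T + 1" "(norm y)\<^sup>2 \<le> \<eta>" by (auto simp: A_def split: if_splits)
    have "\<theta>\<^sup>2 * (real j * mesh n) \<le> \<theta>\<^sup>2 * (T + 1)" using y by (intro mult_left_mono) auto
    then show "ennreal (exp (- 1 / 2) / (2 * pi) * ln (1 / \<eta>)) \<le> f j y"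
      unfolding f_def using assms y by (intro potential_ge) (auto simp: L_def)
  qed measurable
  also have "f 0 x \<le> ennreal (L / (pi * (norm x)\<^sup>2))"
    using assms unfolding f_def by (simp add: L_def add_increasing2) (intro potential_le, auto
        simp: add_increasing2)
  finally show "ennreal (exp (- 1 / 2) / (2 * pi) * ln (1 / \<eta>)) * emeasure M (H n) \<le> ennreal (L /
      (pi * (norm x)\<^sup>2))" .
qed

lemma hit_origin_null:
  assumes "0 \<le> b" "0 < \<theta>" "x \<noteq> 0" "0 \<le> T"
  shows "AE \<omega> in M. \<forall>r\<in>{b..b + T}. state W1 W2 \<theta> b x r \<omega> \<noteq> 0"
proof -
  \<comment> \<open>Makes ln (1 / \<eta>) equal to m + 1, so the probabilities of coming that close
    to the origin are of order 1 / (m + 1).\<close>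
  define \<eta> where "\<eta> m = exp (- real (Suc m))" for m
  define H where "H m n = {\<omega>\<in>space M. \<exists>j\<le>(Suc n)\<^sup>2. real j * mesh n \<le> T + 1 \<and> (norm (state W1 W2 \<theta>
      b x (b + real j * mesh n) \<omega>))\<^sup>2 \<le> \<eta> m}" for m n
  define Z where "Z m = {\<omega>\<in>space M. \<forall>\<^sub>F n in sequentially. \<omega> \<in> H m n}" for m
  define B where "B = (1 + \<theta>\<^sup>2 * (T + 1)) / (pi * (norm x)\<^sup>2) / (exp (- 1 / 2) / (2 * pi))"
  have B: "0 \<le> B" using assms by (simp add: B_def)
  have \<eta>: "0 < \<eta> m" "\<eta> m \<le> 1" "ln (1 / \<eta> m) = real (Suc m)" for m by (auto simp: \<eta>_def ln_div)
  have Hm: "H m n \<in> sets M" for m n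
    unfolding H_def by (rule hit_origin_grid[OF assms(1-3) \<eta>(1,2) assms(4)])
  have Hb: "emeasure M (H m n) \<le> ennreal (B / real (Suc m))" for m n
  proof -
    have "ennreal (exp (- 1 / 2) / (2 * pi) * real (Suc m)) * emeasure M (H m n) \<le> ennreal ((1 +
        \<theta>\<^sup>2 * (T + 1)) / (pi * (norm x)\<^sup>2))"
      unfolding H_def \<eta>(3)[symmetric] by (rule hit_origin_grid[OF assms(1-3) \<eta>(1,2) assms(4)])
    then have "exp (- 1 / 2) / (2 * pi) * real (Suc m) * measure M (H m n) \<le> (1 + \<theta>\<^sup>2 * (T + 1)) /
        (pi * (norm x)\<^sup>2)"
      using assms(2,4) by (simp add: emeasure_eq_measure ennreal_mult'[symmetric] del: of_nat_Suc)
    then have "measure M (H m n) \<le> B / real (Suc m)"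
      unfolding B_def by (subst pos_le_divide_eq, simp, subst pos_le_divide_eq, simp) (simp only:
          mult_ac)
    then show ?thesis by (simp add: emeasure_eq_measure ennreal_leI)
  qed
  have Z: "Z m \<in> sets M" "emeasure M (Z m) \<le> ennreal (B / real (Suc m))" for m
    unfolding Z_def using emeasure_eventually_le[OF Hm Hb] by auto
  have "emeasure M (\<Inter>m. Z m) = 0"
  proof -
    have "(\<lambda>m. ennreal (B / real (Suc m))) \<longlonglongrightarrow> ennreal 0"
      by (intro tendsto_ennrealI LIMSEQ_Suc[OF lim_const_over_n])
    moreover have "emeasure M (\<Inter>m. Z m) \<le> ennreal (B / real (Suc m))" for m
      by (rule order_trans[OF emeasure_mono Z(2)[of m]]) (use Z(1) in auto)
    ultimately have "emeasure M (\<Inter>m. Z m) \<le> ennreal 0"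
      by (intro LIMSEQ_le_const) auto
    then show ?thesis by simp
  qed
  then have "(\<Inter>m. Z m) \<in> null_sets M" using Z(1) by (auto simp: null_sets_def)
  moreover have "{\<omega>\<in>space M. \<not> (\<forall>r\<in>{b..b + T}. state W1 W2 \<theta> b x r \<omega> \<noteq> 0)} \<subseteq> (\<Inter>m. Z m)"
  proof (intro subsetI INT_I)
    fix \<omega> m assume "\<omega> \<in> {\<omega>\<in>space M. \<not> (\<forall>r\<in>{b..b + T}. state W1 W2 \<theta> b x r \<omega> \<noteq> 0)}"
    then obtain r where \<omega>: "\<omega> \<in> space M" "r \<in> {b..b + T}" "state W1 W2 \<theta> b x r \<omega> = 0" by auto
    have "\<forall>\<^sub>F n in sequentially. \<exists>j\<le>(Suc n)\<^sup>2. r \<le> b + real j * mesh n \<and> b + real j * mesh n \<le> r +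
        mesh n \<and>
       state W1 W2 \<theta> b x (b + real j * mesh n) \<omega> \<in> ball 0 (sqrt (\<eta> m))"
      using \<omega> \<eta>(1)[of m] assms
      by (intro eventually_grid_in_open[where U = "ball 0 (sqrt (\<eta> m))"] continuous_on_subset[OF
          continuous_on_state]) auto
    then have "\<forall>\<^sub>F n in sequentially. \<omega> \<in> H m n"
    proof eventually_elim
      case (elim n)
      then obtain j where j: "j \<le> (Suc n)\<^sup>2" "b + real j * mesh n \<le> r + mesh n"
        "norm (state W1 W2 \<theta> b x (b + real j * mesh n) \<omega>) < sqrt (\<eta> m)" by auto
      \<comment> \<open>The grid time may exceed r by one mesh, hence the margin 1 in the
        horizon.\<close>
      have "mesh n \<le> 1" by (simp add: mesh_def)
      then have "real j * mesh n \<le> T + 1" using j(2) \<omega>(2) by auto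
      moreover have "(norm (state W1 W2 \<theta> b x (b + real j * mesh n) \<omega>))\<^sup>2 \<le> \<eta> m"
        using power_mono[OF less_imp_le[OF j(3)] norm_ge_zero, of 2] \<eta>(1)[of m] by simp
      ultimately show ?case using j(1) \<omega>(1) by (auto simp: H_def)
    qed
    then show "\<omega> \<in> Z m" using \<omega>(1) by (simp add: Z_def)
  qed
  ultimately show ?thesis by (intro AE_I') auto
qed

lemma origin_polar:
  assumes "0 \<le> b" "0 < \<theta>" "x \<noteq> 0"
  shows "AE \<omega> in M. \<forall>r\<ge>b. state W1 W2 \<theta> b x r \<omega> \<noteq> 0"
proof -
  have "AE \<omega> in M. \<forall>T::nat. \<forall>r\<in>{b..b + real T}. state W1 W2 \<theta> b x r \<omega> \<noteq> 0"
    unfolding AE_all_countable using assms by (intro allI hit_origin_null) auto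
  then show ?thesis
  proof eventually_elim
    case (elim \<omega>)
    show ?case
    proof (intro allI impI)
      fix r assume "b \<le> r"
      obtain T :: nat where "r - b \<le> real T" using real_arch_simple by blast
      with \<open>b \<le> r\<close> have "r \<in> {b..b + real T}" by auto
      with elim show "state W1 W2 \<theta> b x r \<omega> \<noteq> 0" by blast
    qed
  qed
qed

text \<open>Exponential martingale \<open>exp (- \<kappa>\<^sup>2 * \<theta>\<^sup>2 * s / 2) * I0 (\<kappa> * norm (X s))\<close> with \<open>\<kappa> = 1 / sqrt \<epsilon>\<close>.\<close>

lemma early_exit_bound:
  assumes "0 \<le> b" "0 < \<theta>" "0 < \<epsilon>" "0 < d"
  obtains S where "S \<in> sets M" "emeasure M S \<le> ennreal (1024 * exp (\<theta>\<^sup>2) / d ^ 4 * \<epsilon>\<^sup>2)"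
    "{\<omega>\<in>space M. \<exists>r\<in>{b..b + \<epsilon>}. d \<le> norm (state W1 W2 \<theta> b 0 r \<omega>)} \<subseteq> S"
proof -
  \<comment> \<open>The radius is halved and the time span doubled to leave room for the grid: the
    grid time lies up to one mesh after r, and the path there is only near its value at r.\<close>
  define H where "H n = {\<omega>\<in>space M. \<exists>j\<le>(Suc n)\<^sup>2. real j * mesh n \<le> 2 * \<epsilon> \<and> d / 2 < norm (state W1
      W2 \<theta> b 0 (b + real j * mesh n) \<omega>)}" for n
  \<comment> \<open>exp (- \<theta>^2) is the discount at time 2 \<epsilon>, and d^4 / (1024
    \<epsilon>^2) is the bound of \<open>I0_ge_pow4\<close> at the argument d / (2 sqrt
    \<epsilon>).\<close>
  let ?c = "exp (- \<theta>\<^sup>2) * (d ^ 4 / (1024 * \<epsilon>\<^sup>2))"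
  have c: "0 < ?c" using assms by simp
  have H: "H n \<in> sets M \<and> emeasure M (H n) \<le> ennreal (1024 * exp (\<theta>\<^sup>2) / d ^ 4 * \<epsilon>\<^sup>2)" for n
  proof -
    interpret sampled_bm M W1 W2 "\<lambda>j. b + real j * mesh n" "\<lambda>_. \<theta>" 0 by (rule sampled_grid[OF
        assms(1,2)])
    define A where "A j = (if real j * mesh n \<le> 2 * \<epsilon> then {y :: real \<times> real. d / 2 < norm y} else
        {})" for j
    define k where "k = 1 / sqrt \<epsilon>"
    have k: "0 < k" "k\<^sup>2 = 1 / \<epsilon>" using assms by (auto simp: k_def power_divide)
    define f where "f j y = ennreal (exp (- (k\<^sup>2 * \<theta>\<^sup>2 / 2 * (real j * mesh n))) * I0 (k * norm
        y))" for j and y :: "real \<times> real"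
    have [measurable]: "A j \<in> sets borel" "f j \<in> borel_measurable borel" for j
      by (auto simp: A_def f_def[abs_def])
    have H: "H n = {\<omega>\<in>space M. hit A ((Suc n)\<^sup>2) \<omega>}"
      unfolding H_def hit_def X_grid[OF assms(1,2)] A_def by (auto split: if_splits)
    have 1: "H n \<in> sets M" unfolding H by measurable
    have "ennreal ?c * emeasure M (H n) \<le> f 0 0"
      unfolding H
    proof (rule hit_bound)
      fix j and y :: "real \<times> real"
      have "(\<integral>\<^sup>+d. f (Suc j) (y + d) \<partial>gauss2 (\<sigma> j)) =
         ennreal (exp (- (k\<^sup>2 * \<theta>\<^sup>2 / 2 * (real (Suc j) * mesh n)))) * (\<integral>\<^sup>+d. ennreal (I0 (k * norm
             (y + d))) \<partial>gauss2 (\<sigma> j))"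
        unfolding f_def by (subst nn_integral_cmult[symmetric]) (auto simp: ennreal_mult')
      also have "\<dots> = ennreal (exp (- (k\<^sup>2 * \<theta>\<^sup>2 / 2 * (real (Suc j) * mesh n))) * exp (k\<^sup>2 * (\<sigma>
          j)\<^sup>2 / 2) * I0 (k * norm y))"
        unfolding gauss2_I0[OF \<sigma>_pos] by (simp add: ennreal_mult'[symmetric] mult.assoc)
      also have "\<dots> = f j y"
        unfolding exp_add[symmetric] f_def by (simp add: \<sigma>_grid[OF assms(1,2)] power_mult_distrib
            algebra_simps)
      finally show "(\<integral>\<^sup>+d. f (Suc j) (y + d) \<partial>gauss2 (\<sigma> j)) \<le> f j y" by simp
      assume "y \<in> A j"
      then have y: "real j * mesh n \<le> 2 * \<epsilon>" "d / 2 < norm y" by (auto simp: A_def split: if_splits)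
      have "k\<^sup>2 * \<theta>\<^sup>2 / 2 * (real j * mesh n) \<le> k\<^sup>2 * \<theta>\<^sup>2 / 2 * (2 * \<epsilon>)" using y by (intro
          mult_left_mono) auto
      also have "\<dots> = \<theta>\<^sup>2" using assms by (simp add: k)
      finally have 1: "exp (- \<theta>\<^sup>2) \<le> exp (- (k\<^sup>2 * \<theta>\<^sup>2 / 2 * (real j * mesh n)))" by simp
      have "k ^ 4 = 1 / \<epsilon>\<^sup>2" using k(2) by (metis power2_eq_square power4_eq_xxxx mult.assoc
          power_one_over one_power2 power_divide)
      then have "d ^ 4 / (1024 * \<epsilon>\<^sup>2) = (k * (d / 2) / 2) ^ 4 / 4" by (simp add: power_mult_distrib
          power_divide)
      also have "\<dots> \<le> I0 (k * (d / 2))" by (rule I0_ge_pow4)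
      also have "\<dots> \<le> I0 (k * norm y)" using y k assms by (intro I0_mono) (auto simp: abs_mult)
      finally show "ennreal ?c \<le> f j y"
        unfolding f_def using 1 by (intro ennreal_leI mult_mono) auto
    qed measurable
    also have "f 0 0 = 1" by (simp add: f_def I0_0)
    finally have "?c * measure M (H n) \<le> 1"
      using c by (simp add: emeasure_eq_measure ennreal_mult'[symmetric] flip: ennreal_1)
    then have "measure M (H n) \<le> 1 / ?c" using c by (simp only: pos_le_divide_eq mult.commute)
    also have "\<dots> = 1024 * exp (\<theta>\<^sup>2) / d ^ 4 * \<epsilon>\<^sup>2" by (simp add: exp_minus divide_simps)
    finally show ?thesis using 1 by (simp add: emeasure_eq_measure ennreal_leI)
  qed
  let ?S = "{\<omega>\<in>space M. \<forall>\<^sub>F n in sequentially. \<omega> \<in> H n}"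
  have "{\<omega>\<in>space M. \<exists>r\<in>{b..b + \<epsilon>}. d \<le> norm (state W1 W2 \<theta> b 0 r \<omega>)} \<subseteq> ?S"
  proof safe
    fix \<omega> r assume \<omega>: "\<omega> \<in> space M" "r \<in> {b..b + \<epsilon>}" "d \<le> norm (state W1 W2 \<theta> b 0 r \<omega>)"
    have "\<forall>\<^sub>F n in sequentially. \<exists>j\<le>(Suc n)\<^sup>2. r \<le> b + real j * mesh n \<and> b + real j * mesh n \<le> r +
        mesh n \<and>
       state W1 W2 \<theta> b 0 (b + real j * mesh n) \<omega> \<in> {y. d / 2 < norm y}"
      using \<omega> assms
      by (intro eventually_grid_in_open[where U = "{y. d / 2 < norm y}"] continuous_on_subset[OF
          continuous_on_state] open_Collect_less continuous_intros) auto
    moreover have "\<forall>\<^sub>F n in sequentially. mesh n < \<epsilon>"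
      using mesh_tendsto assms(3) by (rule order_tendstoD)
    ultimately show "\<forall>\<^sub>F n in sequentially. \<omega> \<in> H n"
    proof eventually_elim
      case (elim n)
      then obtain j where j: "j \<le> (Suc n)\<^sup>2" "b + real j * mesh n \<le> r + mesh n"
        "d / 2 < norm (state W1 W2 \<theta> b 0 (b + real j * mesh n) \<omega>)" by auto
      have "real j * mesh n \<le> 2 * \<epsilon>" using j(2) \<omega>(2) elim by auto
      then show ?case using j \<omega>(1) by (auto simp: H_def)
    qed
  qed
  then show thesis using that[of ?S] emeasure_eventually_le[of H] H by blast
qed

end

subsection \<open>Upper bound for the pay-off\<close>

text \<open>By continuity the times spent outside an open set form a closed set, so a finite infimum
  is attained.\<close>

lemma exit_time_attained:
  fixes X :: "real \<Rightarrow> 'a \<Rightarrow> real \<times> real"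
  assumes cont: "continuous_on {s..} (\<lambda>r. X r \<omega>)" and C: "open C" and fin: "exit_time X C s \<omega> < \<infinity>"
  obtains r where "s \<le> r" "exit_time X C s \<omega> = ereal r" "X r \<omega> \<notin> C" "\<And>r'. s \<le> r' \<Longrightarrow> r' < r \<Longrightarrow> X r' \<omega> \<in> C"
proof -
  define S where "S = {r. s \<le> r \<and> X r \<omega> \<notin> C}"
  have S_ne: "S \<noteq> {}"
  proof
    assume "S = {}"
    then have "{r. s \<le> r \<and> X r \<omega> \<notin> C} = {}" by (simp only: S_def)
    then show False using fin by (simp only: exit_time_def) (simp add: top_ereal_def)
  qed
  have "closed ({s..} \<inter> (\<lambda>r. X r \<omega>) -` (- C))"
    using C by (intro continuous_closed_preimage[OF cont]) auto
  moreover have "{s..} \<inter> (\<lambda>r. X r \<omega>) -` (- C) = S" by (auto simp: S_def)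
  ultimately have cl: "closed S" by simp
  have bdd: "bdd_below S" by (auto simp: S_def bdd_below_def)
  have r: "Inf S \<in> S" using closed_contains_Inf[OF S_ne bdd cl] .
  have least: "Inf S \<le> r'" if "r' \<in> S" for r' using cInf_lower[OF that bdd] .
  have "exit_time X C s \<omega> = ereal (Inf S)"
    unfolding exit_time_def S_def[symmetric]
    by (rule antisym) (auto intro!: INF_lower2[OF r] INF_greatest least)
  moreover have "X r' \<omega> \<in> C" if "s \<le> r'" "r' < Inf S" for r'
    using least[of r'] that by (auto simp: S_def)
  ultimately show thesis using that[of "Inf S"] r by (auto simp: S_def)
qed

lemma exit_time_eq:
  assumes "s \<le> r" "X r \<omega> \<notin> C" "\<And>r'. s \<le> r' \<Longrightarrow> r' < r \<Longrightarrow> X r' \<omega> \<in> C"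
  shows "exit_time X C s \<omega> = ereal r"
  unfolding exit_time_def
proof (rule antisym)
  show "(INF r\<in>{r. s \<le> r \<and> X r \<omega> \<notin> C}. ereal r) \<le> ereal r" using assms by (intro INF_lower) auto
  show "ereal r \<le> (INF r\<in>{r. s \<le> r \<and> X r \<omega> \<notin> C}. ereal r)"
    using assms(3) by (intro INF_greatest) (auto simp: not_less[symmetric])
qed

lemma open_punctured_ball: "open (punctured_ball r)"
  unfolding punctured_ball_def by (intro open_Collect_conj open_Collect_less continuous_intros)

text \<open>The norm is below c before the exit and continuous, hence at most c at the exit. Of the
  closed ball only the centre and the circle lie outside \<open>punctured_ball c\<close>.\<close>

lemma exit_from_inside:
  fixes X :: "real \<Rightarrow> 'a \<Rightarrow> real \<times> real"
  assumes cont: "continuous_on {s..} (\<lambda>r. X r \<omega>)" and r: "s \<le> r" "X r \<omega> \<notin> punctured_ball c"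
    and before: "\<And>r'. s \<le> r' \<Longrightarrow> r' < r \<Longrightarrow> X r' \<omega> \<in> punctured_ball c" and start: "X s \<omega> \<in> punctured_ball c"
  shows "s < r" "X r \<omega> = 0 \<or> norm (X r \<omega>) = c"
proof -
  show sr: "s < r" using r start by (cases "r = s") auto
  have "((\<lambda>r. X r \<omega>) \<longlongrightarrow> X r \<omega>) (at r within {s..})"
    using cont r(1) by (auto simp: continuous_on_def)
  then have "((\<lambda>r. X r \<omega>) \<longlongrightarrow> X r \<omega>) (at r within {s<..<r})"
    by (rule tendsto_within_subset) auto
  then have lim: "((\<lambda>r'. norm (X r' \<omega>)) \<longlongrightarrow> norm (X r \<omega>)) (at r within {s<..<r})"
    by (rule tendsto_norm)
  have "norm (X r \<omega>) \<le> c"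
  proof (rule tendsto_upperbound[OF lim])
    show "\<forall>\<^sub>F r' in at r within {s<..<r}. norm (X r' \<omega>) \<le> c"
      unfolding eventually_at_filter using before by (auto simp: punctured_ball_def intro!:
          always_eventually less_imp_le)
    show "at r within {s<..<r} \<noteq> bot" using sr by (simp add: at_within_eq_bot_iff)
  qed
  then show "X r \<omega> = 0 \<or> norm (X r \<omega>) = c" using r(2) by (auto simp: punctured_ball_def)
qed

section \<open>The perturbed process and its time grid\<close>

locale equilibrium_problem = planar_bm M W1 W2 + tstar_problem \<theta> \<beta> t
  for M :: "'a measure" and W1 W2 :: "real \<Rightarrow> 'a \<Rightarrow> real" and \<theta> \<beta> t :: real
begin

definition gain :: "real \<Rightarrow> (real \<Rightarrow> 'a \<Rightarrow> real \<times> real) \<Rightarrow> ('a \<Rightarrow> ereal) \<Rightarrow> 'a \<Rightarrow> ennreal" where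
  "gain b X \<tau> \<omega> = (if \<tau> \<omega> < \<infinity> then ennreal (reward \<beta> b (real_of_ereal (\<tau> \<omega>)) (X (real_of_ereal (\<tau>
      \<omega>)) \<omega>)) else 0)"

lemma payoff_gain: "payoff M \<beta> b X \<tau> = enn2ereal (\<integral>\<^sup>+\<omega>. gain b X \<tau> \<omega> \<partial>M)"
  by (simp add: payoff_def gain_def)

lemma gain_at: "\<tau> \<omega> = ereal r \<Longrightarrow> gain b X \<tau> \<omega> = ennreal ((norm (X r \<omega>))\<^sup>2 / (1 + \<beta> * (r - b)))"
  by (simp add: gain_def reward_def)

text \<open>The form with min and max has no case distinction at the switching time, which makes
  continuity of the paths immediate.\<close>

lemma perturbed_state_minmax:
  assumes "0 \<le> \<epsilon>"
  shows "perturbed_state W1 W2 \<theta> \<epsilon> \<theta>' b x s \<omega> =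
    (fst x + \<theta>' * (W1 (min s (b + \<epsilon>)) \<omega> - W1 b \<omega>) + \<theta> * (W1 (max s (b + \<epsilon>)) \<omega> - W1 (b + \<epsilon>) \<omega>),
     snd x + \<theta>' * (W2 (min s (b + \<epsilon>)) \<omega> - W2 b \<omega>) + \<theta> * (W2 (max s (b + \<epsilon>)) \<omega> - W2 (b + \<epsilon>) \<omega>))"
  using assms by (auto simp: perturbed_state_def state_def min_def max_def)

lemma continuous_on_perturbed_state:
  assumes "\<omega> \<in> space M" "0 \<le> b" "0 \<le> \<epsilon>"
  shows "continuous_on {b..} (\<lambda>s. perturbed_state W1 W2 \<theta> \<epsilon> \<theta>' b x s \<omega>)"
  unfolding perturbed_state_minmax[OF assms(3)] using assms(2,3)
  by (intro continuous_intros continuous_on_compose2[OF W_continuous(1)[OF assms(1)]]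
       continuous_on_compose2[OF W_continuous(2)[OF assms(1)]]) (auto simp: min_def max_def)

text \<open>The first step spans the whole perturbation interval and the regular grid follows.
  Volatility \<theta>' is thus confined to a single Gaussian step.\<close>

definition times :: "real \<Rightarrow> real \<Rightarrow> nat \<Rightarrow> nat \<Rightarrow> real" where
  "times b \<epsilon> n j = (case j of 0 \<Rightarrow> b | Suc i \<Rightarrow> b + \<epsilon> + real i * mesh n)"

definition vols :: "real \<Rightarrow> nat \<Rightarrow> real" where
  "vols \<theta>' j = (case j of 0 \<Rightarrow> \<theta>' | Suc i \<Rightarrow> \<theta>)"

lemma times_simps [simp]: "times b \<epsilon> n 0 = b" "times b \<epsilon> n (Suc i) = b + \<epsilon> + real i * mesh n"
  by (auto simp: times_def)

lemma vols_simps [simp]: "vols \<theta>' 0 = \<theta>'" "vols \<theta>' (Suc i) = \<theta>"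
  by (auto simp: vols_def)

lemma sampled_perturbed:
  assumes "0 \<le> b" "0 < \<epsilon>" "0 < \<theta>'"
  shows "sampled_bm M W1 W2 (times b \<epsilon> n) (vols \<theta>')"
proof
  show "times b \<epsilon> n i < times b \<epsilon> n (Suc i)" for i
    using assms by (cases i) (auto simp: algebra_simps)
  show "0 < vols \<theta>' i" for i using assms \<theta>_pos by (cases i) auto
qed (use assms in auto)

lemma X_perturbed:
  assumes "0 \<le> b" "0 < \<epsilon>" "0 < \<theta>'"
  shows "sampled_bm.X W1 W2 (times b \<epsilon> n) (vols \<theta>') x (Suc j) \<omega> = perturbed_state W1 W2 \<theta> \<epsilon> \<theta>' b x
      (b + \<epsilon> + real j * mesh n) \<omega>"
proof -
  interpret S: sampled_bm M W1 W2 "times b \<epsilon> n" "vols \<theta>'" x by (rule sampled_perturbed[OF assms])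
  show ?thesis
  proof (induction j)
    case 0
    show ?case by (simp add: S.X_Suc S.D_def S.inc_def perturbed_state_def state_def prod_eq_iff)
  next
    case (Suc j)
    show ?case
    proof -
      have late: "perturbed_state W1 W2 \<theta> \<epsilon> \<theta>' b x (b + \<epsilon> + u) \<omega>
         = state W1 W2 \<theta> (b + \<epsilon>) (state W1 W2 \<theta>' b x (b + \<epsilon>) \<omega>) (b + \<epsilon> + u) \<omega>" if "0 \<le> u" for u
        using that by (simp add: perturbed_state_def)
      have nn: "0 \<le> real j * mesh n" "0 \<le> real (Suc j) * mesh n" by simp_all
      show ?thesis
        unfolding S.X_Suc[of "Suc j"] Suc.IH late[OF nn(1)] late[OF nn(2)]
        by (simp add: S.D_def S.inc_def state_def algebra_simps)
    qed
  qed
qed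

lemma distr_perturbed:
  assumes "0 \<le> b" "0 < \<epsilon>" "0 < \<theta>'" and [measurable]: "f \<in> borel_measurable borel"
  shows "(\<lambda>\<omega>. perturbed_state W1 W2 \<theta> \<epsilon> \<theta>' b x (b + \<epsilon>) \<omega>) \<in> borel_measurable M"
    and "(\<integral>\<^sup>+\<omega>. f (perturbed_state W1 W2 \<theta> \<epsilon> \<theta>' b x (b + \<epsilon>) \<omega>) \<partial>M) = (\<integral>\<^sup>+d. f (x + d) \<partial>gauss2 (\<theta>' *
        sqrt \<epsilon>))"
proof -
  interpret S: sampled_bm M W1 W2 "times b \<epsilon> 0" "vols \<theta>'" x by (rule sampled_perturbed[OF assms(1-3)])
  have eq: "perturbed_state W1 W2 \<theta> \<epsilon> \<theta>' b x (b + \<epsilon>) \<omega> = x + S.D 0 \<omega>" for \<omega>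
    using X_perturbed[OF assms(1-3), of 0 x 0 \<omega>] by (simp add: S.X_Suc)
  show "(\<lambda>\<omega>. perturbed_state W1 W2 \<theta> \<epsilon> \<theta>' b x (b + \<epsilon>) \<omega>) \<in> borel_measurable M"
    unfolding eq by measurable
  have "S.\<sigma> 0 = \<theta>' * sqrt \<epsilon>" by (simp add: S.\<sigma>_def)
  then have "(\<integral>\<^sup>+d. f (x + d) \<partial>gauss2 (\<theta>' * sqrt \<epsilon>)) = (\<integral>\<^sup>+d. f (x + d) \<partial>distr M borel (S.D 0))"
    by (simp add: S.distr_D)
  also have "\<dots> = (\<integral>\<^sup>+\<omega>. f (x + S.D 0 \<omega>) \<partial>M)" by (subst nn_integral_distr) auto
  finally show "(\<integral>\<^sup>+\<omega>. f (perturbed_state W1 W2 \<theta> \<epsilon> \<theta>' b x (b + \<epsilon>) \<omega>) \<partial>M) = (\<integral>\<^sup>+d. f (x + d)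
      \<partial>gauss2 (\<theta>' * sqrt \<epsilon>))"
    unfolding eq by simp
qed

text \<open>The shortfall in \<open>H_ge_outside\<close> at delay \<epsilon>. Inside radius R the
  real expression is nonpositive and \<open>ennreal\<close> turns it into 0.\<close>

definition excess :: "real \<Rightarrow> real \<times> real \<Rightarrow> ennreal" where
  "excess \<epsilon> y = ennreal (\<beta> * \<epsilon> * t * ((norm y)\<^sup>2 * (norm y / R - 1)))"

lemma excess_measurable [measurable]: "excess \<epsilon> \<in> borel_measurable borel"
  unfolding excess_def[abs_def] by measurable

text \<open>On the time grid the process is stopped at radius \<open>\<rho> * R\<close> instead of \<open>R\<close>, so that a grid time
  shortly after the exit time already stops it.\<close>

lemma gain_le:
  fixes x :: "real \<times> real"
  assumes b: "0 \<le> b" and \<epsilon>: "0 < \<epsilon>" and \<theta>': "0 < \<theta>'" "\<theta>' \<le> \<theta>"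
    and \<rho>: "0 < \<rho>" "\<rho> < 1" and c: "c = \<rho>\<^sup>2 * (1 + t / 2 * ln \<rho>)" "0 < c"
  defines "Y \<equiv> perturbed_state W1 W2 \<theta> \<epsilon> \<theta>' b x"
  obtains F where "F \<in> borel_measurable M"
    "\<And>\<omega>. \<omega> \<in> space M \<Longrightarrow> gain b Y (exit_time Y (punctured_ball R) (b + \<epsilon>)) \<omega> \<le> F \<omega>"
    "(\<integral>\<^sup>+\<omega>. F \<omega> \<partial>M) \<le> ennreal (1 / c) * H 0 (norm x) + (\<integral>\<^sup>+d. excess \<epsilon> (x + d) \<partial>gauss2 (\<theta>' * sqrt \<epsilon>))"
proof -
  \<comment> \<open>No stopping at index 0: the exit is looked for only from time b + \<epsilon>
    on.\<close>
  define A where "A j = (case j of 0 \<Rightarrow> {} | Suc i \<Rightarrow> {y :: real \<times> real. \<rho> * R \<le> norm y})" for j :: nat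
  define f where "f n j y = (case j of 0 \<Rightarrow> H 0 (norm y) | Suc i \<Rightarrow> H (\<epsilon> + real i * mesh n) (norm
      y))" for n j and y :: "real \<times> real"
  define St where "St n = sampled_bm.stopped W1 W2 (times b \<epsilon> n) (vols \<theta>') x A (f n) (Suc ((Suc
      n)\<^sup>2))" for n
  \<comment> \<open>1 / c pays for stopping at \<rho> R, the factor 1 + \<beta> *
    \<open>mesh n\<close> for a grid time up to one mesh late, and the last term for an exit already
    at b + \<epsilon>, beyond R. The limit inferior is integrated by Fatou's lemma.\<close>
  define F where "F \<omega> = ennreal (1 / c) * liminf (\<lambda>n. ennreal (1 + \<beta> * mesh n) * St n \<omega>) + excess \<epsilon>
      (Y (b + \<epsilon>) \<omega>)" for \<omega>
  have A_meas [measurable]: "A j \<in> sets borel" for j by (cases j) (auto simp: A_def)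
  have f_meas [measurable]: "f n j \<in> borel_measurable borel" for n j by (cases j) (auto simp:
      f_def[abs_def])
  have St_meas [measurable]: "St n \<in> borel_measurable M" for n
    unfolding St_def by (rule sampled_bm.stopped_measurable[OF sampled_perturbed[OF b \<epsilon> \<theta>'(1)]])
        measurable
  have St_le: "(\<integral>\<^sup>+\<omega>. St n \<omega> \<partial>M) \<le> H 0 (norm x)" for n
  proof -
    interpret S: sampled_bm M W1 W2 "times b \<epsilon> n" "vols \<theta>'" x by (rule sampled_perturbed[OF b \<epsilon> \<theta>'(1)])
    have "(\<integral>\<^sup>+\<omega>. St n \<omega> \<partial>M) \<le> f n 0 x"
      unfolding St_def
    proof (rule S.stopped_le)
      fix j and y :: "real \<times> real"
      show "(\<integral>\<^sup>+d. f n (Suc j) (y + d) \<partial>gauss2 (S.\<sigma> j)) \<le> f n j y"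
      proof (cases j)
        case 0
        \<comment> \<open>Here a volatility below \<theta> is seen to do no better: its variance at
          most compensates the delay \<epsilon>. In the later steps the variance matches the delay
          exactly.\<close>
        have "(S.\<sigma> j)\<^sup>2 = \<theta>'\<^sup>2 * \<epsilon>" using \<epsilon> by (simp add: S.\<sigma>_def 0 power_mult_distrib)
        also have "\<dots> \<le> \<theta>\<^sup>2 * \<epsilon>" using \<theta>' \<epsilon> by (intro mult_right_mono power_mono) auto
        finally show ?thesis using gauss2_H_le[OF S.\<sigma>_pos, of j \<epsilon> 0 y] by (simp add: f_def 0)
      next
        case (Suc i)
        have "(S.\<sigma> j)\<^sup>2 = \<theta>\<^sup>2 * mesh n" by (simp add: S.\<sigma>_def Suc power_mult_distrib algebra_simps)
        then show ?thesis using gauss2_H_le[OF S.\<sigma>_pos, of j "mesh n" "\<epsilon> + real i * mesh n" y]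
          by (simp add: f_def Suc algebra_simps)
      qed
    qed measurable
    then show ?thesis by (simp add: f_def)
  qed
  have Y_meas [measurable]: "Y (b + \<epsilon>) \<in> borel_measurable M"
    unfolding Y_def using distr_perturbed(1)[OF b \<epsilon> \<theta>'(1), where f = "\<lambda>_. 0"] by simp
  have F_meas: "F \<in> borel_measurable M" unfolding F_def[abs_def] by measurable
  have F_int: "(\<integral>\<^sup>+\<omega>. F \<omega> \<partial>M) \<le> ennreal (1 / c) * H 0 (norm x) + (\<integral>\<^sup>+d. excess \<epsilon> (x + d) \<partial>gauss2
      (\<theta>' * sqrt \<epsilon>))"
  proof -
    have "(\<integral>\<^sup>+\<omega>. liminf (\<lambda>n. ennreal (1 + \<beta> * mesh n) * St n \<omega>) \<partial>M) \<le> liminf (\<lambda>n. \<integral>\<^sup>+\<omega>. ennreal (1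
        + \<beta> * mesh n) * St n \<omega> \<partial>M)"
      by (rule nn_integral_liminf) measurable
    also have "\<dots> \<le> liminf (\<lambda>n. ennreal (1 + \<beta> * mesh n) * H 0 (norm x))"
      by (intro Liminf_mono always_eventually allI) (simp add: nn_integral_cmult St_le mult_left_mono)
    also have "\<dots> = H 0 (norm x)"
    proof (rule lim_imp_Liminf)
      have "(\<lambda>n. ennreal (1 + \<beta> * mesh n)) \<longlonglongrightarrow> ennreal (1 + \<beta> * 0)"
        by (intro tendsto_ennrealI tendsto_intros mesh_tendsto)
      then have "(\<lambda>n. ennreal (1 + \<beta> * mesh n) * H 0 (norm x)) \<longlonglongrightarrow> ennreal (1 + \<beta> * 0) * H 0 (norm x)"
        by (intro tendsto_mult_ennreal tendsto_const) auto
      then show "(\<lambda>n. ennreal (1 + \<beta> * mesh n) * H 0 (norm x)) \<longlonglongrightarrow> H 0 (norm x)" by simp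
    qed simp
    finally have "ennreal (1 / c) * (\<integral>\<^sup>+\<omega>. liminf (\<lambda>n. ennreal (1 + \<beta> * mesh n) * St n \<omega>) \<partial>M) \<le>
        ennreal (1 / c) * H 0 (norm x)"
      by (intro mult_left_mono) auto
    moreover have "(\<integral>\<^sup>+\<omega>. excess \<epsilon> (Y (b + \<epsilon>) \<omega>) \<partial>M) = (\<integral>\<^sup>+d. excess \<epsilon> (x + d) \<partial>gauss2 (\<theta>' * sqrt \<epsilon>))"
      unfolding Y_def by (rule distr_perturbed(2)[OF b \<epsilon> \<theta>'(1)]) measurable
    ultimately show ?thesis
      unfolding F_def by (subst nn_integral_add) (auto simp: nn_integral_cmult intro!: add_right_mono)
  qed
  have c1: "c \<le> 1"
  proof -
    have "1 + t / 2 * ln \<rho> \<le> 1" using \<rho> t_pos by (simp add: mult_le_0_iff)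
    moreover have "\<rho>\<^sup>2 \<le> 1" using \<rho> by (simp add: power_le_one)
    ultimately show ?thesis unfolding c(1) using c by (intro mult_le_one) (auto simp:
        zero_less_mult_iff)
  qed
  have first: "St n \<omega> = H \<epsilon> (norm (Y (b + \<epsilon>) \<omega>))" if "\<rho> * R \<le> norm (Y (b + \<epsilon>) \<omega>)" for n \<omega>
  proof -
    interpret S: sampled_bm M W1 W2 "times b \<epsilon> n" "vols \<theta>'" x by (rule sampled_perturbed[OF b \<epsilon> \<theta>'(1)])
    have "S.X 1 \<omega> = Y (b + \<epsilon>) \<omega>" using X_perturbed[OF b \<epsilon> \<theta>'(1), of n x 0 \<omega>] by (simp add: Y_def)
    then show ?thesis
      unfolding St_def using that by (subst S.stopped_first_hit[of 1]) (auto simp: A_def f_def)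
  qed
  have gain_F: "gain b Y (exit_time Y (punctured_ball R) (b + \<epsilon>)) \<omega> \<le> F \<omega>" if \<omega>: "\<omega> \<in> space M" for \<omega>
  proof (cases "exit_time Y (punctured_ball R) (b + \<epsilon>) \<omega> < \<infinity>")
    case False then show ?thesis by (simp add: gain_def)
  next
    case True
    have cont: "continuous_on {b + \<epsilon>..} (\<lambda>r. Y r \<omega>)"
      unfolding Y_def by (rule continuous_on_subset[OF continuous_on_perturbed_state[OF \<omega> b]]) (use
          \<epsilon> in auto)
    obtain r where r: "b + \<epsilon> \<le> r" "exit_time Y (punctured_ball R) (b + \<epsilon>) \<omega> = ereal r" "Y r \<omega> \<notin>
        punctured_ball R"
      "\<And>r'. b + \<epsilon> \<le> r' \<Longrightarrow> r' < r \<Longrightarrow> Y r' \<omega> \<in> punctured_ball R"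
      using exit_time_attained[of "b + \<epsilon>" Y \<omega> "punctured_ball R", OF cont open_punctured_ball True]
          by blast
    have gain: "gain b Y (exit_time Y (punctured_ball R) (b + \<epsilon>)) \<omega> = ennreal ((norm (Y r \<omega>))\<^sup>2 /
        (1 + \<beta> * (r - b)))"
      using r(2) by (rule gain_at)
    \<comment> \<open>At the origin the reward is 0. Otherwise the exit is immediate at b +
      \<epsilon>, possibly with an overshoot, or it happens later and then, by continuity, on the
      circle.\<close>
    consider "Y r \<omega> = 0" | "r = b + \<epsilon>" "R \<le> norm (Y r \<omega>)" | "Y (b + \<epsilon>) \<omega> \<in> punctured_ball R" "norm
        (Y r \<omega>) = R"
    proof (cases "Y (b + \<epsilon>) \<omega> \<in> punctured_ball R")
      case True
      then show thesis using exit_from_inside(2)[of "b + \<epsilon>" Y \<omega> r R, OF cont r(1) r(3) r(4) True]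
          that by blast
    next
      case False
      then have "r = b + \<epsilon>" using r(1) r(4)[of "b + \<epsilon>"] by force
      then show thesis using False that by (auto simp: punctured_ball_def not_less)
    qed
    then show ?thesis
    proof cases
      case 1 then show ?thesis unfolding gain by simp
    next
      case 2
      have "\<rho> * R \<le> norm (Y (b + \<epsilon>) \<omega>)" using 2 \<rho> R_pos by (metis mult_le_cancel_right1 order_trans
          less_imp_le not_less)
      note St = first[OF this]
      have "gain b Y (exit_time Y (punctured_ball R) (b + \<epsilon>)) \<omega> \<le> H \<epsilon> (norm (Y r \<omega>)) + excess \<epsilon> (Y r \<omega>)"
        unfolding gain excess_def using H_ge_outside[of \<epsilon> "norm (Y r \<omega>)"] 2 \<epsilon> by simp
      also have "\<dots> \<le> F \<omega>"
        unfolding F_def 2(1)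
      proof (rule add_right_mono)
        have "H \<epsilon> (norm (Y (b + \<epsilon>) \<omega>)) \<le> liminf (\<lambda>n. ennreal (1 + \<beta> * mesh n) * St n \<omega>)"
        proof (rule Liminf_bounded, rule always_eventually, rule allI)
          fix n
          have "ennreal 1 * St n \<omega> \<le> ennreal (1 + \<beta> * mesh n) * St n \<omega>"
            using \<beta>_pos by (intro mult_right_mono ennreal_leI) auto
          then show "H \<epsilon> (norm (Y (b + \<epsilon>) \<omega>)) \<le> ennreal (1 + \<beta> * mesh n) * St n \<omega>" by (simp add: St)
        qed
        then have "ennreal 1 * H \<epsilon> (norm (Y (b + \<epsilon>) \<omega>)) \<le> ennreal (1 / c) * liminf (\<lambda>n. ennreal (1
            + \<beta> * mesh n) * St n \<omega>)"
          using c c1 by (intro mult_mono ennreal_leI) auto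
        then show "H \<epsilon> (norm (Y (b + \<epsilon>) \<omega>)) \<le> ennreal (1 / c) * liminf (\<lambda>n. ennreal (1 + \<beta> * mesh
            n) * St n \<omega>)" by simp
      qed
      finally show ?thesis .
    next
      case 3
      let ?g = "R\<^sup>2 / (1 + \<beta> * (r - b))"
      have "\<forall>\<^sub>F n in sequentially. \<exists>j\<le>(Suc n)\<^sup>2. r \<le> (b + \<epsilon>) + real j * mesh n \<and> (b + \<epsilon>) + real j *
          mesh n \<le> r + mesh n \<and>
         Y ((b + \<epsilon>) + real j * mesh n) \<omega> \<in> {y. \<rho> * R < norm y}"
        using 3 \<rho> R_pos r(1)
        by (intro eventually_grid_in_open[OF cont] open_Collect_less continuous_intros) auto
      then have "\<forall>\<^sub>F n in sequentially. ennreal (c * ?g) \<le> ennreal (1 + \<beta> * mesh n) * St n \<omega>"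
      proof eventually_elim
        case (elim n)
        then obtain j where j: "j \<le> (Suc n)\<^sup>2" "(b + \<epsilon>) + real j * mesh n \<le> r + mesh n" "\<rho> * R <
            norm (Y ((b + \<epsilon>) + real j * mesh n) \<omega>)"
          by auto
        interpret S: sampled_bm M W1 W2 "times b \<epsilon> n" "vols \<theta>'" x by (rule sampled_perturbed[OF b \<epsilon>
            \<theta>'(1)])
        have XY: "S.X (Suc i) \<omega> = Y ((b + \<epsilon>) + real i * mesh n) \<omega>" for i
          using X_perturbed[OF b \<epsilon> \<theta>'(1)] by (simp add: Y_def)
        have "S.X (Suc j) \<omega> \<in> A (Suc j)" using j(3) by (simp add: XY A_def)
        then have "S.hit A (Suc j) \<omega>" unfolding S.hit_def by blast
        \<comment> \<open>The stopping index may precede the exit, since \<rho> R can be reached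
          earlier. This does no harm: the bound on \<open>H\<close> improves with a shorter delay.
          Index 0 is excluded because \<open>A 0\<close> is empty.\<close>
        then obtain i where i: "i \<le> Suc j" "S.X i \<omega> \<in> A i" "\<And>l. l < i \<Longrightarrow> S.X l \<omega> \<notin> A l" by (rule
            S.hit_first) blast
        then obtain l where l: "i = Suc l" "l \<le> j" by (cases i) (auto simp: A_def)
        have "St n \<omega> = f n i (S.X i \<omega>)"
          unfolding St_def using i j(1) by (intro S.stopped_first_hit) auto
        then have Sn: "St n \<omega> = H (\<epsilon> + real l * mesh n) (norm (S.X i \<omega>))" by (simp add: f_def l)
        have s: "0 \<le> \<epsilon> + real l * mesh n" using \<epsilon> by simp
        have "real l * mesh n \<le> real j * mesh n" using l by (intro mult_right_mono) auto
        then have s_le: "\<epsilon> + real l * mesh n \<le> (r - b) + mesh n" using j(2) by linarith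
        have rb: "0 \<le> r - b" using r(1) \<epsilon> by simp
        have "1 + \<beta> * (\<epsilon> + real l * mesh n) \<le> 1 + \<beta> * ((r - b) + mesh n)"
          using s_le \<beta>_pos by simp
        also have "\<dots> \<le> (1 + \<beta> * (r - b)) * (1 + \<beta> * mesh n)"
          using rb \<beta>_pos by (simp add: algebra_simps)
        finally have le: "1 + \<beta> * (\<epsilon> + real l * mesh n) \<le> (1 + \<beta> * (r - b)) * (1 + \<beta> * mesh n)" .
        have p: "0 < 1 + \<beta> * (\<epsilon> + real l * mesh n)" "0 < 1 + \<beta> * (r - b)" "0 < 1 + \<beta> * mesh n"
          using discount_pos[OF s] discount_pos[OF rb] discount_pos[of "mesh n"] by auto
        have "1 / (1 + \<beta> * (r - b)) = (1 + \<beta> * mesh n) / ((1 + \<beta> * (r - b)) * (1 + \<beta> * mesh n))"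
            using p by simp
        also have "\<dots> \<le> (1 + \<beta> * mesh n) / (1 + \<beta> * (\<epsilon> + real l * mesh n))"
          using p le by (intro divide_left_mono mult_pos_pos) auto
        finally have "c * R\<^sup>2 * (1 / (1 + \<beta> * (r - b))) \<le> c * R\<^sup>2 * ((1 + \<beta> * mesh n) / (1 + \<beta> * (\<epsilon>
            + real l * mesh n)))"
          using c by (intro mult_left_mono) auto
        then have "ennreal (c * ?g) \<le> ennreal ((1 + \<beta> * mesh n) * (c * (R\<^sup>2 / (1 + \<beta> * (\<epsilon> + real l
            * mesh n)))))"
          by (intro ennreal_leI) (simp add: mult_ac)
        also have "\<dots> = ennreal (1 + \<beta> * mesh n) * ennreal (c * (R\<^sup>2 / (1 + \<beta> * (\<epsilon> + real l * mesh n))))"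
          using p by (intro ennreal_mult') simp
        also have "\<dots> \<le> ennreal (1 + \<beta> * mesh n) * St n \<omega>"
          unfolding Sn c(1) using i(2) \<rho> by (intro mult_left_mono H_ge_inside[OF s]) (auto simp:
              A_def l)
        finally show ?case .
      qed
      then have "ennreal (c * ?g) \<le> liminf (\<lambda>n. ennreal (1 + \<beta> * mesh n) * St n \<omega>)"
        by (rule Liminf_bounded)
      then have "ennreal (1 / c) * ennreal (c * ?g) \<le> ennreal (1 / c) * liminf (\<lambda>n. ennreal (1 + \<beta>
          * mesh n) * St n \<omega>)"
        by (intro mult_left_mono) auto
      moreover have "ennreal (1 / c) * ennreal (c * ?g) = ennreal ?g"
        using c(2) by (simp add: ennreal_mult'[symmetric])
      ultimately have "ennreal ?g \<le> ennreal (1 / c) * liminf (\<lambda>n. ennreal (1 + \<beta> * mesh n) * St n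
          \<omega>)" by simp
      also have "\<dots> \<le> F \<omega>" unfolding F_def by simp
      finally show ?thesis unfolding gain 3(2) .
    qed
  qed
  show thesis by (rule that[OF F_meas gain_F F_int])
qed

end

subsection \<open>Lower bound for the pay-off\<close>

text \<open>Applying exp (c |u|) \<le> exp (c u) + exp (- c u) in each coordinate reduces the norm
  to moment generating functions; the four products account for the factor 4.\<close>

lemma gauss2_exp_norm_le:
  assumes "0 < s" "0 \<le> c"
  shows "(\<integral>\<^sup>+d. ennreal (exp (c * norm d)) \<partial>gauss2 s) \<le> ennreal (4 * exp (c\<^sup>2 * s\<^sup>2))"
proof -
  have e: "(\<integral>\<^sup>+x. ennreal (normal_density 0 s x) * ennreal (exp (c * x) + exp (- c * x)) \<partial>lborel) =
      ennreal (2 * exp (c\<^sup>2 * s\<^sup>2 / 2))"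
  proof -
    have "(\<integral>\<^sup>+x. ennreal (normal_density 0 s x) * ennreal (exp (c * x) + exp (- c * x)) \<partial>lborel)
      = (\<integral>\<^sup>+x. ennreal (normal_density 0 s x) * ennreal (exp (c * x)) + ennreal (normal_density 0 s
          x) * ennreal (exp (- c * x)) \<partial>lborel)"
      by (intro nn_integral_cong) (simp add: distrib_left[symmetric])
    also have "\<dots> = ennreal (exp (c\<^sup>2 * s\<^sup>2 / 2)) + ennreal (exp ((- c)\<^sup>2 * s\<^sup>2 / 2))"
      unfolding normal_density_mgf[OF assms(1), symmetric] by (rule nn_integral_add) measurable
    also have "\<dots> = ennreal (2 * exp (c\<^sup>2 * s\<^sup>2 / 2))" by (simp add: ennreal_plus[symmetric] del:
        ennreal_plus)
    finally show ?thesis .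
  qed
  have le: "exp (c * norm d) \<le> (exp (c * fst d) + exp (- c * fst d)) * (exp (c * snd d) + exp (- c
      * snd d))" for d :: "real \<times> real"
  proof -
    have a: "exp (c * \<bar>u\<bar>) \<le> exp (c * u) + exp (- c * u)" for u :: real
      by (cases "0 \<le> u") (auto simp: add_increasing add_increasing2)
    have "norm d \<le> \<bar>fst d\<bar> + \<bar>snd d\<bar>"
      using sqrt_sum_squares_le_sum_abs[of "fst d" "snd d"] by (simp add: norm_prod_def)
    then have "exp (c * norm d) \<le> exp (c * \<bar>fst d\<bar>) * exp (c * \<bar>snd d\<bar>)"
      using assms(2) unfolding exp_add[symmetric] distrib_left[symmetric] by (simp add: mult_left_mono)
    also have "\<dots> \<le> (exp (c * fst d) + exp (- c * fst d)) * (exp (c * snd d) + exp (- c * snd d))"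
      by (intro mult_mono a) (auto simp: add_nonneg_nonneg)
    finally show ?thesis .
  qed
  have "(\<integral>\<^sup>+d. ennreal (exp (c * norm d)) \<partial>gauss2 s) \<le>
     (\<integral>\<^sup>+d. ennreal (exp (c * fst d) + exp (- c * fst d)) * ennreal (exp (c * snd d) + exp (- c *
         snd d)) \<partial>gauss2 s)"
    by (intro nn_integral_mono) (simp add: ennreal_mult'[symmetric] add_nonneg_nonneg ennreal_leI
        le[simplified] del: ennreal_plus)
  also have "\<dots> = ennreal (2 * exp (c\<^sup>2 * s\<^sup>2 / 2)) * ennreal (2 * exp (c\<^sup>2 * s\<^sup>2 / 2))"
    by (subst nn_integral_gauss2_prod[OF assms(1)]) (simp_all only: e, measurable)
  also have "\<dots> = ennreal (4 * exp (c\<^sup>2 * s\<^sup>2))"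
    by (simp add: ennreal_mult'[symmetric] exp_add[symmetric])
  finally show ?thesis .
qed

lemma (in sampled_bm) nn_integral_D:
  assumes [measurable]: "f \<in> borel_measurable borel"
  shows "(\<integral>\<^sup>+\<omega>. f (D j \<omega>) \<partial>M) = (\<integral>\<^sup>+d. f d \<partial>gauss2 (\<sigma> j))"
  unfolding distr_D[symmetric] by (subst nn_integral_distr) auto

text \<open>Joint measurability in the mixture variable, for the exchange of the integrals over v
  and over the probability space.\<close>

lemma (in sampled_bm) stopped_measurable_pair:
  assumes [measurable]: "\<And>i. A i \<in> sets borel" and g: "\<And>i. (\<lambda>(v, y). g v i y) \<in> borel_measurable
      (borel \<Otimes>\<^sub>M borel)"
  shows "(\<lambda>(v::real, \<omega>). stopped A (g v) j \<omega>) \<in> borel_measurable (borel \<Otimes>\<^sub>M M)"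
proof (induction j)
  case 0
  have "(\<lambda>z. (fst z, X 0 (snd z))) \<in> borel \<Otimes>\<^sub>M M \<rightarrow>\<^sub>M borel \<Otimes>\<^sub>M borel" by measurable
  from measurable_compose[OF this g[of 0]] show ?case by (simp add: case_prod_beta')
next
  case (Suc j)
  have "(\<lambda>z. (fst z, X (Suc j) (snd z))) \<in> borel \<Otimes>\<^sub>M M \<rightarrow>\<^sub>M borel \<Otimes>\<^sub>M borel" by measurable
  from measurable_compose[OF this g[of "Suc j"]]
  have [measurable]: "(\<lambda>z. g (fst z) (Suc j) (X (Suc j) (snd z))) \<in> borel_measurable (borel \<Otimes>\<^sub>M M)"
      by simp
  have [measurable]: "(\<lambda>z. stopped A (g (fst z)) j (snd z)) \<in> borel_measurable (borel \<Otimes>\<^sub>M M)"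
    using Suc by (simp add: case_prod_beta')
  have [measurable]: "Measurable.pred M (hit A j)" by (rule hit_measurable) measurable
  show ?case by (simp add: case_prod_beta')
qed

section \<open>Laplace transforms of the hitting time of radius R\<close>

context equilibrium_problem
begin

text \<open>The indicator makes the stopped value vanish if the horizon ends without a hit, so that
  only discounts at actual hits count.\<close>

definition disc :: "nat \<Rightarrow> real \<Rightarrow> nat \<Rightarrow> real \<times> real \<Rightarrow> ennreal" where
  "disc n v j y = ennreal (exp (- (\<beta> * v\<^sup>2 * (real j * mesh n)))) * indicator {y. R \<le> norm y} y"

definition discounted :: "real \<Rightarrow> real \<times> real \<Rightarrow> nat \<Rightarrow> real \<Rightarrow> 'a \<Rightarrow> ennreal" where
  "discounted b x n v = sampled_bm.stopped W1 W2 (\<lambda>j. b + real j * mesh n) (\<lambda>_. \<theta>) x (\<lambda>_. {y. R \<le>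
      norm y}) (disc n v) ((Suc n)\<^sup>2)"

lemma disc_measurable: "(\<lambda>(v, y). disc n v j y) \<in> borel_measurable (borel \<Otimes>\<^sub>M borel)"
  unfolding disc_def by measurable

lemma discounted_measurable:
  assumes "0 \<le> b"
  shows "(\<lambda>(v, \<omega>). discounted b x n v \<omega>) \<in> borel_measurable (borel \<Otimes>\<^sub>M M)"
  unfolding discounted_def
  by (rule sampled_bm.stopped_measurable_pair[OF sampled_grid[OF assms \<theta>_pos]]) (auto simp:
      disc_measurable)

lemma discounted_measurable2:
  assumes "0 \<le> b"
  shows "discounted b x n v \<in> borel_measurable M"
  using measurable_compose[OF measurable_Pair1' discounted_measurable[OF assms], of v] by simp

text \<open>Optional stopping for \<open>exp (- \<beta> * v\<^sup>2 * s) * I0 (\<kappa> * v * norm (X s))\<close>. The overshoot over the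
  radius \<open>R\<close> exceeds \<open>\<eta>\<close> only if one of the increments does.\<close>

lemma discounted_ge:
  assumes b: "0 \<le> b" and x: "norm x < R" and v: "0 < v" and \<eta>: "0 < \<eta>"
  defines "k \<equiv> \<kappa> * v"
  shows "ennreal (I0 (k * norm x)) \<le> ennreal (I0 (k * (R + \<eta>))) * (\<integral>\<^sup>+\<omega>. discounted b x n v \<omega> \<partial>M)
     + ennreal (exp (- (\<beta> * v\<^sup>2 * real (Suc n))) * I0 (k * R)
       + (real (Suc n))\<^sup>2 * (exp (k * R - sqrt (real (Suc n)) * \<eta>) * (4 * exp ((k + 1)\<^sup>2 * \<theta>\<^sup>2))))"
proof -
  interpret S: sampled_bm M W1 W2 "\<lambda>j. b + real j * mesh n" "\<lambda>_. \<theta>" x by (rule sampled_grid[OF b \<theta>_pos])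
  let ?A = "\<lambda>_::nat. {y :: real \<times> real. R \<le> norm y}"
  let ?N = "(Suc n)\<^sup>2"
  have k: "0 < k" using v \<kappa>_pos by (simp add: k_def)
  have k2: "k\<^sup>2 * \<theta>\<^sup>2 / 2 = \<beta> * v\<^sup>2" using \<kappa>_sq by (simp add: k_def power_mult_distrib)
  define f where "f j y = ennreal (exp (- (\<beta> * v\<^sup>2 * (real j * mesh n))) * I0 (k * norm y))" for j
      and y :: "real \<times> real"
  \<comment> \<open>Exponent of a Chebyshev bound for large increments. As a^2 is the number of
    steps per unit time, the moment bound exp ((k + a)^2 \<sigma>^2) stays bounded, while exp (- a
    \<eta>) outweighs the (n + 1)^2 increments.\<close>
  define a where "a = sqrt (real (Suc n))"
  have a: "0 \<le> a" "1 \<le> a" "a\<^sup>2 = real (Suc n)" by (auto simp: a_def)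
  define ov where "ov d = (if \<eta> < norm d then ennreal (exp (k * (R + norm d))) else 0)" for d ::
      "real \<times> real"
  have f_meas [measurable]: "f j \<in> borel_measurable borel" for j by (auto simp: f_def[abs_def])
  have ov_meas [measurable]: "ov \<in> borel_measurable borel" by (auto simp: ov_def[abs_def])
  have \<sigma>: "S.\<sigma> j = \<theta> * sqrt (mesh n)" for j using b \<theta>_pos by (rule \<sigma>_grid)
  have "f 0 x \<le> (\<integral>\<^sup>+\<omega>. S.stopped ?A f ?N \<omega> \<partial>M)"
  proof (rule S.stopped_ge)
    fix j and y :: "real \<times> real"
    have "(\<integral>\<^sup>+d. f (Suc j) (y + d) \<partial>gauss2 (S.\<sigma> j)) =
       ennreal (exp (- (\<beta> * v\<^sup>2 * (real (Suc j) * mesh n)))) * (\<integral>\<^sup>+d. ennreal (I0 (k * norm (y +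
           d))) \<partial>gauss2 (S.\<sigma> j))"
      unfolding f_def by (subst nn_integral_cmult[symmetric]) (auto simp: ennreal_mult')
    also have "\<dots> = ennreal (exp (- (\<beta> * v\<^sup>2 * (real (Suc j) * mesh n))) * exp (k\<^sup>2 * (S.\<sigma> j)\<^sup>2 / 2)
        * I0 (k * norm y))"
      unfolding gauss2_I0[OF S.\<sigma>_pos] by (simp add: ennreal_mult'[symmetric] mult.assoc)
    also have "k\<^sup>2 * (S.\<sigma> j)\<^sup>2 / 2 = \<beta> * v\<^sup>2 * mesh n"
      unfolding k2[symmetric] \<sigma> by (simp add: power_mult_distrib)
    also have "exp (- (\<beta> * v\<^sup>2 * (real (Suc j) * mesh n))) * exp (\<beta> * v\<^sup>2 * mesh n) = exp (- (\<beta> *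
        v\<^sup>2 * (real j * mesh n)))"
      unfolding exp_add[symmetric] by (simp add: algebra_simps)
    finally show "f j y \<le> (\<integral>\<^sup>+d. f (Suc j) (y + d) \<partial>gauss2 (S.\<sigma> j))" by (simp add: f_def)
  qed measurable
  also have "\<dots> \<le> (\<integral>\<^sup>+\<omega>. ennreal (I0 (k * (R + \<eta>))) * discounted b x n v \<omega>
      + (ennreal (exp (- (\<beta> * v\<^sup>2 * real (Suc n))) * I0 (k * R)) + (\<Sum>j<?N. ov (S.D j \<omega>))) \<partial>M)"
  proof (rule nn_integral_mono)
    fix \<omega>
    have Nm: "real ?N * mesh n = real (Suc n)" by (simp only: mesh_def power2_eq_square
        of_nat_mult) simp
    show "S.stopped ?A f ?N \<omega> \<le> ennreal (I0 (k * (R + \<eta>))) * discounted b x n v \<omega>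
      + (ennreal (exp (- (\<beta> * v\<^sup>2 * real (Suc n))) * I0 (k * R)) + (\<Sum>j<?N. ov (S.D j \<omega>)))"
    proof (cases "S.hit ?A ?N \<omega>")
      case False
      have "S.stopped ?A f ?N \<omega> = f ?N (S.X ?N \<omega>)"
        using False by (intro S.stopped_not_hit) (auto simp: S.hit_def)
      also have "\<dots> \<le> ennreal (exp (- (\<beta> * v\<^sup>2 * real (Suc n))) * I0 (k * R))"
      proof -
        have "norm (S.X ?N \<omega>) \<le> R" using False unfolding S.hit_def by (auto simp: not_le intro:
            less_imp_le)
        then have "I0 (k * norm (S.X ?N \<omega>)) \<le> I0 (k * R)" using k by (intro I0_mono) (auto simp:
            abs_mult)
        then show ?thesis unfolding f_def Nm by (intro ennreal_leI mult_left_mono) auto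
      qed
      also have "\<dots> \<le> ennreal (I0 (k * (R + \<eta>))) * discounted b x n v \<omega>
        + (ennreal (exp (- (\<beta> * v\<^sup>2 * real (Suc n))) * I0 (k * R)) + (\<Sum>j<?N. ov (S.D j \<omega>)))"
        by (metis add_increasing add_increasing2 order_refl zero_le)
      finally show ?thesis .
    next
      case True
      then obtain i where i: "i \<le> ?N" "R \<le> norm (S.X i \<omega>)" "\<And>l. l < i \<Longrightarrow> norm (S.X l \<omega>) < R"
        by (rule S.hit_first) (auto simp: not_le)
      then obtain l where l: "i = Suc l" using x by (cases i) auto
      have nh: "\<not> R \<le> norm (S.X m \<omega>)" if "m < i" for m using i(3)[OF that] by simp
      have st: "S.stopped ?A f ?N \<omega> = f i (S.X i \<omega>)" "discounted b x n v \<omega> = disc n v i (S.X i \<omega>)"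
        unfolding discounted_def using i(1,2) nh by (auto intro!: S.stopped_first_hit)
      have nX: "norm (S.X i \<omega>) \<le> R + norm (S.D l \<omega>)"
        unfolding l S.X_Suc using norm_triangle_ineq[of "S.X l \<omega>" "S.D l \<omega>"] i(3)[of l] l by simp
      show ?thesis
      proof (cases "\<eta> < norm (S.D l \<omega>)")
        case True
        have "f i (S.X i \<omega>) \<le> ov (S.D l \<omega>)"
        proof -
          have "I0 (k * norm (S.X i \<omega>)) \<le> exp (k * norm (S.X i \<omega>))" using k by (intro I0_le_exp) auto
          also have "\<dots> \<le> exp (k * (R + norm (S.D l \<omega>)))" using nX k by simp
          finally have "exp (- (\<beta> * v\<^sup>2 * (real i * mesh n))) * I0 (k * norm (S.X i \<omega>)) \<le> 1 * exp
              (k * (R + norm (S.D l \<omega>)))"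
            using \<beta>_pos by (intro mult_mono) auto
          then show ?thesis unfolding f_def ov_def using True by (simp add: ennreal_leI)
        qed
        also have "\<dots> \<le> (\<Sum>j<?N. ov (S.D j \<omega>))"
          using i(1) l by (intro member_le_sum) auto
        finally show ?thesis unfolding st(1) by (metis add_increasing zero_le)
      next
        case False
        have "I0 (k * norm (S.X i \<omega>)) \<le> I0 (k * (R + \<eta>))"
          using nX k False R_pos \<eta> by (intro I0_mono) (auto simp: abs_mult)
        then have "f i (S.X i \<omega>) \<le> ennreal (I0 (k * (R + \<eta>)) * exp (- (\<beta> * v\<^sup>2 * (real i * mesh n))))"
          unfolding f_def by (intro ennreal_leI) (simp add: mult.commute)
        also have "\<dots> = ennreal (I0 (k * (R + \<eta>))) * discounted b x n v \<omega>"
          unfolding st(2) disc_def using i(2) by (simp add: ennreal_mult')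
        finally show ?thesis unfolding st(1) by (metis add_increasing2 zero_le)
      qed
    qed
  qed
  also have "\<dots> = ennreal (I0 (k * (R + \<eta>))) * (\<integral>\<^sup>+\<omega>. discounted b x n v \<omega> \<partial>M)
      + (ennreal (exp (- (\<beta> * v\<^sup>2 * real (Suc n))) * I0 (k * R)) + (\<Sum>j<?N. (\<integral>\<^sup>+\<omega>. ov (S.D j \<omega>) \<partial>M)))"
    using discounted_measurable2[OF b]
    by (simp add: nn_integral_add nn_integral_cmult nn_integral_sum emeasure_space_1)
  also have "\<dots> \<le> ennreal (I0 (k * (R + \<eta>))) * (\<integral>\<^sup>+\<omega>. discounted b x n v \<omega> \<partial>M)
      + (ennreal (exp (- (\<beta> * v\<^sup>2 * real (Suc n))) * I0 (k * R)) + (\<Sum>j<?N. ennreal (exp (k * R - a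
          * \<eta>) * (4 * exp ((k + 1)\<^sup>2 * \<theta>\<^sup>2)))))"
  proof (intro add_left_mono sum_mono)
    fix j
    have "(\<integral>\<^sup>+\<omega>. ov (S.D j \<omega>) \<partial>M) = (\<integral>\<^sup>+d. ov d \<partial>gauss2 (S.\<sigma> j))"
      by (rule S.nn_integral_D) measurable
    also have "\<dots> \<le> (\<integral>\<^sup>+d. ennreal (exp (k * R - a * \<eta>)) * ennreal (exp ((k + a) * norm d)) \<partial>gauss2
        (S.\<sigma> j))"
    proof (rule nn_integral_mono)
      fix d :: "real \<times> real"
      have "k * (R + norm d) \<le> (k * R - a * \<eta>) + (k + a) * norm d" if "\<eta> < norm d"
        using mult_left_mono[OF less_imp_le[OF that] a(1)] by (simp add: algebra_simps)
      then show "ov d \<le> ennreal (exp (k * R - a * \<eta>)) * ennreal (exp ((k + a) * norm d))"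
        by (auto simp: ov_def ennreal_mult'[symmetric] exp_add[symmetric] intro!: ennreal_leI)
    qed
    also have "\<dots> = ennreal (exp (k * R - a * \<eta>)) * (\<integral>\<^sup>+d. ennreal (exp ((k + a) * norm d)) \<partial>gauss2
        (S.\<sigma> j))"
      by (rule nn_integral_cmult) measurable
    also have "\<dots> \<le> ennreal (exp (k * R - a * \<eta>)) * ennreal (4 * exp ((k + a)\<^sup>2 * (S.\<sigma> j)\<^sup>2))"
      using k a S.\<sigma>_pos by (intro mult_left_mono gauss2_exp_norm_le) auto
    also have "\<dots> = ennreal (exp (k * R - a * \<eta>) * (4 * exp ((k + a)\<^sup>2 * (S.\<sigma> j)\<^sup>2)))"
      by (simp add: ennreal_mult'[symmetric])
    also have "\<dots> \<le> ennreal (exp (k * R - a * \<eta>) * (4 * exp ((k + 1)\<^sup>2 * \<theta>\<^sup>2)))"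
    proof -
      have "k * 1 \<le> k * a" using a k by (intro mult_left_mono) auto
      then have "(k + a)\<^sup>2 \<le> ((k + 1) * a)\<^sup>2" using k a by (intro power_mono) (auto simp: algebra_simps)
      also have "\<dots> = (k + 1)\<^sup>2 * real (Suc n)" by (simp add: power_mult_distrib a(3))
      finally have "(k + a)\<^sup>2 * (S.\<sigma> j)\<^sup>2 \<le> ((k + 1)\<^sup>2 * real (Suc n)) * (S.\<sigma> j)\<^sup>2" by (intro
          mult_right_mono) auto
      also have "\<dots> = (k + 1)\<^sup>2 * \<theta>\<^sup>2" unfolding \<sigma> by (simp add: power_mult_distrib mesh_def del:
          of_nat_Suc)
      finally show ?thesis by (intro ennreal_leI mult_left_mono) auto
    qed
    finally show "(\<integral>\<^sup>+\<omega>. ov (S.D j \<omega>) \<partial>M) \<le> ennreal (exp (k * R - a * \<eta>) * (4 * exp ((k + 1)\<^sup>2 *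
        \<theta>\<^sup>2)))" .
  qed
  also have "\<dots> = ennreal (I0 (k * (R + \<eta>))) * (\<integral>\<^sup>+\<omega>. discounted b x n v \<omega> \<partial>M)
     + ennreal (exp (- (\<beta> * v\<^sup>2 * real (Suc n))) * I0 (k * R)
       + (real (Suc n))\<^sup>2 * (exp (k * R - a * \<eta>) * (4 * exp ((k + 1)\<^sup>2 * \<theta>\<^sup>2))))"
  proof -
    have "(\<Sum>j<?N. ennreal (exp (k * R - a * \<eta>) * (4 * exp ((k + 1)\<^sup>2 * \<theta>\<^sup>2)))) = ennreal ((real
        (Suc n))\<^sup>2 * (exp (k * R - a * \<eta>) * (4 * exp ((k + 1)\<^sup>2 * \<theta>\<^sup>2))))"
      by (subst sum_ennreal) (simp_all del: of_nat_Suc)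
    then show ?thesis by (subst ennreal_plus) (simp_all del: of_nat_Suc)
  qed
  finally show ?thesis unfolding f_def a_def by simp
qed

text \<open>For a fixed margin \<eta> the error terms vanish as n grows; then \<eta> tends to 0 by
  continuity of I0. The limits are taken in this order because the overshoot estimate works with a
  positive margin.\<close>

lemma liminf_discounted_ge:
  assumes b: "0 \<le> b" and x: "norm x < R" and v: "0 < v"
  shows "ennreal (I0 (\<kappa> * v * norm x) / I0 (\<kappa> * v * R)) \<le> liminf (\<lambda>n. \<integral>\<^sup>+\<omega>. discounted b x n v \<omega> \<partial>M)"
proof -
  let ?k = "\<kappa> * v"
  let ?q = "\<lambda>n. \<integral>\<^sup>+\<omega>. discounted b x n v \<omega> \<partial>M"
  have k: "0 < ?k" using v \<kappa>_pos by simp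
  have bv: "0 < \<beta> * v\<^sup>2" using v \<beta>_pos by simp
  have step: "ennreal (I0 (?k * norm x) / I0 (?k * (R + \<eta>))) \<le> liminf ?q" if \<eta>: "0 < \<eta>" for \<eta>
  proof -
    define e where "e n = exp (- (\<beta> * v\<^sup>2 * real (Suc n))) * I0 (?k * R)
       + (real (Suc n))\<^sup>2 * (exp (?k * R - sqrt (real (Suc n)) * \<eta>) * (4 * exp ((?k + 1)\<^sup>2 *
           \<theta>\<^sup>2)))" for n
    have e0: "e \<longlonglongrightarrow> 0"
    proof -
      have "(\<lambda>n. exp (- (B * real (Suc n))) * I + (real (Suc n))\<^sup>2 * (exp (K - sqrt (real (Suc n))
          * \<eta>) * L)) \<longlonglongrightarrow> 0" if "0 < B" for B I K L :: real
        using that \<eta> by real_asymp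
      from this[OF bv] show ?thesis unfolding e_def[abs_def] .
    qed
    have en: "0 \<le> e n" for n by (simp add: e_def)
    have "ennreal ((I0 (?k * norm x) - e n) / I0 (?k * (R + \<eta>))) \<le> ?q n" for n
    proof (cases "?q n")
      case (real r)
      have "ennreal (I0 (?k * norm x)) \<le> ennreal (I0 (?k * (R + \<eta>))) * ennreal r + ennreal (e n)"
        using discounted_ge[OF b x v \<eta>, of n] unfolding e_def[symmetric] real(2) .
      also have "\<dots> = ennreal (I0 (?k * (R + \<eta>)) * r + e n)"
        using real(1) en by (simp add: ennreal_mult')
      finally have "I0 (?k * norm x) \<le> I0 (?k * (R + \<eta>)) * r + e n"
        using real(1) en by (subst (asm) ennreal_le_iff) auto
      then have "(I0 (?k * norm x) - e n) / I0 (?k * (R + \<eta>)) \<le> r"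
        by (simp add: pos_divide_le_eq mult.commute)
      then show ?thesis unfolding real(2) by (rule ennreal_leI)
    qed simp
    then have "liminf (\<lambda>n. ennreal ((I0 (?k * norm x) - e n) / I0 (?k * (R + \<eta>)))) \<le> liminf ?q"
      by (intro Liminf_mono always_eventually) simp
    moreover have "(\<lambda>n. ennreal ((I0 (?k * norm x) - e n) / I0 (?k * (R + \<eta>)))) \<longlonglongrightarrow> ennreal ((I0 (?k
        * norm x) - 0) / I0 (?k * (R + \<eta>)))"
      by (intro tendsto_ennrealI tendsto_divide tendsto_diff tendsto_const e0) simp
    ultimately show ?thesis using lim_imp_Liminf[of sequentially] by fastforce
  qed
  have cont: "isCont (\<lambda>\<eta>. I0 (?k * (R + \<eta>))) 0"
  proof -
    have "continuous_on UNIV (\<lambda>\<eta>. I0 (?k * (R + \<eta>)))" by (intro continuous_intros)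
    then show ?thesis by (simp add: continuous_on_eq_continuous_at)
  qed
  have "((\<lambda>\<eta>. ennreal (I0 (?k * norm x) / I0 (?k * (R + \<eta>)))) \<longlongrightarrow> ennreal (I0 (?k * norm x) / I0 (?k
      * (R + 0)))) (at_right 0)"
    using cont by (intro tendsto_ennrealI tendsto_divide tendsto_const)
      (auto simp: isCont_def intro: tendsto_within_subset)
  moreover have "\<forall>\<^sub>F \<eta> in at_right (0::real). ennreal (I0 (?k * norm x) / I0 (?k * (R + \<eta>))) \<le>
      liminf ?q"
    by (rule eventually_at_rightI[of 0 1]) (auto intro: step)
  ultimately have "ennreal (I0 (?k * norm x) / I0 (?k * (R + 0))) \<le> liminf ?q"
    by (rule tendsto_upperbound) simp
  then show ?thesis by simp
qed

text \<open>The weight 2 v exp (- v^2) makes v^2 a standard exponential variable, and 1 / (1 +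
  \<beta> s) is the Laplace transform of that variable.\<close>

lemma nn_integral_mixture:
  assumes "0 \<le> s"
  shows "(\<integral>\<^sup>+v. ennreal (indicator {0..} v * (2 * v * exp (- v\<^sup>2))) * ennreal (exp (- (\<beta> * v\<^sup>2 *
      s))) \<partial>lborel) = ennreal (1 / (1 + \<beta> * s))"
proof -
  have m: "has_bochner_integral lborel (\<lambda>v. 2 * (indicator {0..} v * (exp (- (1 + \<beta> * s) * v\<^sup>2) * v
      ^ (2 * 0 + 1)))) (2 * (fact 0 / (2 * (1 + \<beta> * s) ^ (0 + 1))))"
    by (intro has_bochner_integral_mult_right moment_integral assms)
  have ae: "AE v in lborel. 0 \<le> 2 * (indicator {0..} v * (exp (- (1 + \<beta> * s) * v\<^sup>2) * v ^ (2 * 0 + 1)))"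
    by (intro AE_I2) (simp add: indicator_def)
  have "(\<integral>\<^sup>+v. ennreal (indicator {0..} v * (2 * v * exp (- v\<^sup>2))) * ennreal (exp (- (\<beta> * v\<^sup>2 *
      s))) \<partial>lborel)
    = (\<integral>\<^sup>+v. ennreal (2 * (indicator {0..} v * (exp (- (1 + \<beta> * s) * v\<^sup>2) * v ^ (2 * 0 + 1)))) \<partial>lborel)"
  proof (rule nn_integral_cong)
    fix v :: real
    have "exp (- v\<^sup>2) * exp (- (\<beta> * v\<^sup>2 * s)) = exp (- (1 + \<beta> * s) * v\<^sup>2)"
      unfolding exp_add[symmetric] by (simp add: algebra_simps)
    then show "ennreal (indicator {0..} v * (2 * v * exp (- v\<^sup>2))) * ennreal (exp (- (\<beta> * v\<^sup>2 * s)))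
      = ennreal (2 * (indicator {0..} v * (exp (- (1 + \<beta> * s) * v\<^sup>2) * v ^ (2 * 0 + 1))))"
      by (auto simp: ennreal_mult''[symmetric] indicator_def mult_ac)
  qed
  also have "\<dots> = ennreal (2 * (fact 0 / (2 * (1 + \<beta> * s) ^ (0 + 1))))"
    unfolding nn_integral_eq_integral[OF integrable.intros[OF m] ae]
        has_bochner_integral_integral_eq[OF m] ..
  also have "2 * (fact 0 / (2 * (1 + \<beta> * s) ^ (0 + 1))) = 1 / (1 + \<beta> * s)"
  proof -
    have "2 * (1 / (2 * a)) = 1 / a" for a :: real by simp
    then show ?thesis by (simp only: fact_0 add_0 power_one_right)
  qed
  finally show ?thesis .
qed

text \<open>The hitting index on the grid does not depend on v, so the mixture resums to the
  hyperbolic discount at that grid time. The true exit is no later, and it occurs on the circle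
  because the origin is avoided.\<close>

lemma mixture_discounted_le_gain:
  assumes b: "0 \<le> b" and x: "x \<in> punctured_ball R" and \<omega>: "\<omega> \<in> space M"
    and polar: "\<forall>r\<ge>b. state W1 W2 \<theta> b x r \<omega> \<noteq> 0"
  defines "Y \<equiv> state W1 W2 \<theta> b x"
  shows "(\<integral>\<^sup>+v. ennreal (R\<^sup>2) * (ennreal (indicator {0..} v * (2 * v * exp (- v\<^sup>2))) * discounted b
      x n v \<omega>) \<partial>lborel)
    \<le> gain b Y (exit_time Y (punctured_ball R) b) \<omega>"
proof -
  interpret S: sampled_bm M W1 W2 "\<lambda>j. b + real j * mesh n" "\<lambda>_. \<theta>" x by (rule sampled_grid[OF b \<theta>_pos])
  let ?A = "\<lambda>_::nat. {y :: real \<times> real. R \<le> norm y}"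
  let ?N = "(Suc n)\<^sup>2"
  have xR: "norm x < R" using x by (simp add: punctured_ball_def)
  show ?thesis
  proof (cases "S.hit ?A ?N \<omega>")
    case False
    have "discounted b x n v \<omega> = 0" for v
    proof -
      have "discounted b x n v \<omega> = disc n v ?N (S.X ?N \<omega>)"
        unfolding discounted_def using False by (intro S.stopped_not_hit) (auto simp: S.hit_def)
      moreover have "\<not> R \<le> norm (S.X ?N \<omega>)" using False by (auto simp: S.hit_def)
      ultimately show ?thesis by (simp add: disc_def)
    qed
    then show ?thesis by simp
  next
    case True
    then obtain i where i: "i \<le> ?N" "R \<le> norm (S.X i \<omega>)" "\<And>l. l < i \<Longrightarrow> norm (S.X l \<omega>) < R"
      by (rule S.hit_first) (auto simp: not_le)
    have nh: "\<not> R \<le> norm (S.X m \<omega>)" if "m < i" for m using i(3)[OF that] by simp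
    define s where "s = real i * mesh n"
    have s: "0 \<le> s" by (simp add: s_def)
    have "discounted b x n v \<omega> = ennreal (exp (- (\<beta> * v\<^sup>2 * s)))" for v
    proof -
      have "discounted b x n v \<omega> = disc n v i (S.X i \<omega>)"
        unfolding discounted_def using i(1,2) nh by (auto intro!: S.stopped_first_hit)
      then show ?thesis using i(2) by (simp add: disc_def s_def)
    qed
    then have "(\<integral>\<^sup>+v. ennreal (R\<^sup>2) * (ennreal (indicator {0..} v * (2 * v * exp (- v\<^sup>2))) *
        discounted b x n v \<omega>) \<partial>lborel)
      = ennreal (R\<^sup>2) * ennreal (1 / (1 + \<beta> * s))"
      by (simp add: nn_integral_cmult nn_integral_mixture[OF s])
    also have "\<dots> = ennreal (R\<^sup>2 / (1 + \<beta> * s))" by (simp add: ennreal_mult'[symmetric])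
    also have "\<dots> \<le> gain b Y (exit_time Y (punctured_ball R) b) \<omega>"
    proof -
      have cont: "continuous_on {b..} (\<lambda>r. Y r \<omega>)"
        unfolding Y_def by (rule continuous_on_subset[OF continuous_on_state[OF \<omega>]]) (use b in auto)
      have Ys: "Y (b + s) \<omega> \<notin> punctured_ball R"
        using i(2) X_grid[OF b \<theta>_pos, of n x i \<omega>] by (simp add: Y_def s_def punctured_ball_def)
      have "exit_time Y (punctured_ball R) b \<omega> \<le> ereal (b + s)"
        unfolding exit_time_def using s Ys by (intro INF_lower) auto
      then have fin: "exit_time Y (punctured_ball R) b \<omega> < \<infinity>" by auto
      obtain r where r: "b \<le> r" "exit_time Y (punctured_ball R) b \<omega> = ereal r" "Y r \<omega> \<notin>
          punctured_ball R"
        "\<And>r'. b \<le> r' \<Longrightarrow> r' < r \<Longrightarrow> Y r' \<omega> \<in> punctured_ball R"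
        using exit_time_attained[of b Y \<omega> "punctured_ball R", OF cont open_punctured_ball fin] by blast
      have rs: "r \<le> b + s" using \<open>exit_time Y (punctured_ball R) b \<omega> \<le> ereal (b + s)\<close> r(2) by simp
      have "Y b \<omega> \<in> punctured_ball R" using x by (simp add: Y_def state_def)
      from exit_from_inside(2)[of b Y \<omega> r R, OF cont r(1) r(3) r(4) this]
      have "norm (Y r \<omega>) = R" using polar r(1) by (auto simp: Y_def)
      moreover have "R\<^sup>2 / (1 + \<beta> * s) \<le> R\<^sup>2 / (1 + \<beta> * (r - b))"
        using rs r(1) \<beta>_pos discount_pos[of "r - b"] by (intro divide_left_mono mult_pos_pos
            discount_pos[OF s]) auto
      ultimately show ?thesis using gain_at[of "exit_time Y (punctured_ball R) b" \<omega> r b Y] r(2) by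
          (simp add: ennreal_leI)
    qed
    finally show ?thesis .
  qed
qed

text \<open>The integral over v and the expectation are exchanged at finite n, where the integrand
  is jointly measurable; Fatou's lemma in v then brings in the ratios of I0.\<close>

lemma payoff_ge_H:
  assumes b: "0 \<le> b" and x: "x \<in> punctured_ball R"
  defines "Y \<equiv> state W1 W2 \<theta> b x"
  shows "H 0 (norm x) \<le> (\<integral>\<^sup>+\<omega>. gain b Y (exit_time Y (punctured_ball R) b) \<omega> \<partial>M)"
proof -
  have xR: "norm x < R" "x \<noteq> 0" using x by (auto simp: punctured_ball_def)
  let ?J = "\<integral>\<^sup>+\<omega>. gain b Y (exit_time Y (punctured_ball R) b) \<omega> \<partial>M"
  let ?w = "\<lambda>v. ennreal (indicator {0..} v * (2 * v * exp (- v\<^sup>2)))"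
  let ?q = "\<lambda>n v. \<integral>\<^sup>+\<omega>. discounted b x n v \<omega> \<partial>M"
  note [measurable] = discounted_measurable[OF b] discounted_measurable2[OF b]
  have q_meas [measurable]: "(\<lambda>v. ?q n v) \<in> borel_measurable borel" for n
    by measurable
  have "(\<integral>\<^sup>+v. ennreal (R\<^sup>2) * (?w v * ?q n v) \<partial>lborel) \<le> ?J" for n
  proof -
    have "(\<integral>\<^sup>+v. ennreal (R\<^sup>2) * (?w v * ?q n v) \<partial>lborel) = (\<integral>\<^sup>+v. (\<integral>\<^sup>+\<omega>. ennreal (R\<^sup>2) * (?w v *
        discounted b x n v \<omega>) \<partial>M) \<partial>lborel)"
      by (intro nn_integral_cong) (simp add: nn_integral_cmult)
    also have "\<dots> = (\<integral>\<^sup>+\<omega>. (\<integral>\<^sup>+v. ennreal (R\<^sup>2) * (?w v * discounted b x n v \<omega>) \<partial>lborel) \<partial>M)"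
    proof -
      interpret P: pair_sigma_finite M lborel ..
      have "(\<lambda>z. discounted b x n (snd z) (fst z)) \<in> borel_measurable (M \<Otimes>\<^sub>M borel)"
        using measurable_compose[OF measurable_pair_swap' discounted_measurable[OF b, of x n]] by
            (simp add: case_prod_beta')
      then have "(\<lambda>z. ennreal (R\<^sup>2) * (?w (snd z) * discounted b x n (snd z) (fst z))) \<in>
          borel_measurable (M \<Otimes>\<^sub>M borel)"
        by measurable
      then have "(\<lambda>(\<omega>, v). ennreal (R\<^sup>2) * (?w v * discounted b x n v \<omega>)) \<in> borel_measurable (M \<Otimes>\<^sub>M
          lborel)"
        by (simp add: case_prod_beta' cong: measurable_cong_sets sets_pair_measure_cong)
      then show ?thesis by (rule P.Fubini')
    qed
    also have "\<dots> \<le> ?J"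
    proof (rule nn_integral_mono_AE)
      show "AE \<omega> in M. (\<integral>\<^sup>+v. ennreal (R\<^sup>2) * (?w v * discounted b x n v \<omega>) \<partial>lborel) \<le> gain b Y
          (exit_time Y (punctured_ball R) b) \<omega>"
        using origin_polar[OF b \<theta>_pos xR(2)] AE_space
        by eventually_elim (simp only: Y_def, rule mixture_discounted_le_gain[OF b x])
    qed
    finally show ?thesis .
  qed
  then have "liminf (\<lambda>n. \<integral>\<^sup>+v. ennreal (R\<^sup>2) * (?w v * ?q n v) \<partial>lborel) \<le> ?J"
    by (intro Liminf_le) auto
  moreover have "(\<integral>\<^sup>+v. liminf (\<lambda>n. ennreal (R\<^sup>2) * (?w v * ?q n v)) \<partial>lborel) \<le> liminf (\<lambda>n. \<integral>\<^sup>+v.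
      ennreal (R\<^sup>2) * (?w v * ?q n v) \<partial>lborel)"
    by (rule nn_integral_liminf) measurable
  moreover have "H 0 (norm x) \<le> (\<integral>\<^sup>+v. liminf (\<lambda>n. ennreal (R\<^sup>2) * (?w v * ?q n v)) \<partial>lborel)"
    unfolding H_def
  proof (rule nn_integral_mono)
    fix v :: real
    show "ennreal (Hint 0 (norm x) v) \<le> liminf (\<lambda>n. ennreal (R\<^sup>2) * (?w v * ?q n v))"
    proof (cases "0 < v")
      case True
      have kR: "\<kappa> * v * R = sqrt t * v" unfolding \<kappa>_R[symmetric] by (simp add: mult_ac)
      define c where "c = R\<^sup>2 * (2 * v * exp (- v\<^sup>2))"
      have c: "0 \<le> c" using True by (simp add: c_def)
      have "ennreal (Hint 0 (norm x) v) = ennreal c * ennreal (I0 (\<kappa> * v * norm x) / I0 (\<kappa> * v * R))"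
        unfolding kR using True c by (simp add: Hint_def c_def ennreal_mult'[symmetric] mult_ac)
      also have "\<dots> \<le> ennreal c * liminf (\<lambda>n. ?q n v)"
        by (intro mult_left_mono liminf_discounted_ge[OF b xR(1) True]) auto
      also have "\<dots> = liminf (\<lambda>n. ennreal c * ?q n v)"
        by (rule Liminf_compose_continuous_mono[symmetric])
          (auto intro!: ennreal_continuous_on_cmult continuous_on_id mult_left_mono simp: mono_def)
      also have "(\<lambda>n. ennreal c * ?q n v) = (\<lambda>n. ennreal (R\<^sup>2) * (?w v * ?q n v))"
        using True by (simp add: c_def ennreal_mult' mult_ac)
      finally show ?thesis .
    qed (auto simp: Hint_def indicator_def)
  qed
  ultimately show ?thesis by (meson order_trans)
qed

end

subsection \<open>Equilibrium\<close>

text \<open>Both pay-offs are compared with the same number h, and only a lower bound on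
  \<open>J\<close> is asked for, so a \<open>J\<close> that is a priori infinite does no
  harm.\<close>

lemma limsup_quotient_le:
  fixes P :: "real \<Rightarrow> ennreal" and J :: ennreal
  assumes P: "\<And>\<epsilon>. 0 < \<epsilon> \<Longrightarrow> P \<epsilon> \<le> ennreal (h + \<epsilon> * m \<epsilon>)" and J: "ennreal h \<le> J" and h: "0 \<le> h"
    and m: "\<And>\<epsilon>. 0 < \<epsilon> \<Longrightarrow> 0 \<le> m \<epsilon>" "(m \<longlongrightarrow> 0) (at_right 0)"
  shows "Limsup (at_right 0) (\<lambda>\<epsilon>. ereal (inverse \<epsilon>) * (enn2ereal (P \<epsilon>) - enn2ereal J)) \<le> 0"
proof -
  have "ereal (inverse \<epsilon>) * (enn2ereal (P \<epsilon>) - enn2ereal J) \<le> ereal (m \<epsilon>)" if \<epsilon>: "0 < \<epsilon>" for \<epsilon>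
  proof -
    have "enn2ereal (P \<epsilon>) \<le> enn2ereal (ennreal (h + \<epsilon> * m \<epsilon>))"
      using P[OF \<epsilon>] by (simp add: less_eq_ennreal.rep_eq)
    then have 1: "enn2ereal (P \<epsilon>) \<le> ereal (h + \<epsilon> * m \<epsilon>)"
    proof -
      have "0 \<le> h + \<epsilon> * m \<epsilon>" using h m(1)[OF \<epsilon>] \<epsilon> by simp
      then show ?thesis using \<open>enn2ereal (P \<epsilon>) \<le> enn2ereal (ennreal (h + \<epsilon> * m \<epsilon>))\<close>
        by (simp only: enn2ereal_ennreal)
    qed
    have "enn2ereal (ennreal h) \<le> enn2ereal J" using J by (simp add: less_eq_ennreal.rep_eq)
    then have 2: "ereal h \<le> enn2ereal J" using h by (simp add: enn2ereal_ennreal)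
    have "enn2ereal (P \<epsilon>) - enn2ereal J \<le> ereal (h + \<epsilon> * m \<epsilon>) - ereal h"
      by (rule ereal_minus_mono[OF 1 2])
    then have "ereal (inverse \<epsilon>) * (enn2ereal (P \<epsilon>) - enn2ereal J) \<le> ereal (inverse \<epsilon>) * ereal (\<epsilon> *
        m \<epsilon>)"
      using \<epsilon> by (intro ereal_mult_left_mono) auto
    moreover have "inverse \<epsilon> * (\<epsilon> * m \<epsilon>) = m \<epsilon>" using \<epsilon> by simp
    ultimately show ?thesis by (simp only: times_ereal.simps)
  qed
  then have "\<forall>\<^sub>F \<epsilon> in at_right 0. ereal (inverse \<epsilon>) * (enn2ereal (P \<epsilon>) - enn2ereal J) \<le> ereal (m \<epsilon>)"
    by (intro eventually_at_rightI[of 0 1]) auto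
  then have "Limsup (at_right 0) (\<lambda>\<epsilon>. ereal (inverse \<epsilon>) * (enn2ereal (P \<epsilon>) - enn2ereal J)) \<le> Limsup
      (at_right 0) (\<lambda>\<epsilon>. ereal (m \<epsilon>))"
    by (rule Limsup_mono)
  also have "\<dots> = ereal 0"
    using m(2) by (intro lim_imp_Limsup) auto
  finally show ?thesis by (simp add: zero_ereal_def)
qed

text \<open>Odd powers of u are traded for the second and fourth, whose Gaussian moments are at
  hand, by 2 u \<le> \<delta> + u^2 / \<delta> and 2 u^3 \<le> u^2 + u^4. The choice \<delta> = sqrt
  \<epsilon> will balance the first of these.\<close>

lemma cubic_bound:
  fixes R u \<delta> :: real
  assumes "0 \<le> R" "0 \<le> u" "0 < \<delta>"
  shows "(R + u)\<^sup>2 * u \<le> R\<^sup>2 * \<delta> + (R\<^sup>2 / \<delta> + 1) * u\<^sup>2 + u ^ 4"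
proof -
  have "0 \<le> (\<delta> - u)\<^sup>2 / \<delta>" using assms by simp
  also have "\<dots> = \<delta> - 2 * u + u\<^sup>2 / \<delta>" using assms by (simp add: field_simps power2_eq_square)
  finally have 1: "R\<^sup>2 * (2 * u) \<le> R\<^sup>2 * (\<delta> + u\<^sup>2 / \<delta>)" by (intro mult_left_mono) auto
  have "0 \<le> u\<^sup>2 * (1 - u)\<^sup>2" by simp
  then have 2: "2 * u ^ 3 \<le> u\<^sup>2 + u ^ 4" by (simp add: power2_eq_square power3_eq_cube
      power4_eq_xxxx algebra_simps)
  have "(R + u)\<^sup>2 \<le> 2 * R\<^sup>2 + 2 * u\<^sup>2" using zero_le_power2[of "R - u"] by (simp add: power2_sum
      power2_diff)
  then have "(R + u)\<^sup>2 * u \<le> (2 * R\<^sup>2 + 2 * u\<^sup>2) * u" using assms by (intro mult_right_mono) auto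
  also have "\<dots> = R\<^sup>2 * (2 * u) + 2 * u ^ 3" by (simp add: power2_eq_square power3_eq_cube algebra_simps)
  also have "\<dots> \<le> R\<^sup>2 * (\<delta> + u\<^sup>2 / \<delta>) + (u\<^sup>2 + u ^ 4)" using 1 2 by (rule add_mono)
  finally show ?thesis by (simp add: algebra_simps)
qed

section \<open>Error terms that are negligible against \<epsilon>\<close>

context equilibrium_problem
begin

text \<open>As |x| \<le> R, the overshoot beyond R is at most |d|, so the excess is at most a
  multiple of \<epsilon> (R + |d|)^2 |d|. Since |d| has the size of sqrt \<epsilon>, the factor
  beside \<epsilon> tends to 0, even for x on the circle.\<close>

lemma excess_integral_le:
  assumes x: "norm x \<le> R" and \<epsilon>: "0 < \<epsilon>" and \<theta>': "0 < \<theta>'"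
  shows "(\<integral>\<^sup>+d. excess \<epsilon> (x + d) \<partial>gauss2 (\<theta>' * sqrt \<epsilon>)) \<le>
    ennreal (\<epsilon> * (\<beta> * t / R * (R\<^sup>2 * sqrt \<epsilon> + (R\<^sup>2 / sqrt \<epsilon> + 1) * (2 * (\<theta>' * sqrt \<epsilon>)\<^sup>2) + 12 * (\<theta>'
        * sqrt \<epsilon>) ^ 4)))"
proof -
  let ?s = "\<theta>' * sqrt \<epsilon>"
  have s: "0 < ?s" using \<theta>' \<epsilon> by simp
  interpret G: prob_space "gauss2 ?s" by (rule prob_space_gauss2[OF s])
  define K where "K = \<beta> * \<epsilon> * t / R"
  have K: "0 \<le> K" using \<beta>_pos \<epsilon> t_pos R_pos by (simp add: K_def)
  define c where "c = K * (R\<^sup>2 / sqrt \<epsilon> + 1)"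
  have c: "0 \<le> c" using K \<epsilon> by (simp add: c_def)
  have "excess \<epsilon> (x + d) \<le> ennreal (K * (R\<^sup>2 * sqrt \<epsilon>)) + (ennreal c * ennreal ((norm d)\<^sup>2) +
      ennreal K * ennreal ((norm d) ^ 4))" for d
  proof -
    let ?r = "norm (x + d)" and ?u = "norm d"
    have ru: "?r \<le> R + ?u" using norm_triangle_ineq[of x d] x by linarith
    have "?r\<^sup>2 * (?r / R - 1) \<le> (R + ?u)\<^sup>2 * ?u / R"
    proof (cases "?r \<le> R")
      case True
      then have "?r\<^sup>2 * (?r / R - 1) \<le> 0" using R_pos by (intro mult_nonneg_nonpos) auto
      also have "0 \<le> (R + ?u)\<^sup>2 * ?u / R" using R_pos by simp
      finally show ?thesis .
    next
      case False
      have "?r\<^sup>2 * (?r / R - 1) \<le> (R + ?u)\<^sup>2 * (?u / R)"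
      proof -
        have "?r / R \<le> (R + ?u) / R" using ru R_pos by (intro divide_right_mono) auto
        then have "?r / R - 1 \<le> ?u / R" using R_pos by (simp add: add_divide_distrib)
        then show ?thesis using ru False R_pos by (intro mult_mono power_mono) auto
      qed
      then show ?thesis by simp
    qed
    then have "\<beta> * \<epsilon> * t * (?r\<^sup>2 * (?r / R - 1)) \<le> \<beta> * \<epsilon> * t * ((R + ?u)\<^sup>2 * ?u / R)"
      using \<beta>_pos \<epsilon> t_pos by (intro mult_left_mono) auto
    also have "\<dots> = K * ((R + ?u)\<^sup>2 * ?u)" by (simp add: K_def)
    also have "\<dots> \<le> K * (R\<^sup>2 * sqrt \<epsilon> + (R\<^sup>2 / sqrt \<epsilon> + 1) * ?u\<^sup>2 + ?u ^ 4)"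
      using K R_pos \<epsilon> by (intro mult_left_mono cubic_bound) auto
    also have "\<dots> = K * (R\<^sup>2 * sqrt \<epsilon>) + (c * ?u\<^sup>2 + K * ?u ^ 4)" by (simp add: c_def algebra_simps)
    finally have "excess \<epsilon> (x + d) \<le> ennreal (K * (R\<^sup>2 * sqrt \<epsilon>) + (c * ?u\<^sup>2 + K * ?u ^ 4))"
      unfolding excess_def by (rule ennreal_leI)
    also have "\<dots> = ennreal (K * (R\<^sup>2 * sqrt \<epsilon>)) + (ennreal c * ennreal (?u\<^sup>2) + ennreal K * ennreal
        (?u ^ 4))"
      using K c \<epsilon> by (simp add: ennreal_mult')
    finally show ?thesis .
  qed
  then have "(\<integral>\<^sup>+d. excess \<epsilon> (x + d) \<partial>gauss2 ?s) \<le> (\<integral>\<^sup>+d. ennreal (K * (R\<^sup>2 * sqrt \<epsilon>)) + (ennreal c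
      * ennreal ((norm d)\<^sup>2) + ennreal K * ennreal ((norm d) ^ 4)) \<partial>gauss2 ?s)"
    by (intro nn_integral_mono)
  also have "\<dots> = ennreal (K * (R\<^sup>2 * sqrt \<epsilon>)) + (ennreal c * (\<integral>\<^sup>+d. ennreal ((norm d)\<^sup>2) \<partial>gauss2
      ?s) + ennreal K * (\<integral>\<^sup>+d. ennreal ((norm d) ^ 4) \<partial>gauss2 ?s))"
    by (simp add: nn_integral_add nn_integral_cmult G.emeasure_space_1[simplified])
  also have "\<dots> \<le> ennreal (K * (R\<^sup>2 * sqrt \<epsilon>)) + (ennreal c * ennreal (2 * ?s\<^sup>2) + ennreal K *
      ennreal (12 * ?s ^ 4))"
    using gauss2_norm2[OF s] gauss2_norm4[OF s] by (intro add_mono mult_left_mono) auto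
  also have "\<dots> = ennreal (K * (R\<^sup>2 * sqrt \<epsilon>) + (c * (2 * ?s\<^sup>2) + K * (12 * ?s ^ 4)))"
    using K c \<epsilon> by (simp add: ennreal_mult'[symmetric] ennreal_plus[symmetric] del: ennreal_plus)
  also have "K * (R\<^sup>2 * sqrt \<epsilon>) + (c * (2 * ?s\<^sup>2) + K * (12 * ?s ^ 4)) =
     \<epsilon> * (\<beta> * t / R * (R\<^sup>2 * sqrt \<epsilon> + (R\<^sup>2 / sqrt \<epsilon> + 1) * (2 * ?s\<^sup>2) + 12 * ?s ^ 4))"
  proof -
    have "K = \<epsilon> * (\<beta> * t / R)" by (simp add: K_def)
    then show ?thesis unfolding c_def by (simp only: distrib_left distrib_right mult.assoc add.assoc)
  qed
  finally show ?thesis .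
qed

text \<open>The auxiliary radius \<rho> R of \<open>gain_le\<close> tends to R, which sends 1 / c to
  1. The set \<open>S\<close> is meant to collect the paths that may leave the ball during the
  perturbation interval.\<close>

lemma integral_gain_le:
  fixes x :: "real \<times> real"
  assumes b: "0 \<le> b" and \<epsilon>: "0 < \<epsilon>" and \<theta>': "0 < \<theta>'" "\<theta>' \<le> \<theta>" and x: "norm x \<le> R"
    and S: "S \<in> sets M"
  defines "Y \<equiv> perturbed_state W1 W2 \<theta> \<epsilon> \<theta>' b x"
  assumes g: "\<And>\<omega>. \<omega> \<in> space M \<Longrightarrow> g \<omega> \<le> gain b Y (exit_time Y (punctured_ball R) (b + \<epsilon>)) \<omega> + ennreal
      (R\<^sup>2) * indicator S \<omega>"
  shows "(\<integral>\<^sup>+\<omega>. g \<omega> \<partial>M) \<le> H 0 (norm x) + (\<integral>\<^sup>+d. excess \<epsilon> (x + d) \<partial>gauss2 (\<theta>' * sqrt \<epsilon>)) + ennreal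
      (R\<^sup>2) * emeasure M S"
proof -
  let ?E = "\<integral>\<^sup>+d. excess \<epsilon> (x + d) \<partial>gauss2 (\<theta>' * sqrt \<epsilon>)"
  let ?c = "\<lambda>\<rho>. \<rho>\<^sup>2 * (1 + t / 2 * ln \<rho>)"
  have c_lim: "(?c \<longlongrightarrow> 1\<^sup>2 * (1 + t / 2 * ln 1)) (at_left 1)"
    by (intro tendsto_intros) auto
  then have "\<forall>\<^sub>F \<rho> in at_left 1. 0 < ?c \<rho>"
    by (rule order_tendstoD) simp
  moreover have "\<forall>\<^sub>F \<rho> in at_left (1::real). \<rho> \<in> {0<..<1}"
    by (rule eventually_at_leftI[of 0]) auto
  ultimately have ev: "\<forall>\<^sub>F \<rho> in at_left 1. (\<integral>\<^sup>+\<omega>. g \<omega> \<partial>M) \<le> ennreal (1 / ?c \<rho>) * H 0 (norm x) + ?E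
      + ennreal (R\<^sup>2) * emeasure M S"
  proof eventually_elim
    case (elim \<rho>)
    then have \<rho>: "0 < \<rho>" "\<rho> < 1" by auto
    obtain F where F: "F \<in> borel_measurable M"
      "\<And>\<omega>. \<omega> \<in> space M \<Longrightarrow> gain b Y (exit_time Y (punctured_ball R) (b + \<epsilon>)) \<omega> \<le> F \<omega>"
      "(\<integral>\<^sup>+\<omega>. F \<omega> \<partial>M) \<le> ennreal (1 / ?c \<rho>) * H 0 (norm x) + ?E"
      using gain_le[OF b \<epsilon> \<theta>' \<rho> refl elim(1), of x] unfolding Y_def by blast
    have "(\<integral>\<^sup>+\<omega>. g \<omega> \<partial>M) \<le> (\<integral>\<^sup>+\<omega>. F \<omega> + ennreal (R\<^sup>2) * indicator S \<omega> \<partial>M)"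
    proof (rule nn_integral_mono)
      fix \<omega> assume "\<omega> \<in> space M"
      from order_trans[OF g[OF this] add_right_mono[OF F(2)[OF this]]]
      show "g \<omega> \<le> F \<omega> + ennreal (R\<^sup>2) * indicator S \<omega>" .
    qed
    also have "\<dots> = (\<integral>\<^sup>+\<omega>. F \<omega> \<partial>M) + ennreal (R\<^sup>2) * emeasure M S"
      using S F(1) by (simp add: nn_integral_add nn_integral_cmult_indicator)
    also have "\<dots> \<le> ennreal (1 / ?c \<rho>) * H 0 (norm x) + ?E + ennreal (R\<^sup>2) * emeasure M S"
      using F(3) by (rule add_right_mono)
    finally show ?case .
  qed
  have Hfin: "H 0 (norm x) \<noteq> \<top>" using H_0_le[of "norm x"] x by (auto simp: top_unique)
  have "((\<lambda>\<rho>. ennreal (1 / ?c \<rho>)) \<longlongrightarrow> ennreal (1 / (1\<^sup>2 * (1 + t / 2 * ln 1)))) (at_left 1)"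
    by (intro tendsto_ennrealI tendsto_divide c_lim tendsto_const) simp
  then have "((\<lambda>\<rho>. ennreal (1 / ?c \<rho>) * H 0 (norm x) + ?E + ennreal (R\<^sup>2) * emeasure M S) \<longlongrightarrow>
     ennreal (1 / (1\<^sup>2 * (1 + t / 2 * ln 1))) * H 0 (norm x) + ?E + ennreal (R\<^sup>2) * emeasure M S)
         (at_left 1)"
    using Hfin by (intro tendsto_add tendsto_const tendsto_mult_ennreal) auto
  from tendsto_lowerbound[OF this ev] show ?thesis by simp
qed

section \<open>The pay-off of the unperturbed strategy\<close>

lemma gain_outside:
  assumes "x \<notin> punctured_ball R"
  shows "gain b (state W1 W2 \<theta> b x) (exit_time (state W1 W2 \<theta> b x) (punctured_ball R) b) \<omega> =
      ennreal ((norm x)\<^sup>2)"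
proof -
  have "exit_time (state W1 W2 \<theta> b x) (punctured_ball R) b \<omega> = ereal b"
    by (rule exit_time_eq) (use assms in \<open>auto simp: state_def\<close>)
  from gain_at[of "exit_time (state W1 W2 \<theta> b x) (punctured_ball R) b", OF this] show ?thesis by
      (simp add: state_def)
qed

abbreviation J :: "real \<Rightarrow> real \<times> real \<Rightarrow> ennreal" where
  "J b x \<equiv> \<integral>\<^sup>+\<omega>. gain b (state W1 W2 \<theta> b x) (exit_time (state W1 W2 \<theta> b x) (punctured_ball R) b) \<omega> \<partial>M"

lemma J_outside: "x \<notin> punctured_ball R \<Longrightarrow> J b x = ennreal ((norm x)\<^sup>2)"
  by (simp add: gain_outside emeasure_space_1)

text \<open>On the circle itself the process stops at once and pays R^2, which \<open>H 0 R\<close>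
  does not exceed. The circle is included because later stopping is tested there too.\<close>

lemma J_ge_H:
  assumes "0 \<le> b" "x \<noteq> 0" "norm x \<le> R"
  shows "H 0 (norm x) \<le> J b x"
proof (cases "x \<in> punctured_ball R")
  case True then show ?thesis by (rule payoff_ge_H[OF assms(1)])
next
  case False
  then have "norm x = R" using assms by (auto simp: punctured_ball_def)
  then show ?thesis using H_0_le[of R] R_pos by (simp add: J_outside[OF False])
qed

lemma J_ge_norm2:
  assumes "0 \<le> b" "x \<noteq> 0"
  shows "ennreal ((norm x)\<^sup>2) \<le> J b x"
proof (cases "x \<in> punctured_ball R")
  case True
  have "ennreal ((norm x)\<^sup>2) \<le> H 0 (norm x)" using assms by (intro H_0_ge) auto
  also have "\<dots> \<le> J b x" using True assms by (intro J_ge_H) (auto simp: punctured_ball_def)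
  finally show ?thesis .
qed (simp add: J_outside)

text \<open>Makes later stopping the special case \<theta>' = \<theta> of a perturbation, so that
  one bound serves both equilibrium conditions on the ball.\<close>

lemma perturbed_state_same: "0 \<le> \<epsilon> \<Longrightarrow> perturbed_state W1 W2 \<theta> \<epsilon> \<theta> b x = state W1 W2 \<theta> b x"
  by (intro ext) (simp add: perturbed_state_def state_def algebra_simps)

definition rate :: "real \<Rightarrow> real \<Rightarrow> real" where
  "rate \<theta>' \<epsilon> = \<beta> * t / R * (R\<^sup>2 * sqrt \<epsilon> + (R\<^sup>2 / sqrt \<epsilon> + 1) * (2 * (\<theta>' * sqrt \<epsilon>)\<^sup>2) + 12 * (\<theta>' *
      sqrt \<epsilon>) ^ 4)"

lemma rate_nonneg: "0 < \<epsilon> \<Longrightarrow> 0 \<le> rate \<theta>' \<epsilon>"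
  using \<beta>_pos t_pos R_pos by (simp add: rate_def)

lemma rate_tendsto: "(rate \<theta>' \<longlongrightarrow> 0) (at_right 0)"
proof -
  have "((\<lambda>\<epsilon>. k * (c * sqrt \<epsilon> + (c / sqrt \<epsilon> + 1) * (2 * (\<theta>' * sqrt \<epsilon>)\<^sup>2) + 12 * (\<theta>' * sqrt \<epsilon>) ^ 4))
      \<longlongrightarrow> 0) (at_right 0)" for k c :: real
  proof -
    have "((\<lambda>\<epsilon>. k * (c * sqrt \<epsilon> + (c * sqrt \<epsilon> + \<epsilon>) * (2 * \<theta>'\<^sup>2) + 12 * \<theta>' ^ 4 * \<epsilon>\<^sup>2)) \<longlongrightarrow>
        k * (c * sqrt 0 + (c * sqrt 0 + 0) * (2 * \<theta>'\<^sup>2) + 12 * \<theta>' ^ 4 * 0\<^sup>2)) (at_right 0)"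
      by (intro tendsto_intros)
    moreover have "\<forall>\<^sub>F \<epsilon> in at_right 0. k * (c * sqrt \<epsilon> + (c * sqrt \<epsilon> + \<epsilon>) * (2 * \<theta>'\<^sup>2) + 12 * \<theta>' ^
        4 * \<epsilon>\<^sup>2) =
       k * (c * sqrt \<epsilon> + (c / sqrt \<epsilon> + 1) * (2 * (\<theta>' * sqrt \<epsilon>)\<^sup>2) + 12 * (\<theta>' * sqrt \<epsilon>) ^ 4)"
    proof (rule eventually_at_rightI[of 0 1])
      fix \<epsilon> :: real assume "\<epsilon> \<in> {0<..<1}"
      then have \<epsilon>: "0 < \<epsilon>" by simp
      have 1: "(c / sqrt \<epsilon> + 1) * (2 * (\<theta>' * sqrt \<epsilon>)\<^sup>2) = (c * sqrt \<epsilon> + \<epsilon>) * (2 * \<theta>'\<^sup>2)"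
      proof -
        have "(c / sqrt \<epsilon> + 1) * (2 * (\<theta>' * sqrt \<epsilon>)\<^sup>2) = (c / sqrt \<epsilon> * (sqrt \<epsilon> * sqrt \<epsilon>) + sqrt \<epsilon> *
            sqrt \<epsilon>) * (2 * \<theta>'\<^sup>2)"
          by (simp only: power2_eq_square distrib_left distrib_right mult_ac mult_1_left mult_1_right)
        also have "c / sqrt \<epsilon> * (sqrt \<epsilon> * sqrt \<epsilon>) = c * sqrt \<epsilon>"
        proof -
          have "c / z * (z * z) = c * z" if "z \<noteq> 0" for z using that by simp
          from this[of "sqrt \<epsilon>"] show ?thesis using \<epsilon> by (metis less_irrefl real_sqrt_gt_zero)
        qed
        finally show ?thesis using \<epsilon> by simp
      qed
      have "(sqrt \<epsilon>) ^ 4 = ((sqrt \<epsilon>)\<^sup>2)\<^sup>2" by (simp only: power_mult[symmetric]) simp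
      then have 2: "(\<theta>' * sqrt \<epsilon>) ^ 4 = \<theta>' ^ 4 * \<epsilon>\<^sup>2" using \<epsilon> by (simp add: power_mult_distrib)
      show "k * (c * sqrt \<epsilon> + (c * sqrt \<epsilon> + \<epsilon>) * (2 * \<theta>'\<^sup>2) + 12 * \<theta>' ^ 4 * \<epsilon>\<^sup>2) =
       k * (c * sqrt \<epsilon> + (c / sqrt \<epsilon> + 1) * (2 * (\<theta>' * sqrt \<epsilon>)\<^sup>2) + 12 * (\<theta>' * sqrt \<epsilon>) ^ 4)"
        unfolding 1 2 by simp
    qed simp
    ultimately show ?thesis by (simp add: filterlim_cong tendsto_cong)
  qed
  then show ?thesis unfolding rate_def[abs_def] by blast
qed

lemma H_real:
  assumes "norm x \<le> R"
  obtains h where "0 \<le> h" "H 0 (norm x) = ennreal h"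
proof -
  have "H 0 (norm x) < \<top>" using H_0_le[of "norm x"] assms by (auto simp: less_top[symmetric] top_unique)
  then show thesis using that by (cases "H 0 (norm x)") auto
qed

text \<open>Exits before b + \<epsilon> are ignored by the later stopping rule, so the exceptional
  set is empty and a start on the circle is allowed.\<close>

lemma later_stopping_inside:
  assumes b: "0 \<le> b" and x: "x \<noteq> 0" "norm x \<le> R"
  shows "Limsup (at_right 0) (\<lambda>\<epsilon>. ereal (inverse \<epsilon>) *
     (payoff M \<beta> b (state W1 W2 \<theta> b x) (exit_time (state W1 W2 \<theta> b x) (punctured_ball R) (b + \<epsilon>)) -
         enn2ereal (J b x))) \<le> 0"
proof -
  obtain h where h: "0 \<le> h" "H 0 (norm x) = ennreal h" using H_real[OF x(2)] .
  show ?thesis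
    unfolding payoff_gain
  proof (rule limsup_quotient_le[OF _ _ h(1) rate_nonneg rate_tendsto])
    show "ennreal h \<le> J b x" using J_ge_H[OF b x] by (simp add: h)
    fix \<epsilon> :: real assume \<epsilon>: "0 < \<epsilon>"
    let ?X = "state W1 W2 \<theta> b x"
    have "(\<integral>\<^sup>+\<omega>. gain b ?X (exit_time ?X (punctured_ball R) (b + \<epsilon>)) \<omega> \<partial>M) \<le>
      H 0 (norm x) + (\<integral>\<^sup>+d. excess \<epsilon> (x + d) \<partial>gauss2 (\<theta> * sqrt \<epsilon>)) + ennreal (R\<^sup>2) * emeasure M {}"
      using \<epsilon> by (intro integral_gain_le[OF b \<epsilon> \<theta>_pos order_refl x(2)]) (auto simp:
          perturbed_state_same)
    also have "\<dots> \<le> ennreal h + ennreal (\<epsilon> * rate \<theta> \<epsilon>) + 0"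
      unfolding h(2) rate_def using excess_integral_le[OF x(2) \<epsilon> \<theta>_pos] by (intro add_mono) auto
    also have "\<dots> = ennreal (h + \<epsilon> * rate \<theta> \<epsilon>)" using h(1) \<epsilon> rate_nonneg[OF \<epsilon>] by simp
    finally show "(\<integral>\<^sup>+\<omega>. gain b ?X (exit_time ?X (punctured_ball R) (b + \<epsilon>)) \<omega> \<partial>M) \<le> ennreal (h + \<epsilon>
        * rate \<theta> \<epsilon>)" .
  qed
qed

text \<open>The exit may now fall into the perturbation interval, where \<open>gain_le\<close> says
  nothing. For a start at positive distance from the boundary this has probability of order
  \<epsilon>^2, and the gain is then at most R^2.\<close>

lemma perturbed_control:
  assumes b: "0 \<le> b" and x: "x \<in> punctured_ball R" and \<theta>': "0 < \<theta>'" "\<theta>' \<le> \<theta>"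
  shows "Limsup (at_right 0) (\<lambda>\<epsilon>. ereal (inverse \<epsilon>) *
     (payoff M \<beta> b (perturbed_state W1 W2 \<theta> \<epsilon> \<theta>' b x) (exit_time (perturbed_state W1 W2 \<theta> \<epsilon> \<theta>' b x)
         (punctured_ball R) b) - enn2ereal (J b x))) \<le> 0"
proof -
  have xR: "x \<noteq> 0" "norm x < R" "norm x \<le> R" using x by (auto simp: punctured_ball_def)
  obtain h where h: "0 \<le> h" "H 0 (norm x) = ennreal h" using H_real[OF xR(3)] .
  \<comment> \<open>Distance from x to the complement of the ball: to the origin or to the
    circle.\<close>
  define d where "d = min (norm x) (R - norm x)"
  have d: "0 < d" using xR by (simp add: d_def)
  define K where "K = 1024 * exp (\<theta>'\<^sup>2) / d ^ 4"
  have K: "0 \<le> K" using d by (simp add: K_def)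
  define m where "m \<epsilon> = rate \<theta>' \<epsilon> + R\<^sup>2 * K * \<epsilon>" for \<epsilon>
  have m: "0 \<le> m \<epsilon>" if "0 < \<epsilon>" for \<epsilon> using rate_nonneg[OF that] K that by (simp add: m_def)
  have "((\<lambda>\<epsilon>. rate \<theta>' \<epsilon> + R\<^sup>2 * K * \<epsilon>) \<longlongrightarrow> 0 + R\<^sup>2 * K * 0) (at_right 0)"
    by (intro tendsto_intros rate_tendsto)
  then have m0: "(m \<longlongrightarrow> 0) (at_right 0)" by (simp add: m_def[abs_def])
  show ?thesis
    unfolding payoff_gain
  proof (rule limsup_quotient_le[OF _ _ h(1) m m0])
    show "ennreal h \<le> J b x" using J_ge_H[OF b xR(1,3)] by (simp add: h)
    fix \<epsilon> :: real assume \<epsilon>: "0 < \<epsilon>"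
    let ?Y = "perturbed_state W1 W2 \<theta> \<epsilon> \<theta>' b x"
    let ?C = "punctured_ball R"
    obtain S where S: "S \<in> sets M" "emeasure M S \<le> ennreal (K * \<epsilon>\<^sup>2)"
      "{\<omega>\<in>space M. \<exists>r\<in>{b..b + \<epsilon>}. d \<le> norm (state W1 W2 \<theta>' b 0 r \<omega>)} \<subseteq> S"
      unfolding K_def by (rule early_exit_bound[OF b \<theta>'(1) \<epsilon> d])
    have pt: "gain b ?Y (exit_time ?Y ?C b) \<omega> \<le> gain b ?Y (exit_time ?Y ?C (b + \<epsilon>)) \<omega> + ennreal
        (R\<^sup>2) * indicator S \<omega>"
      if \<omega>: "\<omega> \<in> space M" for \<omega>
    proof (cases "\<omega> \<in> S")
      case True
      have "gain b ?Y (exit_time ?Y ?C b) \<omega> \<le> ennreal (R\<^sup>2)"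
      proof (cases "exit_time ?Y ?C b \<omega> < \<infinity>")
        case True
        have cont: "continuous_on {b..} (\<lambda>r. ?Y r \<omega>)" using \<epsilon> by (intro
            continuous_on_perturbed_state[OF \<omega> b]) simp
        obtain r where r: "b \<le> r" "exit_time ?Y ?C b \<omega> = ereal r" "?Y r \<omega> \<notin> ?C"
          "\<And>r'. b \<le> r' \<Longrightarrow> r' < r \<Longrightarrow> ?Y r' \<omega> \<in> ?C"
          using exit_time_attained[of b ?Y \<omega> ?C, OF cont open_punctured_ball True] by blast
        have "?Y b \<omega> \<in> ?C" using x \<epsilon> by (simp add: perturbed_state_def state_def)
        from exit_from_inside(2)[of b ?Y \<omega> r R, OF cont r(1) r(3) r(4) this]
        have nY: "norm (?Y r \<omega>) \<le> R" using R_pos by auto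
        have "(norm (?Y r \<omega>))\<^sup>2 / (1 + \<beta> * (r - b)) \<le> R\<^sup>2 / 1"
          using nY r(1) \<beta>_pos by (intro frac_le power_mono) auto
        then show ?thesis using gain_at[of "exit_time ?Y ?C b" \<omega> r b ?Y] r(2) by (simp add: ennreal_leI)
      qed (simp add: gain_def)
      then show ?thesis using True by (simp add: add_increasing)
    next
      case False
      have "?Y r \<omega> \<in> ?C" if r: "b \<le> r" "r < b + \<epsilon>" for r
      proof -
        have "norm (state W1 W2 \<theta>' b 0 r \<omega>) < d" using False S(3) \<omega> r by (force simp: not_le)
        then have "norm (state W1 W2 \<theta>' b 0 r \<omega>) < norm x" "norm (state W1 W2 \<theta>' b 0 r \<omega>) < R - norm x"
          by (auto simp: d_def)
        moreover have "?Y r \<omega> = x + state W1 W2 \<theta>' b 0 r \<omega>"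
          using r by (simp add: perturbed_state_def state_def prod_eq_iff)
        ultimately show ?thesis
          using norm_triangle_ineq[of x "state W1 W2 \<theta>' b 0 r \<omega>"] norm_diff_ineq[of x "state W1 W2
              \<theta>' b 0 r \<omega>"]
          unfolding punctured_ball_def mem_Collect_eq by (simp del: zero_less_norm_iff)
      qed
      then have "{r. b \<le> r \<and> ?Y r \<omega> \<notin> ?C} = {r. b + \<epsilon> \<le> r \<and> ?Y r \<omega> \<notin> ?C}"
        using \<epsilon> by (force simp: not_le[symmetric])
      then have "exit_time ?Y ?C b \<omega> = exit_time ?Y ?C (b + \<epsilon>) \<omega>" by (simp add: exit_time_def)
      then show ?thesis by (simp add: gain_def)
    qed
    have "(\<integral>\<^sup>+\<omega>. gain b ?Y (exit_time ?Y ?C b) \<omega> \<partial>M) \<le>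
      H 0 (norm x) + (\<integral>\<^sup>+d. excess \<epsilon> (x + d) \<partial>gauss2 (\<theta>' * sqrt \<epsilon>)) + ennreal (R\<^sup>2) * emeasure M S"
      by (rule integral_gain_le[OF b \<epsilon> \<theta>' xR(3) S(1) pt])
    also have "\<dots> \<le> ennreal h + ennreal (\<epsilon> * rate \<theta>' \<epsilon>) + ennreal (R\<^sup>2) * ennreal (K * \<epsilon>\<^sup>2)"
      unfolding h(2) rate_def using excess_integral_le[OF xR(3) \<epsilon> \<theta>'(1)] S(2) by (intro add_mono
          mult_left_mono) auto
    also have "\<dots> = ennreal (h + \<epsilon> * m \<epsilon>)"
      using h(1) \<epsilon> rate_nonneg[OF \<epsilon>, of \<theta>'] K
      by (simp add: m_def ennreal_mult'[symmetric] ennreal_plus[symmetric] power2_eq_square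
          algebra_simps del: ennreal_plus)
    finally show "(\<integral>\<^sup>+\<omega>. gain b ?Y (exit_time ?Y ?C b) \<omega> \<partial>M) \<le> ennreal (h + \<epsilon> * m \<epsilon>)" .
  qed
qed

text \<open>Since \<open>t\<^sup>* \<ge> 4\<close>, outside the ball the drift \<open>2 * \<theta>\<^sup>2\<close> of the squared norm does not compensate
  the discounting.\<close>

lemma later_stopping_outside:
  assumes b: "0 \<le> b" and x: "R < norm x"
  shows "Limsup (at_right 0) (\<lambda>\<epsilon>. ereal (inverse \<epsilon>) *
     (payoff M \<beta> b (state W1 W2 \<theta> b x) (exit_time (state W1 W2 \<theta> b x) (punctured_ball R) (b + \<epsilon>)) -
         enn2ereal (J b x))) \<le> 0"
proof -
  let ?X = "state W1 W2 \<theta> b x"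
  let ?C = "punctured_ball R"
  \<comment> \<open>From this start the process continues after b + \<epsilon> only if it has moved
    by at least a.\<close>
  define a where "a = norm x - R"
  have a: "0 < a" using x by (simp add: a_def)
  define m where "m \<epsilon> = R\<^sup>2 / a ^ 4 * (12 * \<theta> ^ 4) * \<epsilon>" for \<epsilon>
  have xC: "x \<notin> ?C" using x by (simp add: punctured_ball_def)
  have "((\<lambda>\<epsilon>. R\<^sup>2 / a ^ 4 * (12 * \<theta> ^ 4) * \<epsilon>) \<longlongrightarrow> R\<^sup>2 / a ^ 4 * (12 * \<theta> ^ 4) * 0) (at_right 0)"
    by (intro tendsto_intros)
  then have m0: "(m \<longlongrightarrow> 0) (at_right 0)" by (simp add: m_def[abs_def])
  show ?thesis
    unfolding payoff_gain
  proof (rule limsup_quotient_le[where h = "(norm x)\<^sup>2", OF _ _ _ _ m0])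
    show "ennreal ((norm x)\<^sup>2) \<le> J b x" by (simp add: J_outside[OF xC])
    show "0 \<le> m \<epsilon>" if "0 < \<epsilon>" for \<epsilon> using that a by (simp add: m_def)
    fix \<epsilon> :: real assume \<epsilon>: "0 < \<epsilon>"
    define Z where "Z \<omega> = perturbed_state W1 W2 \<theta> \<epsilon> \<theta> b x (b + \<epsilon>) \<omega>" for \<omega>
    have Z: "Z \<omega> = ?X (b + \<epsilon>) \<omega>" for \<omega> using \<epsilon> by (simp add: Z_def perturbed_state_same)
    have s: "0 < \<theta> * sqrt \<epsilon>" using \<epsilon> \<theta>_pos by simp
    \<comment> \<open>The first term is a fourth-power Chebyshev majorant for that event, where the
      gain is at most R^2; the second is the reward for stopping at b + \<epsilon>.\<close>
    define G where "G y = ennreal (R\<^sup>2 / a ^ 4) * ennreal ((norm (y - x)) ^ 4) + ennreal (1 / (1 +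
        \<beta> * \<epsilon>)) * ennreal ((norm y)\<^sup>2)" for y :: "real \<times> real"
    have p: "0 < 1 + \<beta> * \<epsilon>" using discount_pos[of \<epsilon>] \<epsilon> by simp
    have pt: "gain b ?X (exit_time ?X ?C (b + \<epsilon>)) \<omega> \<le> G (Z \<omega>)" if \<omega>: "\<omega> \<in> space M" for \<omega>
    proof (cases "exit_time ?X ?C (b + \<epsilon>) \<omega> < \<infinity>")
      case True
      have cont: "continuous_on {b + \<epsilon>..} (\<lambda>r. ?X r \<omega>)"
        by (rule continuous_on_subset[OF continuous_on_state[OF \<omega>]]) (use b \<epsilon> in auto)
      obtain r where r: "b + \<epsilon> \<le> r" "exit_time ?X ?C (b + \<epsilon>) \<omega> = ereal r" "?X r \<omega> \<notin> ?C"
        "\<And>r'. b + \<epsilon> \<le> r' \<Longrightarrow> r' < r \<Longrightarrow> ?X r' \<omega> \<in> ?C"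
        using exit_time_attained[of "b + \<epsilon>" ?X \<omega> ?C, OF cont open_punctured_ball True] by blast
      have gain: "gain b ?X (exit_time ?X ?C (b + \<epsilon>)) \<omega> = ennreal ((norm (?X r \<omega>))\<^sup>2 / (1 + \<beta> * (r
          - b)))"
        using r(2) by (rule gain_at)
      show ?thesis
      proof (cases "?X (b + \<epsilon>) \<omega> \<in> ?C")
        case True
        from exit_from_inside(2)[of "b + \<epsilon>" ?X \<omega> r R, OF cont r(1) r(3) r(4) this]
        have nX: "norm (?X r \<omega>) \<le> R" using R_pos by auto
        have "(norm (?X r \<omega>))\<^sup>2 / (1 + \<beta> * (r - b)) \<le> R\<^sup>2 / 1"
          using nX r(1) \<epsilon> \<beta>_pos by (intro frac_le power_mono) auto
        moreover have "a \<le> norm (Z \<omega> - x)"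
          using True norm_triangle_ineq2[of x "Z \<omega>"] by (simp add: Z punctured_ball_def a_def
              norm_minus_commute)
        then have "R\<^sup>2 \<le> R\<^sup>2 / a ^ 4 * (norm (Z \<omega> - x)) ^ 4"
          using a mult_left_mono[OF power_mono[of a "norm (Z \<omega> - x)" 4], of "R\<^sup>2 / a ^ 4"] by simp
        ultimately have "(norm (?X r \<omega>))\<^sup>2 / (1 + \<beta> * (r - b)) \<le> R\<^sup>2 / a ^ 4 * (norm (Z \<omega> - x)) ^
            4" by simp
        then have "gain b ?X (exit_time ?X ?C (b + \<epsilon>)) \<omega> \<le> ennreal (R\<^sup>2 / a ^ 4) * ennreal ((norm
            (Z \<omega> - x)) ^ 4)"
          unfolding gain using a by (simp add: ennreal_mult'[symmetric] ennreal_leI)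
        then show ?thesis unfolding G_def by (rule add_increasing2[rotated]) simp
      next
        case False
        then have "r = b + \<epsilon>" using r(1) r(4)[of "b + \<epsilon>"] by force
        then have "gain b ?X (exit_time ?X ?C (b + \<epsilon>)) \<omega> = ennreal (1 / (1 + \<beta> * \<epsilon>)) * ennreal
            ((norm (Z \<omega>))\<^sup>2)"
          unfolding gain Z using p by (simp add: ennreal_mult'[symmetric])
        then show ?thesis unfolding G_def by (simp add: add_increasing)
      qed
    qed (simp add: gain_def)
    have G_meas: "G \<in> borel_measurable borel" unfolding G_def[abs_def] by measurable
    have "(\<integral>\<^sup>+\<omega>. gain b ?X (exit_time ?X ?C (b + \<epsilon>)) \<omega> \<partial>M) \<le> (\<integral>\<^sup>+\<omega>. G (Z \<omega>) \<partial>M)"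
      by (rule nn_integral_mono) (rule pt)
    also have "\<dots> = (\<integral>\<^sup>+d. G (x + d) \<partial>gauss2 (\<theta> * sqrt \<epsilon>))"
      unfolding Z_def by (rule distr_perturbed(2)[OF b \<epsilon> \<theta>_pos G_meas])
    also have "\<dots> = ennreal (R\<^sup>2 / a ^ 4) * (\<integral>\<^sup>+d. ennreal ((norm d) ^ 4) \<partial>gauss2 (\<theta> * sqrt \<epsilon>)) +
        ennreal (1 / (1 + \<beta> * \<epsilon>)) * (\<integral>\<^sup>+d. ennreal ((norm (x + d))\<^sup>2) \<partial>gauss2 (\<theta> * sqrt \<epsilon>))"
      unfolding G_def by (simp add: nn_integral_add nn_integral_cmult)
    also have "\<dots> \<le> ennreal (R\<^sup>2 / a ^ 4) * ennreal (12 * (\<theta> * sqrt \<epsilon>) ^ 4) + ennreal (1 / (1 + \<beta> *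
        \<epsilon>)) * ennreal ((norm x)\<^sup>2 + 2 * (\<theta> * sqrt \<epsilon>)\<^sup>2)"
      unfolding gauss2_norm2_shift[OF s] using gauss2_norm4[OF s] by (intro add_mono
          mult_left_mono) auto
    also have "\<dots> = ennreal (\<epsilon> * m \<epsilon> + ((norm x)\<^sup>2 + 2 * \<theta>\<^sup>2 * \<epsilon>) / (1 + \<beta> * \<epsilon>))"
    proof -
      have "(sqrt \<epsilon>) ^ 4 = ((sqrt \<epsilon>)\<^sup>2)\<^sup>2" by (simp only: power_mult[symmetric]) simp
      then have 1: "R\<^sup>2 / a ^ 4 * (12 * (\<theta> * sqrt \<epsilon>) ^ 4) = \<epsilon> * m \<epsilon>"
        using \<epsilon> by (simp add: m_def power_mult_distrib power2_eq_square)
      have 2: "1 / (1 + \<beta> * \<epsilon>) * ((norm x)\<^sup>2 + 2 * (\<theta> * sqrt \<epsilon>)\<^sup>2) = ((norm x)\<^sup>2 + 2 * \<theta>\<^sup>2 * \<epsilon>) /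
          (1 + \<beta> * \<epsilon>)"
        using \<epsilon> by (simp add: power_mult_distrib)
      have "ennreal (R\<^sup>2 / a ^ 4) * ennreal (12 * (\<theta> * sqrt \<epsilon>) ^ 4) = ennreal (\<epsilon> * m \<epsilon>)"
        unfolding 1[symmetric] using a by (intro ennreal_mult'[symmetric]) simp
      moreover have "ennreal (1 / (1 + \<beta> * \<epsilon>)) * ennreal ((norm x)\<^sup>2 + 2 * (\<theta> * sqrt \<epsilon>)\<^sup>2) =
          ennreal (((norm x)\<^sup>2 + 2 * \<theta>\<^sup>2 * \<epsilon>) / (1 + \<beta> * \<epsilon>))"
        unfolding 2[symmetric] using p by (intro ennreal_mult'[symmetric]) simp
      moreover have "0 \<le> \<epsilon> * m \<epsilon>" using \<epsilon> a by (simp add: m_def)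
      moreover have "0 \<le> ((norm x)\<^sup>2 + 2 * \<theta>\<^sup>2 * \<epsilon>) / (1 + \<beta> * \<epsilon>)" using p \<epsilon> by simp
      ultimately show ?thesis by simp
    qed
    also have "\<dots> \<le> ennreal ((norm x)\<^sup>2 + \<epsilon> * m \<epsilon>)"
    proof (rule ennreal_leI)
      have "4 \<le> t" by (rule t_star_ge_4[OF t_star])
      then have "\<theta>\<^sup>2 * 4 \<le> \<theta>\<^sup>2 * t" by (intro mult_left_mono) auto
      \<comment> \<open>\<beta> R^2 = \<theta>^2 t / 2 turns 4 \<le> t into a comparison of drift
        and discount rate.\<close>
      then have "2 * \<theta>\<^sup>2 \<le> \<beta> * R\<^sup>2" unfolding R_sq using \<beta>_pos by (simp add: field_simps)
      also have "\<dots> \<le> \<beta> * (norm x)\<^sup>2" using x R_pos \<beta>_pos by (intro mult_left_mono power_mono) auto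
      finally have "2 * \<theta>\<^sup>2 * \<epsilon> \<le> \<beta> * (norm x)\<^sup>2 * \<epsilon>" using \<epsilon> by (intro mult_right_mono) auto
      then have "(norm x)\<^sup>2 + 2 * \<theta>\<^sup>2 * \<epsilon> \<le> (norm x)\<^sup>2 * (1 + \<beta> * \<epsilon>)" by (simp add: algebra_simps)
      then have "((norm x)\<^sup>2 + 2 * \<theta>\<^sup>2 * \<epsilon>) / (1 + \<beta> * \<epsilon>) \<le> (norm x)\<^sup>2"
        using p by (simp add: pos_divide_le_eq)
      then show "\<epsilon> * m \<epsilon> + ((norm x)\<^sup>2 + 2 * \<theta>\<^sup>2 * \<epsilon>) / (1 + \<beta> * \<epsilon>) \<le> (norm x)\<^sup>2 + \<epsilon> * m \<epsilon>" by simp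
    qed
    finally show "(\<integral>\<^sup>+\<omega>. gain b ?X (exit_time ?X ?C (b + \<epsilon>)) \<omega> \<partial>M) \<le> ennreal ((norm x)\<^sup>2 + \<epsilon> * m \<epsilon>)" .
  qed simp
qed

lemma equilibrium_ball: "equilibrium M W1 W2 \<beta> \<theta> \<theta> (punctured_ball R)"
  unfolding equilibrium_def Let_def
proof (intro conjI ballI allI impI)
  show "\<theta> \<in> {0<..\<theta>}" using \<theta>_pos by simp
  have "punctured_ball R \<subseteq> state_space"
    by (auto simp: punctured_ball_def state_space_def zero_prod_def[symmetric])
  then have "punctured_ball R = state_space \<inter> punctured_ball R" by auto
  then show "openin (top_of_set state_space) (punctured_ball R)"
    using openin_open_Int[OF open_punctured_ball] by metis
  have nz: "x \<noteq> 0" if "x \<in> state_space" for x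
    using that by (auto simp: state_space_def zero_prod_def)
  fix b :: real assume b: "0 \<le> b"
  show "ereal ((norm x)\<^sup>2) \<le> payoff M \<beta> b (state W1 W2 \<theta> b x) (exit_time (state W1 W2 \<theta> b x)
      (punctured_ball R) b)"
    if "x \<in> state_space" for x
  proof -
    have "enn2ereal (ennreal ((norm x)\<^sup>2)) \<le> enn2ereal (J b x)"
      using J_ge_norm2[OF b nz[OF that]] by (simp only: less_eq_ennreal.rep_eq)
    then show ?thesis by (simp add: payoff_gain enn2ereal_ennreal)
  qed
  show "Limsup (at_right 0) (\<lambda>\<epsilon>. ereal (inverse \<epsilon>) *
     (payoff M \<beta> b (state W1 W2 \<theta> b x) (exit_time (state W1 W2 \<theta> b x) (punctured_ball R) (b + \<epsilon>)) -
      payoff M \<beta> b (state W1 W2 \<theta> b x) (exit_time (state W1 W2 \<theta> b x) (punctured_ball R) b))) \<le> 0"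
    if "x \<in> state_space" for x
    unfolding payoff_gain[of b _ "exit_time _ _ b"]
    \<comment> \<open>On the circle and inside, the bound through \<open>H\<close> applies; strictly
      outside, the exact second moment.\<close>
    using later_stopping_inside[OF b nz[OF that]] later_stopping_outside[OF b, of x]
    by (cases "norm x \<le> R") (auto simp: not_le)
  show "Limsup (at_right 0) (\<lambda>\<epsilon>. ereal (inverse \<epsilon>) *
     (payoff M \<beta> b (perturbed_state W1 W2 \<theta> \<epsilon> \<theta>' b x) (exit_time (perturbed_state W1 W2 \<theta> \<epsilon> \<theta>' b x)
         (punctured_ball R) b) -
      payoff M \<beta> b (state W1 W2 \<theta> b x) (exit_time (state W1 W2 \<theta> b x) (punctured_ball R) b))) \<le> 0"
    if "x \<in> punctured_ball R" "\<theta>' \<in> {0<..\<theta>}" for x \<theta>'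
    using perturbed_control[OF b that(1), of \<theta>'] that(2)
    unfolding payoff_gain[of b "state W1 W2 \<theta> b x"] by auto
qed

end

theorem proposition4p7:
  fixes M :: "'a measure" and W1 W2 :: "real \<Rightarrow> 'a \<Rightarrow> real" and \<theta>0 \<beta> :: real
  assumes "\<theta>0 > 0" and "\<beta> > 0"
    and "planar_brownian_motion M W1 W2"
  shows "(\<exists>!t. is_t_star t) \<and>
    (\<forall>t. is_t_star t \<longrightarrow>
       equilibrium M W1 W2 \<beta> \<theta>0 \<theta>0 (punctured_ball (\<theta>0 * sqrt (t / (2 * \<beta>)))))"
proof (intro conjI allI impI)
  show "\<exists>!t. is_t_star t" by (rule ex1_t_star)
  fix t assume t: "is_t_star t"
  interpret prob_space M
    using assms(3) by (simp add: planar_brownian_motion_def brownian_motion_def)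
  interpret equilibrium_problem M W1 W2 \<theta>0 \<beta> t
    by unfold_locales (use assms t in auto)
  show "equilibrium M W1 W2 \<beta> \<theta>0 \<theta>0 (punctured_ball (\<theta>0 * sqrt (t / (2 * \<beta>))))"
    using equilibrium_ball by (simp add: R_def)
qed

end
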